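(* Let $1\le k\le n$, let $D\in\mathbb{R}^{n\times k}$, and let $\mathcal{X}$ and $\widetilde{\mathcal{X}}$ be $k$-dimensional subspaces of $\mathbb{R}^n$. Let $X,\widetilde X\in\mathbb{R}^{n\times k}$ satisfy $X^{\mathrm T}X=\widetilde X^{\mathrm T}\widetilde X=I_k$, with column spaces $\mathcal{R}(X)=\mathcal{X}$ and $\mathcal{R}(\widetilde X)=\widetilde{\mathcal{X}}$, and suppose that both $X^{\mathrm T}D$ and $\widetilde X^{\mathrm T}D$ are (symmetric) positive semidefinite. Suppose that $\operatorname{rank}(X^{\mathrm T}D)=\operatorname{rank}(\widetilde X^{\mathrm T}D)=:r$ with $r\ge 1$. Let $\sigma_1\ge\cdots\ge\sigma_r>0$ and $\tilde\sigma_1\ge\cdots\ge\tilde\sigma_r>0$ be the nonzero singular values of $X^{\mathrm T}D$ and $\widetilde X^{\mathrm T}D$, respectively. Let $$X^{\mathrm T}D=[V_1,V_2]\begin{bmatrix}\Sigma_1&0\\0&0\end{bmatrix}[V_1,V_2]^{\mathrm T},\qquad \Sigma_1=\operatorname{diag}(\sigma_1,\dots,\sigma_r),$$ where $[V_1,V_2]\in\mathbb{R}^{k\times k}$ is orthogonal, $V_1\in\mathbb{R}^{k\times r}$ and $V_2\in\mathbb{R}^{k\times (k-r)}$, and define $$\mathbb{X}=\left\{XV_1V_1^{\mathrm T}+XV_2WV_2^{\mathrm T}\,:\,W\in\mathbb{R}^{(k-r)\times(k-r)},\ W^{\mathrm T}W=I_{k-r}\right\}$$ (so that $\mathbb{X}=\{X\}$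 if $r=k$). Then for any unitarily invariant norm $\|\cdot\|_{\mathrm{ui}}$, $$\min_{Y\in\mathbb{X}}\|\widetilde X-Y\|_{\mathrm{ui}}\le\eta\,\|\sin\Theta(\mathcal{X},\widetilde{\mathcal{X}})\|_{\mathrm{ui}},\qquad( * )$$ where $$\eta=\begin{cases}\sqrt2\left(1+\dfrac{2\|D\|_2}{\sigma_k+\tilde\sigma_k}\right),&\text{if } r=k,\\[1em]\sqrt2\left(1+\dfrac{2\|D\|_2}{\sigma_r+\tilde\sigma_r}\right)+\dfrac{(2\sqrt2+4)\|D\|_2}{\max\{\sigma_r,\tilde\sigma_r\}},&\text{if } r<k.\end{cases}$$ Moreover, in the case $r<k$, inequality $( * )$ holds for the Frobenius norm $\|\cdot\|_{\mathrm{ui}}=\|\cdot\|_{\mathrm F}$ with the smaller constant $$\eta=\sqrt2\left(1+\frac{2\|D\|_2}{\sigma_r+\tilde\sigma_r}\right)+\frac{4\|D\|_2}{\max\{\sigma_r,\tilde\sigma_r\}},$$ and for the spectral norm $\|\cdot\|_{\mathrm{ui}}=\|\cdot\|_2$ with the smaller constant $$\eta=\sqrt2+\sqrt{\frac{8\|D\|_2^2}{(\sigma_r+\tilde\sigma_r)^2}+\frac{4\|D\|_2^2}{[\max\{\sigma_r,\tilde\sigma_r\}]^2}}+\frac{4\|D\|_2}{\max\{\sigma_r,\tilde\sigma_r\}}.$$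
   Context: Canonical angles: for $k$-dimensional subspaces $\mathcal{X},\widetilde{\mathcal{X}}$ of $\mathbb{R}^n$ with orthonormal basis matrices $X,\widetilde X\in\mathbb{R}^{n\times k}$, let $\omega_1\ge\dots\ge\omega_k$ be the singular values of $X^{\mathrm T}\widetilde X$ and set $\theta_i=\arccos(\omega_{k-i+1})\in[0,\pi/2]$ for $1\le i\le k$. Then $\Theta(\mathcal{X},\widetilde{\mathcal{X}})=\operatorname{diag}(\theta_1,\dots,\theta_k)$ (independent of the choice of orthonormal bases) and $\sin\Theta(\mathcal{X},\widetilde{\mathcal{X}})=\operatorname{diag}(\sin\theta_1,\dots,\sin\theta_k)$. Norms: $\|\cdot\|_2$ is the spectral norm (largest singular value) and $\|\cdot\|_{\mathrm F}$ is the Frobenius norm. A unitarily invariant norm $\|\cdot\|_{\mathrm{ui}}$ is assumed to be dimension-free, i.e., applied consistently to matrices of all sizes: it is induced by a symmetric gauge function $\Phi$ on $\mathbb{R}^N$ (a norm on $\mathbb{R}^N$ invariant under permutations and sign changes of the coordinates), with $N$ at least as large as the number of rows and columns of every matrix involved, by $\|B\|_{\mathrm{ui}}=\Phi(\sigma_1(B),\sigma_2(B),\dots,0,\dots,0)$, where the list of singular values of $B$ is padded with zeros to length $N$. *)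

theory Defs
  imports
    Complex_Main
    "HOL-Combinatorics.Permutations"
    "Jordan_Normal_Form.Char_Poly"
    "Jordan_Normal_Form.DL_Rank"
begin

text \<open>Sizes of matrices and dimensions of subspaces depend on the rank \<open>r\<close>, so everything is
  phrased with the carrier-based matrices and vectors of Jordan_Normal_Form. All indices are
  0-based: the mathematical index \<open>i\<close> becomes \<open>i - 1\<close>.\<close>

text \<open>The square roots of the eigenvalues of \<open>A\<^sup>T A\<close>, repeated by algebraic multiplicity, in
  decreasing order. A matrix with more columns than rows has \<open>dim_col A\<close> such roots; the truncation
  removes the surplus zeros and leaves the usual \<open>min (dim_row A) (dim_col A)\<close> values.\<close>

definition singular_values :: "real mat \<Rightarrow> real list" where
  "singular_values A =
     take (min (dim_row A) (dim_col A))
       (rev (sorted_list_of_multiset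
          (image_mset sqrt (proots (char_poly (transpose_mat A * A))))))"

definition nonzero_singular_values :: "real mat \<Rightarrow> real list" where
  "nonzero_singular_values A = filter (\<lambda>s. s \<noteq> 0) (singular_values A)"

text \<open>The \<open>insert 0\<close> only matters for matrices without rows or columns.\<close>

definition spectral_norm :: "real mat \<Rightarrow> real" where
  "spectral_norm A = Max (insert 0 (set (singular_values A)))"

definition frobenius_norm :: "real mat \<Rightarrow> real" where
  "frobenius_norm A = sqrt (\<Sum>i<dim_row A. \<Sum>j<dim_col A. (A $$ (i, j))\<^sup>2)"

definition symmetric_gauge :: "nat \<Rightarrow> (real vec \<Rightarrow> real) \<Rightarrow> bool" where
  "symmetric_gauge N \<Phi> \<longleftrightarrow>
     (\<forall>x \<in> carrier_vec N. 0 \<le> \<Phi> x) \<and>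
     (\<forall>x \<in> carrier_vec N. \<Phi> x = 0 \<longleftrightarrow> x = 0\<^sub>v N) \<and>
     (\<forall>c. \<forall>x \<in> carrier_vec N. \<Phi> (c \<cdot>\<^sub>v x) = \<bar>c\<bar> * \<Phi> x) \<and>
     (\<forall>x \<in> carrier_vec N. \<forall>y \<in> carrier_vec N. \<Phi> (x + y) \<le> \<Phi> x + \<Phi> y) \<and>
     (\<forall>p. \<forall>x \<in> carrier_vec N. p permutes {..<N} \<longrightarrow> \<Phi> (vec N (\<lambda>i. x $ p i)) = \<Phi> x) \<and>
     (\<forall>s. \<forall>x \<in> carrier_vec N. (\<forall>i<N. s i = 1 \<or> s i = -1) \<longrightarrow>
        \<Phi> (vec N (\<lambda>i. s i * x $ i)) = \<Phi> x)"

text \<open>The unitarily invariant norm induced by a gauge \<open>\<Phi>\<close> on \<open>\<real>\<^sup>N\<close>, meant for matrices with at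
  most \<open>N\<close> rows and columns.\<close>

definition ui_norm :: "nat \<Rightarrow> (real vec \<Rightarrow> real) \<Rightarrow> real mat \<Rightarrow> real" where
  "ui_norm N \<Phi> B =
     \<Phi> (vec N (\<lambda>i. if i < length (singular_values B) then singular_values B ! i else 0))"

definition psd :: "real mat \<Rightarrow> bool" where
  "psd A \<longleftrightarrow> square_mat A \<and> transpose_mat A = A \<and>
     (\<forall>v \<in> carrier_vec (dim_row A). 0 \<le> v \<bullet> (A *\<^sub>v v))"

definition subspace_of_dim :: "nat \<Rightarrow> nat \<Rightarrow> real vec set \<Rightarrow> bool" where
  "subspace_of_dim n k S \<longleftrightarrow>
     VectorSpace.subspace class_ring S (module_vec TYPE(real) n) \<and>
     vectorspace.dim class_ring ((module_vec TYPE(real) n)\<lparr>carrier := S\<rparr>) = k"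

definition orthonormal_basis_mat :: "nat \<Rightarrow> nat \<Rightarrow> real vec set \<Rightarrow> real mat \<Rightarrow> bool" where
  "orthonormal_basis_mat n k S X \<longleftrightarrow>
     X \<in> carrier_mat n k \<and> transpose_mat X * X = 1\<^sub>m k \<and> vec_space.col_space n X = S"

text \<open>Canonical angles between two \<open>k\<close>-dimensional subspaces of \<open>\<real>\<^sup>n\<close>. They do not depend on the
  orthonormal bases, so arbitrary ones are chosen. For \<open>i < k\<close>, \<open>canonical_angle n k S T i\<close> is
  \<open>\<theta>\<^bsub>i+1\<^esub> = arccos \<omega>\<^bsub>k-i\<^esub>\<close> in the usual 1-based numbering.\<close>

definition canonical_angle ::
  "nat \<Rightarrow> nat \<Rightarrow> real vec set \<Rightarrow> real vec set \<Rightarrow> nat \<Rightarrow> real" where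
  "canonical_angle n k S T i =
     (let X = (SOME X. orthonormal_basis_mat n k S X);
          Y = (SOME Y. orthonormal_basis_mat n k T Y)
      in arccos (singular_values (transpose_mat X * Y) ! (k - 1 - i)))"

definition sin_Theta :: "nat \<Rightarrow> nat \<Rightarrow> real vec set \<Rightarrow> real vec set \<Rightarrow> real mat" where
  "sin_Theta n k S T = mat_diag k (\<lambda>i. sin (canonical_angle n k S T i))"

text \<open>The block row \<open>[A, B]\<close>, for matrices with the same number of rows.\<close>

definition append_cols :: "real mat \<Rightarrow> real mat \<Rightarrow> real mat" where
  "append_cols A B = four_block_mat A B (0\<^sub>m 0 (dim_col A)) (0\<^sub>m 0 (dim_col B))"

text \<open>The set \<open>{X V\<^sub>1 V\<^sub>1\<^sup>T + X V\<^sub>2 W V\<^sub>2\<^sup>T | W orthogonal}\<close>, where \<open>V\<^sub>2\<close> has \<open>m\<close> columns.\<close>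

definition basis_family :: "nat \<Rightarrow> real mat \<Rightarrow> real mat \<Rightarrow> real mat \<Rightarrow> real mat set" where
  "basis_family m X V1 V2 =
     {X * V1 * transpose_mat V1 + X * V2 * W * transpose_mat V2 | W.
        W \<in> carrier_mat m m \<and> transpose_mat W * W = 1\<^sub>m m}"

text \<open>\<open>min f(A) \<le> c\<close>, including the claim that the minimum is attained.\<close>

definition minimum_le :: "('a \<Rightarrow> real) \<Rightarrow> 'a set \<Rightarrow> real \<Rightarrow> bool" where
  "minimum_le f A c \<longleftrightarrow> (\<exists>y \<in> A. (\<forall>z \<in> A. f y \<le> f z) \<and> f y \<le> c)"

end

(* Let Q be the orthogonal polar factor of X^T X' and U = Q^T. Since 1 - cos t <= sin^2 t for
   t in [0, pi/2], the aligned basis satisfies |X' - X Q| <= sqrt 2 |sin Theta|, hence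
   E = U A - A' = (X Q - X')^T D, with A = X^T D and A' = X'^T D, has norm at most
   sqrt 2 |D|_2 |sin Theta|. Let P and P' be the orthogonal projections onto the ranges of A and A'.
   The matrix U P - P' splits into three mutually orthogonal blocks: T = P' U P - P' P, which solves
   the Sylvester equation T A + A' T = P' (E - E^T U) P, and the off-diagonal blocks P' (I - P) and
   (I - P') U P. The latter are bounded by both |E| / sigma_r and |E| / sigma'_r, because
   E (I - P) = - A' (I - P) and (I - P') E = (I - P') U A, and because the sines between two ranges
   of equal dimension do not depend on which range is projected on the complement of the other.
   A second polar alignment, now of the kernels, chooses the free orthogonal factor W.

   The only properties of the norm used are the triangle inequality, homogeneity, invariance under
   transposition, and monotonicity: |B v| <= |C v| for all v implies |B| <= |C|. For norms induced
   by a symmetric gauge the triangle inequality is the one of Ky Fan, combined with weak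
   majorization; the other properties follow from the minimax principle for singular values. *)
theory Submission
  imports Defs "HOL-Analysis.L2_Norm"
begin

text \<open>The polar factor \<open>Q\<close> cannot be used as it stands: a member of the family is
  \<open>X\<close> times a matrix that is the identity on the range of \<open>A\<close> and
  orthogonal on its kernel, whereas \<open>Q\<close> mixes the two. With
  \<open>Z = V2 * W * V2\<^sup>T\<close> the defect is
  \<open>Q - P - Z = Q * (P' - U * P) + (Q * Pc' - Z)\<close>: a perturbation of the range and an
  alignment of the kernels. The kernel of \<open>A'\<close> and its image under \<open>Q\<close> are
  both close to the kernel of \<open>A\<close>; each is aligned with it separately, and the two
  factors combine to \<open>W\<close>. Constants, with d = |D|_2 and M = max s s': \<open>T\<close>
  costs 2 sqrt 2 d / (s + s'), since two errors of norm sqrt 2 d |sin Theta| enter its equation.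
  Each off-diagonal block costs sqrt 2 d / M, once in \<open>U * P - P'\<close> and once more, times
  sqrt 2, in the kernels; two blocks give 2 sqrt 2 + 4. In the Frobenius norm all blocks of
  \<open>U * P - P'\<close> fit into the constant of \<open>T\<close>; in the spectral norm the
  squares of the three block norms add up. All spectral facts rest on a minimum over the orthogonal
  group, which exists by compactness; the same compactness makes the minimum over the family
  attained.\<close>

section \<open>Orthogonal matrices and singular values\<close>

text \<open>Bolzano-Weierstrass in finitely many coordinates: a monotone, hence convergent,
  subsequence is extracted for the new coordinate, and the limits already found survive the passage
  to it.\<close>

lemma simultaneous_convergent_subsequence:
  fixes x :: "nat \<Rightarrow> 'a \<Rightarrow> real"
  assumes "finite I" and "\<And>n i. i \<in> I \<Longrightarrow> \<bar>x n i\<bar> \<le> C"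
  shows "\<exists>r L. strict_mono (r :: nat \<Rightarrow> nat) \<and> (\<forall>i\<in>I. (\<lambda>n. x (r n) i) \<longlonglongrightarrow> L i)"
  using assms
proof (induction I rule: finite_induct)
  case empty
  show ?case using strict_mono_id by auto
next
  case (insert j I)
  have "\<exists>r L. strict_mono (r :: nat \<Rightarrow> nat) \<and> (\<forall>i\<in>I. (\<lambda>n. x (r n) i) \<longlonglongrightarrow> L i)"
    by (rule insert.IH) (use insert.prems in auto)
  then obtain r L where r: "strict_mono (r :: nat \<Rightarrow> nat)"
    and L: "\<And>i. i \<in> I \<Longrightarrow> (\<lambda>n. x (r n) i) \<longlonglongrightarrow> L i"
    by auto
  obtain f where f: "strict_mono (f :: nat \<Rightarrow> nat)" "monoseq (\<lambda>n. x (r (f n)) j)"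
    using seq_monosub[of "\<lambda>n. x (r n) j"] by blast
  have "Bseq (\<lambda>n. x (r (f n)) j)"
    by (rule BseqI'[of _ C]) (use insert.prems in auto)
  then obtain l where l: "(\<lambda>n. x (r (f n)) j) \<longlonglongrightarrow> l"
    using f(2) Bseq_monoseq_convergent convergent_def by blast
  have "(\<lambda>n. x ((r \<circ> f) n) i) \<longlonglongrightarrow> (L(j := l)) i" if "i \<in> insert j I" for i
  proof (cases "i = j")
    case True then show ?thesis using l by simp
  next
    case False
    then show ?thesis using that LIMSEQ_subseq_LIMSEQ[OF L f(1)] by (auto simp: o_def)
  qed
  then have "\<forall>i\<in>insert j I. (\<lambda>n. x ((r \<circ> f) n) i) \<longlonglongrightarrow> (L(j := l)) i" by blast
  then show ?case using strict_mono_o[OF r f(1)] by blast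
qed

definition orth_mat :: "nat \<Rightarrow> real mat \<Rightarrow> bool" where
  "orth_mat c V \<longleftrightarrow> V \<in> carrier_mat c c \<and> V\<^sup>T * V = 1\<^sub>m c"

lemma orth_matD:
  assumes "orth_mat c V"
  shows "V \<in> carrier_mat c c" "V\<^sup>T * V = 1\<^sub>m c" "V * V\<^sup>T = 1\<^sub>m c"
  using assms mat_mult_left_right_inverse[of "V\<^sup>T" c V]
  unfolding orth_mat_def by auto

text \<open>The entrywise polynomial form lets orthogonality pass to entrywise limits.\<close>

lemma orth_mat_entries:
  "orth_mat c V \<longleftrightarrow> V \<in> carrier_mat c c \<and>
     (\<forall>i<c. \<forall>j<c. (\<Sum>p<c. V $$ (p,i) * V $$ (p,j)) = (if i = j then 1 else 0))"
proof (cases "V \<in> carrier_mat c c")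
  case True
  have "(V\<^sup>T * V) $$ (i,j) = (\<Sum>p<c. V $$ (p,i) * V $$ (p,j))" if "i < c" "j < c" for i j
    using True that by (simp add: scalar_prod_def lessThan_atLeast0)
  then have "V\<^sup>T * V = 1\<^sub>m c \<longleftrightarrow>
      (\<forall>i<c. \<forall>j<c. (\<Sum>p<c. V $$ (p,i) * V $$ (p,j)) = (if i = j then 1 else 0))"
    using True unfolding mat_eq_iff by simp
  then show ?thesis using True unfolding orth_mat_def by blast
qed (simp add: orth_mat_def)

lemma orth_mat_transpose:
  assumes "orth_mat c V"
  shows "orth_mat c (V\<^sup>T)"
  unfolding orth_mat_def using orth_matD[OF assms] by simp

lemma orth_mat_one [simp]: "orth_mat c (1\<^sub>m c)"
  by (simp add: orth_mat_def)

lemma orth_mat_mult: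
  assumes "orth_mat c U" "orth_mat c V"
  shows "orth_mat c (U * V)"
proof -
  note U = orth_matD[OF assms(1)] and V = orth_matD[OF assms(2)]
  have "(U * V)\<^sup>T * (U * V) = V\<^sup>T * ((U\<^sup>T * U) * V)"
    using U(1) V(1) by (simp add: transpose_mult[of _ c c _ c] assoc_mult_mat[of _ c c _ c _ c])
  then show ?thesis using U V by (simp add: orth_mat_def)
qed

lemma orth_mat_entry_bound:
  assumes "orth_mat c V" "i < c" "j < c"
  shows "\<bar>V $$ (i,j)\<bar> \<le> 1"
proof -
  have "V $$ (i,j) * V $$ (i,j) \<le> (\<Sum>p<c. V $$ (p,j) * V $$ (p,j))"
    by (rule member_le_sum[of i "{..<c}" "\<lambda>p. V $$ (p,j) * V $$ (p,j)"]) (use assms in auto)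
  also have "\<dots> = 1" using assms unfolding orth_mat_entries by auto
  finally show ?thesis using abs_square_le_1[of "V $$ (i,j)"] unfolding power2_eq_square by blast
qed

text \<open>The entries of orthogonal matrices lie in [-1, 1], so a minimising sequence has an
  entrywise convergent subsequence, and its limit is again orthogonal. Applied to a quadratic
  objective in order to diagonalise Gram matrices, and later to the distance from a basis
  family.\<close>

lemma attains_min_on_orthogonal:
  fixes f :: "real mat \<Rightarrow> real"
  assumes nonneg: "\<And>V. orth_mat c V \<Longrightarrow> 0 \<le> f V"
    and cont: "\<And>V L. (\<And>n. orth_mat c (V n)) \<Longrightarrow> orth_mat c L \<Longrightarrow>
      (\<And>i j. i < c \<Longrightarrow> j < c \<Longrightarrow> (\<lambda>n. V n $$ (i,j)) \<longlonglongrightarrow> L $$ (i,j)) \<Longrightarrow>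
      (\<lambda>n. f (V n)) \<longlonglongrightarrow> f L"
  shows "\<exists>V. orth_mat c V \<and> (\<forall>Z. orth_mat c Z \<longrightarrow> f V \<le> f Z)"
proof -
  let ?S = "f ` Collect (orth_mat c)"
  define m where "m = Inf ?S"
  have ne: "?S \<noteq> {}" using orth_mat_one by blast
  have bdd: "bdd_below ?S" by (rule bdd_belowI[of _ 0]) (use nonneg in auto)
  have "\<exists>V. orth_mat c V \<and> f V < m + inverse (real (Suc n))" for n
    using cInf_less_iff[OF ne bdd, of "m + inverse (real (Suc n))"] by (auto simp: m_def)
  then obtain V where V: "\<And>n. orth_mat c (V n)" "\<And>n. f (V n) < m + inverse (real (Suc n))"
    by metis
  have low: "m \<le> f Z" if "orth_mat c Z" for Z
    unfolding m_def by (rule cInf_lower[OF _ bdd]) (use that in auto)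
  have lim: "(\<lambda>n. f (V n)) \<longlonglongrightarrow> m"
  proof (rule tendsto_sandwich[of "\<lambda>_. m" _ _ "\<lambda>n. m + inverse (real (Suc n))"])
    show "(\<lambda>n. m + inverse (real (Suc n))) \<longlonglongrightarrow> m"
      using LIMSEQ_inverse_real_of_nat_add by simp
  qed (use V low in \<open>auto intro!: always_eventually less_imp_le\<close>)
  obtain r L where r: "strict_mono (r :: nat \<Rightarrow> nat)"
    and L: "\<forall>i\<in>{..<c} \<times> {..<c}. (\<lambda>n. V (r n) $$ i) \<longlonglongrightarrow> L i"
    using simultaneous_convergent_subsequence[of "{..<c} \<times> {..<c}" "\<lambda>n i. V n $$ i" 1]
      orth_mat_entry_bound[OF V(1)] by auto
  define W where "W = mat c c L"
  have W: "(\<lambda>n. V (r n) $$ (i,j)) \<longlonglongrightarrow> W $$ (i,j)" if "i < c" "j < c" for i j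
    using L that by (auto simp: W_def)
  have "(\<Sum>p<c. W $$ (p,i) * W $$ (p,j)) = (if i = j then 1 else 0)" if ij: "i < c" "j < c" for i j
  proof -
    have "(\<lambda>n. \<Sum>p<c. V (r n) $$ (p,i) * V (r n) $$ (p,j)) \<longlonglongrightarrow> (\<Sum>p<c. W $$ (p,i) * W $$ (p,j))"
      by (intro tendsto_sum tendsto_mult W) (use ij in auto)
    moreover have "(\<Sum>p<c. V (r n) $$ (p,i) * V (r n) $$ (p,j)) = (if i = j then 1 else 0)" for n
      using V(1)[of "r n"] ij unfolding orth_mat_entries by blast
    ultimately have "(\<lambda>_::nat. if i = j then 1 else 0 :: real) \<longlonglongrightarrow> (\<Sum>p<c. W $$ (p,i) * W $$ (p,j))"
      by simp
    then show ?thesis by (rule LIMSEQ_unique[OF _ tendsto_const])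
  qed
  then have oW: "orth_mat c W" unfolding orth_mat_entries by (simp add: W_def)
  have "(\<lambda>n. f (V (r n))) \<longlonglongrightarrow> f W"
    by (rule cont) (use V oW W in auto)
  moreover have "(\<lambda>n. f (V (r n))) \<longlonglongrightarrow> m"
    using LIMSEQ_subseq_LIMSEQ[OF lim r] by (simp add: o_def)
  ultimately have "f W = m" by (rule LIMSEQ_unique)
  then show ?thesis using oW low by auto
qed

section \<open>Diagonalisation of Gram matrices\<close>

lemma scalar_prod_self_nonneg: "0 \<le> (v :: real vec) \<bullet> v"
  by (auto simp: scalar_prod_def intro: sum_nonneg)

lemma scalar_prod_self_eq_0:
  "(v :: real vec) \<in> carrier_vec n \<Longrightarrow> v \<bullet> v = 0 \<longleftrightarrow> v = 0\<^sub>v n"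
  by (auto simp: scalar_prod_def sum_nonneg_eq_0_iff)

text \<open>Near \<open>t = 0\<close> the linear term outweighs the quadratic one unless
  \<open>b\<close> vanishes; the point b / (|a| + 1) is close enough to 0 to show it.\<close>

lemma quadratic_bound_imp_zero:
  fixes a b :: real
  assumes "\<And>t. 2 * t * b \<le> t\<^sup>2 * a"
  shows "b = 0"
proof (rule ccontr)
  assume b: "b \<noteq> 0"
  define s where "s = \<bar>a\<bar> + 1"
  have s: "s > 0" "a < s" by (auto simp: s_def)
  have "2 * (b / s) * b \<le> (b / s)\<^sup>2 * a" by (rule assms)
  also have "\<dots> \<le> (b / s)\<^sup>2 * s" by (intro mult_left_mono) (use s in auto)
  also have "\<dots> = (b / s) * b" using s by (simp add: power2_eq_square)
  finally have "b * b / s \<le> 0" by simp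
  moreover have "0 < b * b" using b not_real_square_gt_zero by blast
  ultimately show False using s by (simp add: divide_le_0_iff)
qed

lemma scalar_prod_mult_mat_vec_self:
  fixes B :: "real mat"
  assumes "B \<in> carrier_mat m c" "v \<in> carrier_vec c"
  shows "(B *\<^sub>v v) \<bullet> (B *\<^sub>v v) = (\<Sum>p<m. (\<Sum>q<c. B $$ (p,q) * v $ q)\<^sup>2)"
  unfolding power2_eq_square lessThan_atLeast0
  using assms by (auto simp: scalar_prod_def intro!: sum.cong)

lemma orth_mat_cols:
  "orth_mat c V \<longleftrightarrow> V \<in> carrier_mat c c \<and>
     (\<forall>i<c. \<forall>j<c. col V i \<bullet> col V j = (if i = j then 1 else 0))"
proof (cases "V \<in> carrier_mat c c")
  case True
  then have "V\<^sup>T * V = 1\<^sub>m c \<longleftrightarrow>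
      (\<forall>i<c. \<forall>j<c. col V i \<bullet> col V j = (if i = j then 1 else 0))"
    unfolding mat_eq_iff by simp
  then show ?thesis using True unfolding orth_mat_def by blast
qed (simp add: orth_mat_def)

text \<open>Jacobi's argument: an orthogonal matrix minimising a weighted sum of the squared column
  norms of \<open>B V\<close> admits no improving plane rotation, which forces the columns to be orthogonal and
  their norms to decrease.\<close>

lemma exists_right_singular_basis:
  fixes B :: "real mat"
  assumes B: "B \<in> carrier_mat m c"
  shows "\<exists>V d. orth_mat c V \<and> (B * V)\<^sup>T * (B * V) = mat_diag c d \<and>
    (\<forall>i<c. 0 \<le> d i) \<and> (\<forall>i j. i \<le> j \<longrightarrow> j < c \<longrightarrow> d j \<le> d i)"
proof -
  define g where "g V l = (\<Sum>p<m. (\<Sum>q<c. B $$ (p,q) * V $$ (q,l))\<^sup>2)" for V :: "real mat" and l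
  \<comment> \<open>The total of \<open>g V l\<close> over \<open>l\<close> is the same for every
    orthogonal \<open>V\<close>; the increasing weight \<open>l\<close> rewards large columns at
    small indices.\<close>
  have "\<exists>V. orth_mat c V \<and>
    (\<forall>Z. orth_mat c Z \<longrightarrow> (\<Sum>l<c. real l * g V l) \<le> (\<Sum>l<c. real l * g Z l))"
    by (rule attains_min_on_orthogonal)
      (auto simp: g_def intro!: sum_nonneg mult_nonneg_nonneg tendsto_intros)
  then obtain V where V: "orth_mat c V"
    and min: "\<And>Z. orth_mat c Z \<Longrightarrow> (\<Sum>l<c. real l * g V l) \<le> (\<Sum>l<c. real l * g Z l)"
    by blast
  note Vc = orth_matD[OF V]
  define b where "b l = B *\<^sub>v col V l" for l
  have bc: "b l \<in> carrier_vec m" if "l < c" for l using B Vc that by (simp add: b_def)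
  have g: "g Z l = (B *\<^sub>v col Z l) \<bullet> (B *\<^sub>v col Z l)" if "Z \<in> carrier_mat c c" "l < c" for Z l
    using scalar_prod_mult_mat_vec_self[OF B, of "col Z l"] that by (simp add: g_def)
  have key: "x\<^sup>2 * (b i \<bullet> b i) + 2 * x * y * (b i \<bullet> b j) + y\<^sup>2 * (b j \<bullet> b j) \<le> b i \<bullet> b i"
    if ij: "i < j" "j < c" and xy: "x\<^sup>2 + y\<^sup>2 = 1" for i j x y
  proof -
    \<comment> \<open>Columns \<open>i\<close> and \<open>j\<close> are transformed within their
      plane by the reflection with rows \<open>(x, y)\<close> and \<open>(y, -x)\<close>; all other
      columns stay.\<close>
    define v where "v = (\<lambda>l. if l = i then x \<cdot>\<^sub>v col V i + y \<cdot>\<^sub>v col V j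
      else if l = j then y \<cdot>\<^sub>v col V i - x \<cdot>\<^sub>v col V j else col V l)"
    define Z where "Z = mat c c (\<lambda>(p,q). v q $ p)"
    have cc: "col V l \<in> carrier_vec c" if "l < c" for l using Vc that by auto
    have vc: "v l \<in> carrier_vec c" if "l < c" for l using cc ij that by (auto simp: v_def)
    have colZ: "col Z l = v l" if "l < c" for l
      using vc[OF that] that by (auto simp: Z_def)
    have on: "col V p \<bullet> col V q = (if p = q then 1 else 0)" if "p < c" "q < c" for p q
      using V that unfolding orth_mat_cols by blast
    note dist = add_scalar_prod_distrib[of _ c] scalar_prod_add_distrib[of _ c]
      minus_scalar_prod_distrib[of _ c] scalar_prod_minus_distrib[of _ c]
      smult_scalar_prod_distrib[of _ c] scalar_prod_smult_distrib[of _ c]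
    have Z: "orth_mat c Z" unfolding orth_mat_cols
    proof (intro conjI allI impI)
      fix p q assume pq: "p < c" "q < c"
      have "v p \<bullet> v q = (if p = q then 1 else 0)"
        using ij pq xy by (auto simp: v_def dist cc on power2_eq_square)
      then show "col Z p \<bullet> col Z q = (if p = q then 1 else 0)" by (simp add: colZ pq)
    qed (simp add: Z_def)
    note dist' = add_scalar_prod_distrib[of _ m] scalar_prod_add_distrib[of _ m]
      minus_scalar_prod_distrib[of _ m] scalar_prod_minus_distrib[of _ m]
      smult_scalar_prod_distrib[of _ m] scalar_prod_smult_distrib[of _ m]
    have ic: "i < c" using ij by simp
    have bs: "b j \<bullet> b i = b i \<bullet> b j" by (rule comm_scalar_prod[OF bc[OF ij(2)] bc[OF ic]])
    have gi: "g Z i = x\<^sup>2 * (b i \<bullet> b i) + 2 * x * y * (b i \<bullet> b j) + y\<^sup>2 * (b j \<bullet> b j)"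
    proof -
      have "B *\<^sub>v v i = x \<cdot>\<^sub>v b i + y \<cdot>\<^sub>v b j"
        using ij B cc by (simp add: v_def b_def mult_add_distrib_mat_vec[of _ m c] mult_mat_vec[of _ m c])
      then show ?thesis using g[of Z i] Z ij bc colZ bs
        by (simp add: dist' orth_matD power2_eq_square algebra_simps)
    qed
    have gj: "g Z j = y\<^sup>2 * (b i \<bullet> b i) - 2 * x * y * (b i \<bullet> b j) + x\<^sup>2 * (b j \<bullet> b j)"
    proof -
      have "B *\<^sub>v v j = y \<cdot>\<^sub>v b i - x \<cdot>\<^sub>v b j"
        using ij B cc by (simp add: v_def b_def mult_minus_distrib_mat_vec[of _ m c] mult_mat_vec[of _ m c])
      then show ?thesis using g[of Z j] Z ij bc colZ bs
        by (simp add: dist' orth_matD power2_eq_square algebra_simps)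
    qed
    have gl: "g Z l = g V l" if "l < c" "l \<noteq> i" "l \<noteq> j" for l
      using g[of Z l] g[of V l] Z Vc that colZ[of l] by (simp add: orth_matD v_def)
    have split: "(\<Sum>l<c. real l * g Y l) = real i * g Y i + real j * g Y j
        + (\<Sum>l\<in>{..<c} - {i,j}. real l * g Y l)" for Y
    proof -
      have "(\<Sum>l<c. real l * g Y l) = (\<Sum>l\<in>{i,j}. real l * g Y l) + (\<Sum>l\<in>{..<c} - {i,j}. real l * g Y l)"
        by (subst add.commute, rule sum.subset_diff) (use ij in auto)
      then show ?thesis using ij by simp
    qed
    have "(\<Sum>l\<in>{..<c} - {i,j}. real l * g Z l) = (\<Sum>l\<in>{..<c} - {i,j}. real l * g V l)"
      by (rule sum.cong) (auto simp: gl)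
    then have le: "real i * g V i + real j * g V j \<le> real i * g Z i + real j * g Z j"
      using min[OF Z] by (simp add: split)
    have tot: "g Z i + g Z j = g V i + g V j"
    proof -
      have "g V i = b i \<bullet> b i" "g V j = b j \<bullet> b j" using g Vc ij by (auto simp: b_def)
      moreover have "g Z i + g Z j = (x\<^sup>2 + y\<^sup>2) * (b i \<bullet> b i) + (x\<^sup>2 + y\<^sup>2) * (b j \<bullet> b j)"
        unfolding gi gj by (simp add: algebra_simps)
      ultimately show ?thesis using xy by simp
    qed
    \<comment> \<open>The two squared norms keep their sum, so the change of the objective depends
      on the change of column \<open>i\<close> alone.\<close>
    have "0 \<le> (real j - real i) * (g V i - g Z i)"
    proof -
      have e: "g Z j = g V i + g V j - g Z i" using tot by simp
      show ?thesis using le unfolding e by (simp add: algebra_simps)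
    qed
    then have "g Z i \<le> g V i" using ij by (simp add: zero_le_mult_iff)
    then show ?thesis using gi g[of V i] Vc ij by (simp add: b_def)
  qed
  have dec: "b j \<bullet> b j \<le> b i \<bullet> b i" if "i \<le> j" "j < c" for i j
  proof (cases "i = j")
    \<comment> \<open>The pair \<open>x = 0\<close>, \<open>y = 1\<close> exchanges the two
      columns.\<close>
    case False then show ?thesis using key[of i j 0 1] that by simp
  qed simp
  have orth: "b i \<bullet> b j = 0" if ij: "i < j" "j < c" for i j
  proof (rule quadratic_bound_imp_zero)
    fix t :: real
    \<comment> \<open>The test pair is the normalised direction \<open>(1, t)\<close>; once the
      denominator is cleared, the terms constant in \<open>t\<close> cancel.\<close>
    define s where "s = sqrt (1 + t\<^sup>2)"
    have pos: "1 + t\<^sup>2 > 0" by (rule add_pos_nonneg) auto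
    have s: "s\<^sup>2 = 1 + t\<^sup>2" "s > 0" using pos by (auto simp: s_def)
    have "(1/s)\<^sup>2 * (b i \<bullet> b i) + 2 * (1/s) * (t/s) * (b i \<bullet> b j) + (t/s)\<^sup>2 * (b j \<bullet> b j) \<le> b i \<bullet> b i"
      by (rule key[OF ij]) (use s pos in \<open>auto simp: power_divide add_divide_distrib[symmetric]\<close>)
    moreover have "(1/s)\<^sup>2 * (b i \<bullet> b i) + 2 * (1/s) * (t/s) * (b i \<bullet> b j) + (t/s)\<^sup>2 * (b j \<bullet> b j)
       = ((b i \<bullet> b i) + 2 * t * (b i \<bullet> b j) + t\<^sup>2 * (b j \<bullet> b j)) / s\<^sup>2"
      using s(2) by (simp add: field_simps power2_eq_square)
    ultimately have "((b i \<bullet> b i) + 2 * t * (b i \<bullet> b j) + t\<^sup>2 * (b j \<bullet> b j)) \<le> (b i \<bullet> b i) * s\<^sup>2"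
      using s(2) by (simp add: pos_divide_le_eq)
    then show "2 * t * (b i \<bullet> b j) \<le> t\<^sup>2 * (b i \<bullet> b i - b j \<bullet> b j)"
      unfolding s(1) by (simp add: algebra_simps)
  qed
  have "(B * V)\<^sup>T * (B * V) = mat_diag c (\<lambda>i. b i \<bullet> b i)"
  proof (rule eq_matI)
    fix i j assume "i < dim_row (mat_diag c (\<lambda>i. b i \<bullet> b i))" "j < dim_col (mat_diag c (\<lambda>i. b i \<bullet> b i))"
    then have ij: "i < c" "j < c" by (auto simp: mat_diag_def)
    have "col (B * V) l = b l" if "l < c" for l
      unfolding b_def by (rule col_mult2[OF B Vc(1) that])
    moreover have "((B * V)\<^sup>T * (B * V)) $$ (i,j) = col (B * V) i \<bullet> col (B * V) j"
      using ij B Vc(1) by (simp del: col_mult2 col_mult)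
    ultimately have "((B * V)\<^sup>T * (B * V)) $$ (i,j) = b i \<bullet> b j"
      using ij by simp
    moreover have "b i \<bullet> b j = 0" if "i \<noteq> j"
    proof (cases "i < j")
      case True then show ?thesis using orth ij by blast
    next
      case False
      then have "b j \<bullet> b i = 0" using orth[of j i] ij that by simp
      then show ?thesis using comm_scalar_prod[OF bc[OF ij(1)] bc[OF ij(2)]] by simp
    qed
    ultimately show "((B * V)\<^sup>T * (B * V)) $$ (i,j) = mat_diag c (\<lambda>i. b i \<bullet> b i) $$ (i,j)"
      using ij by (simp add: mat_diag_def)
  qed (use B Vc in \<open>auto simp: mat_diag_def\<close>)
  then show ?thesis using V dec scalar_prod_self_nonneg
    by (intro exI[of _ V] exI[of _ "\<lambda>i. b i \<bullet> b i"]) auto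
qed

text \<open>Padding \<open>A\<close> by zero rows to a square matrix makes the last row zero, so the
  transpose annihilates the last unit vector and the determinant vanishes.\<close>

lemma nontrivial_kernel:
  fixes A :: "'a :: field mat"
  assumes A: "A \<in> carrier_mat p q" and "p < q"
  shows "\<exists>z\<in>carrier_vec q. z \<noteq> 0\<^sub>v q \<and> A *\<^sub>v z = 0\<^sub>v p"
proof -
  define A' where "A' = mat q q (\<lambda>(i,j). if i < p then A $$ (i,j) else 0)"
  have A': "A' \<in> carrier_mat q q" by (simp add: A'_def)
  have e: "unit_vec q (q - 1) \<in> carrier_vec q" "unit_vec q (q - 1) \<noteq> (0\<^sub>v q :: 'a vec)"
    using assms(2) by auto
  have "A'\<^sup>T *\<^sub>v unit_vec q (q - 1) = 0\<^sub>v q"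
  proof (rule eq_vecI)
    fix i assume "i < dim_vec (0\<^sub>v q :: 'a vec)"
    then have i: "i < q" by simp
    have "col A' i $ (q - 1) = 0" using i assms(2) by (auto simp: A'_def)
    then show "(A'\<^sup>T *\<^sub>v unit_vec q (q - 1)) $ i = (0\<^sub>v q :: 'a vec) $ i"
      using i A' assms(2) by simp
  qed (use A' in auto)
  then have "det (A'\<^sup>T) = 0"
    using e det_0_iff_vec_prod_zero_field[of "A'\<^sup>T" q] transpose_carrier_mat[of A' q q] A' by blast
  then have "det A' = 0" using det_transpose[OF A'] by simp
  then obtain z where z: "z \<in> carrier_vec q" "z \<noteq> 0\<^sub>v q" "A' *\<^sub>v z = 0\<^sub>v q"
    using det_0_iff_vec_prod_zero_field[OF A'] by auto
  have "A *\<^sub>v z = 0\<^sub>v p"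
  proof (rule eq_vecI)
    fix i assume "i < dim_vec (0\<^sub>v p :: 'a vec)"
    then have i: "i < p" by simp
    have "row A i = row A' i" using i A assms(2) by (auto simp: A'_def)
    moreover have "(A' *\<^sub>v z) $ i = 0" using z(3) i assms(2) by simp
    ultimately show "(A *\<^sub>v z) $ i = (0\<^sub>v p :: 'a vec) $ i" using i A A' assms(2) by simp
  qed (use A in auto)
  with z show ?thesis by blast
qed

abbreviation nsq :: "real vec \<Rightarrow> real" where "nsq v \<equiv> v \<bullet> v"

lemma nsq_pos: "v \<in> carrier_vec n \<Longrightarrow> v \<noteq> 0\<^sub>v n \<Longrightarrow> 0 < nsq v"
  using scalar_prod_self_eq_0[of v n] scalar_prod_self_nonneg[of v] by simp

lemma nsq_sum: "v \<in> carrier_vec n \<Longrightarrow> nsq v = (\<Sum>i<n. (v $ i)\<^sup>2)"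
  by (simp add: scalar_prod_def lessThan_atLeast0 power2_eq_square)

lemma nsq_smult: "nsq (a \<cdot>\<^sub>v v) = a\<^sup>2 * nsq v"
  by (simp add: power2_eq_square)

lemma scalar_prod_mult_mat_vec:
  fixes C :: "real mat"
  assumes "C \<in> carrier_mat m c" "v \<in> carrier_vec c" "w \<in> carrier_vec m"
  shows "(C *\<^sub>v v) \<bullet> w = v \<bullet> (C\<^sup>T *\<^sub>v w)"
  using transpose_vec_mult_scalar[OF assms(1,2,3)] assms
    comm_scalar_prod[of "C *\<^sub>v v" m w] comm_scalar_prod[of v c "C\<^sup>T *\<^sub>v w"] by simp

lemma nsq_mult_mat_vec:
  assumes "C \<in> carrier_mat m c" "v \<in> carrier_vec c"
  shows "nsq (C *\<^sub>v v) = v \<bullet> ((C\<^sup>T * C) *\<^sub>v v)"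
  using assms by (simp add: scalar_prod_mult_mat_vec[of C m c] assoc_mult_mat_vec[of _ c m _ c])

lemma nsq_isometry:
  assumes "C \<in> carrier_mat m c" "C\<^sup>T * C = 1\<^sub>m c" "v \<in> carrier_vec c"
  shows "nsq (C *\<^sub>v v) = nsq v"
  using nsq_mult_mat_vec[OF assms(1,3)] assms by simp

lemma nsq_orth:
  assumes "orth_mat c V" "v \<in> carrier_vec c"
  shows "nsq (V *\<^sub>v v) = nsq v"
  using nsq_isometry[of V c c v] assms unfolding orth_mat_def by simp

lemma sum_if_mult:
  fixes f g :: "'a \<Rightarrow> 'b :: semiring_0"
  assumes "finite A"
  shows "(\<Sum>j\<in>A. (if i = j then f j else 0) * g j) = (if i \<in> A then f i * g i else 0)"
proof -
  have "(\<Sum>j\<in>A. (if i = j then f j else 0) * g j) = (\<Sum>j\<in>A. if i = j then f j * g j else 0)"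
    by (rule sum.cong) auto
  then show ?thesis using assms by simp
qed

lemma mat_diag_mult_vec:
  "v \<in> carrier_vec c \<Longrightarrow> mat_diag c f *\<^sub>v v = vec c (\<lambda>i. f i * v $ i)"
proof (rule eq_vecI)
  fix i assume v: "v \<in> carrier_vec c" and "i < dim_vec (vec c (\<lambda>i. f i * v $ i))"
  then have i: "i < c" by simp
  show "(mat_diag c f *\<^sub>v v) $ i = vec c (\<lambda>i. f i * v $ i) $ i"
    using i v by (simp add: mat_diag_def scalar_prod_def sum_if_mult)
qed (simp add: mat_diag_def)

lemma nsq_diag_gram:
  assumes "C \<in> carrier_mat m c" "C\<^sup>T * C = mat_diag c d" "v \<in> carrier_vec c"
  shows "nsq (C *\<^sub>v v) = (\<Sum>i<c. d i * (v $ i)\<^sup>2)"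
  using nsq_mult_mat_vec[OF assms(1,3)] assms(2,3)
  by (simp add: mat_diag_mult_vec scalar_prod_def lessThan_atLeast0 power2_eq_square mult_ac)

lemma cauchy_schwarz_vec:
  fixes u v :: "real vec"
  assumes u: "u \<in> carrier_vec n" and v: "v \<in> carrier_vec n"
  shows "(u \<bullet> v)\<^sup>2 \<le> nsq u * nsq v"
proof (cases "v = 0\<^sub>v n")
  case False
  then have pos: "0 < nsq v" using nsq_pos v by blast
  define t where "t = (u \<bullet> v) / nsq v"
  have c: "v \<bullet> u = u \<bullet> v" using comm_scalar_prod[OF v u] .
  have "0 \<le> nsq (u - t \<cdot>\<^sub>v v)" by (rule scalar_prod_self_nonneg)
  also have "\<dots> = nsq u - 2 * t * (u \<bullet> v) + t * t * nsq v"
    using u v by (simp add: minus_scalar_prod_distrib[of _ n] scalar_prod_minus_distrib[of _ n]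
      smult_scalar_prod_distrib[of _ n] scalar_prod_smult_distrib[of _ n] c algebra_simps)
  also have "\<dots> = nsq u - (u \<bullet> v)\<^sup>2 / nsq v"
    using pos by (simp add: t_def power2_eq_square field_simps)
  finally show ?thesis using pos by (simp add: pos_divide_le_eq)
qed (use u in simp)

text \<open>Padding the singular values by zeros makes them invariant under transposition.\<close>

definition sv :: "real mat \<Rightarrow> nat \<Rightarrow> real" where
  "sv B i = (if i < dim_col B then
     rev (sorted_list_of_multiset
        (image_mset sqrt (proots (char_poly (B\<^sup>T * B))))) ! i else 0)"

text \<open>Similarity transports the characteristic polynomial to the diagonal matrix, whose linear
  factors exhibit the roots with multiplicity. This ties the list defined by roots to any ordered
  orthogonal diagonalisation.\<close>

lemma sorted_sqrt_eigenvalues_gram: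
  assumes B: "B \<in> carrier_mat m c" and V: "orth_mat c V"
    and d: "(B * V)\<^sup>T * (B * V) = mat_diag c d"
    and dec: "\<And>i j. i \<le> j \<Longrightarrow> j < c \<Longrightarrow> d j \<le> d i"
  shows "rev (sorted_list_of_multiset (image_mset sqrt (proots (char_poly (B\<^sup>T * B)))))
     = map (\<lambda>i. sqrt (d i)) [0..<c]"
proof -
  note Vc = orth_matD[OF V]
  let ?G = "B\<^sup>T * B"
  have G: "?G \<in> carrier_mat c c" using B by simp
  have "mat_diag c d = V\<^sup>T * ?G * V"
    unfolding d[symmetric] using B Vc(1)
    by (simp add: transpose_mult[of B m c V c] assoc_mult_mat[of _ c m _ c _ c] assoc_mult_mat[of _ c c _ m _ c]
        assoc_mult_mat[of _ c c _ c _ c])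
  then have "similar_mat (mat_diag c d) ?G"
    by (intro similar_matI[of _ _ "V\<^sup>T" V c]) (use Vc G in auto)
  then have "char_poly ?G = char_poly (mat_diag c d)" using char_poly_similar by metis
  also have "\<dots> = (\<Prod>a\<leftarrow>diag_mat (mat_diag c d). [:- a, 1:])"
    by (rule char_poly_upper_triangular[of _ c]) (auto simp: mat_diag_def upper_triangular_def)
  also have "diag_mat (mat_diag c d) = map d [0..<c]" by (auto simp: diag_mat_def mat_diag_def)
  finally have "char_poly ?G = (\<Prod>i\<leftarrow>[0..<c]. [:- d i, 1:])" by (simp add: o_def)
  moreover have "proots (\<Prod>i\<leftarrow>xs. [:- d i, 1:]) = mset (map d xs)" for xs
  proof (induction xs)
    case (Cons x xs)
    have nz: "(\<Prod>i\<leftarrow>xs. [:- d i, 1:]) \<noteq> 0" by (auto simp: prod_list_zero_iff)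
    show ?case using Cons.IH nz by (simp add: proots_mult del: mult_pCons_left)
  qed simp
  ultimately have "image_mset sqrt (proots (char_poly ?G)) = mset (rev (map (\<lambda>i. sqrt (d i)) [0..<c]))"
    by (simp add: multiset.map_comp o_def)
  then have "sorted_list_of_multiset (image_mset sqrt (proots (char_poly ?G)))
      = sort (rev (map (\<lambda>i. sqrt (d i)) [0..<c]))"
    by (simp only: sorted_list_of_multiset_mset)
  also have "\<dots> = rev (map (\<lambda>i. sqrt (d i)) [0..<c])"
    by (rule sort_key_id_if_sorted)
      (auto simp: sorted_iff_nth_mono rev_nth intro!: dec)
  finally show ?thesis by simp
qed

lemma
  assumes B: "B \<in> carrier_mat m c"
  shows exists_sv_basis: "\<exists>V. orth_mat c V \<and> (B * V)\<^sup>T * (B * V) = mat_diag c (\<lambda>i. (sv B i)\<^sup>2)"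
    and sv_nonneg: "0 \<le> sv B i"
    and sv_antimono: "i \<le> j \<Longrightarrow> sv B j \<le> sv B i"
proof -
  obtain V d where h: "orth_mat c V \<and> (B * V)\<^sup>T * (B * V) = mat_diag c d \<and>
      (\<forall>i<c. 0 \<le> d i) \<and> (\<forall>i j. i \<le> j \<longrightarrow> j < c \<longrightarrow> d j \<le> d i)"
    using exists_right_singular_basis[OF B] by (elim exE)
  have V: "orth_mat c V" and d: "(B * V)\<^sup>T * (B * V) = mat_diag c d"
    using h by blast+
  have nn: "0 \<le> d i" if "i < c" for i using h that by blast
  have dec: "d j \<le> d i" if "i \<le> j" "j < c" for i j using h that by blast
  have sv: "sv B i = (if i < c then sqrt (d i) else 0)" for i
    using sorted_sqrt_eigenvalues_gram[OF B V d dec] B by (simp add: sv_def)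
  have "mat_diag c d = mat_diag c (\<lambda>i. (sv B i)\<^sup>2)"
    using nn by (auto simp: mat_diag_def sv)
  then show "\<exists>V. orth_mat c V \<and> (B * V)\<^sup>T * (B * V) = mat_diag c (\<lambda>i. (sv B i)\<^sup>2)"
    using V d by auto
  show "0 \<le> sv B i" using nn by (simp add: sv)
  show "i \<le> j \<Longrightarrow> sv B j \<le> sv B i" using nn dec[of i j] by (auto simp: sv)
qed

section \<open>The minimax principle\<close>

lemma sv_beyond: "dim_col B \<le> i \<Longrightarrow> sv B i = 0"
  by (simp add: sv_def)

lemma nsq_sv_basis:
  assumes B: "B \<in> carrier_mat m c" and V: "orth_mat c V"
    and d: "(B * V)\<^sup>T * (B * V) = mat_diag c d" and v: "v \<in> carrier_vec c"
  shows "nsq (B *\<^sub>v (V *\<^sub>v v)) = (\<Sum>i<c. d i * (v $ i)\<^sup>2)"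
  using nsq_diag_gram[of "B * V" m c d v] assms orth_matD(1)[OF V] by simp

text \<open>One half of the minimax principle. The subspace is spanned by the first
  \<open>Suc i\<close> right singular vectors and encoded as the range of the injective matrix
  \<open>L\<close>; only singular values at least \<open>sv B i\<close> occur on it.\<close>

lemma sv_attained_on_subspace:
  assumes B: "B \<in> carrier_mat m c" and i: "i < c"
  shows "\<exists>L\<in>carrier_mat c (Suc i). (\<forall>z\<in>carrier_vec (Suc i). z \<noteq> 0\<^sub>v (Suc i) \<longrightarrow> L *\<^sub>v z \<noteq> 0\<^sub>v c) \<and>
    (\<forall>z\<in>carrier_vec (Suc i). (sv B i)\<^sup>2 * nsq (L *\<^sub>v z) \<le> nsq (B *\<^sub>v (L *\<^sub>v z)))"
proof -
  obtain V where V: "orth_mat c V"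
    and d: "(B * V)\<^sup>T * (B * V) = mat_diag c (\<lambda>i. (sv B i)\<^sup>2)"
    using exists_sv_basis[OF B] by blast
  note Vc = orth_matD[OF V]
  define E :: "real mat" where "E = mat c (Suc i) (\<lambda>(p,q). if p = q then 1 else 0)"
  have E: "E \<in> carrier_mat c (Suc i)" by (simp add: E_def)
  have Ez: "(E *\<^sub>v z) $ p = (if p \<le> i then z $ p else 0)" if "z \<in> carrier_vec (Suc i)" "p < c" for z p
  proof -
    have "(E *\<^sub>v z) $ p = (\<Sum>q = 0..<Suc i. (if p = q then 1 else 0) * z $ q)"
      using that by (simp add: E_def scalar_prod_def del: sum.op_ivl_Suc)
    then show ?thesis by (simp add: sum_if_mult del: sum.op_ivl_Suc)
  qed
  have Ec: "E *\<^sub>v z \<in> carrier_vec c" if "z \<in> carrier_vec (Suc i)" for z using E that by simp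
  have VE: "(V * E) *\<^sub>v z = V *\<^sub>v (E *\<^sub>v z)" if "z \<in> carrier_vec (Suc i)" for z
    using Vc E that by simp
  have "(V * E) *\<^sub>v z \<noteq> 0\<^sub>v c" if z: "z \<in> carrier_vec (Suc i)" "z \<noteq> 0\<^sub>v (Suc i)" for z
  proof
    assume "(V * E) *\<^sub>v z = 0\<^sub>v c"
    then have "nsq (E *\<^sub>v z) = 0" using nsq_orth[OF V Ec[OF z(1)]] VE z by simp
    then have 0: "E *\<^sub>v z = 0\<^sub>v c" using scalar_prod_self_eq_0 Ec z by blast
    have "z = 0\<^sub>v (Suc i)"
    proof (rule eq_vecI)
      fix p assume "p < dim_vec (0\<^sub>v (Suc i) :: real vec)"
      then show "z $ p = 0\<^sub>v (Suc i) $ p" using Ez[OF z(1), of p] i 0 by simp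
    qed (use z in simp)
    then show False using z by simp
  qed
  moreover have "(sv B i)\<^sup>2 * nsq ((V * E) *\<^sub>v z) \<le> nsq (B *\<^sub>v ((V * E) *\<^sub>v z))"
    if z: "z \<in> carrier_vec (Suc i)" for z
  proof -
    have "(sv B i)\<^sup>2 * nsq ((V * E) *\<^sub>v z) = (\<Sum>p<c. (sv B i)\<^sup>2 * ((E *\<^sub>v z) $ p)\<^sup>2)"
      using nsq_orth[OF V Ec[OF z]] nsq_sum[OF Ec[OF z]] VE[OF z] by (simp add: sum_distrib_left)
    also have "\<dots> \<le> (\<Sum>p<c. (sv B p)\<^sup>2 * ((E *\<^sub>v z) $ p)\<^sup>2)"
    proof (rule sum_mono)
      fix p assume "p \<in> {..<c}"
      then show "(sv B i)\<^sup>2 * ((E *\<^sub>v z) $ p)\<^sup>2 \<le> (sv B p)\<^sup>2 * ((E *\<^sub>v z) $ p)\<^sup>2"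
        using Ez[OF z, of p] sv_nonneg[OF B] sv_antimono[OF B] by (auto intro!: mult_right_mono power_mono)
    qed
    also have "\<dots> = nsq (B *\<^sub>v ((V * E) *\<^sub>v z))"
      using nsq_sv_basis[OF B V d Ec[OF z]] VE[OF z] by simp
    finally show ?thesis .
  qed
  ultimately show ?thesis using Vc(1) E by (intro bexI[of _ "V * E"]) auto
qed

text \<open>The other half: a subspace of dimension \<open>Suc i\<close> contains a nonzero vector
  orthogonal to the first \<open>i\<close> right singular vectors, and \<open>C\<close> stretches
  such a vector by at most \<open>sv C i\<close>.\<close>

lemma sv_ge_of_subspace:
  assumes C: "C \<in> carrier_mat m c" and L: "L \<in> carrier_mat c (Suc i)"
    and inj: "\<And>z. z \<in> carrier_vec (Suc i) \<Longrightarrow> z \<noteq> 0\<^sub>v (Suc i) \<Longrightarrow> L *\<^sub>v z \<noteq> 0\<^sub>v c"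
    and ge: "\<And>z. z \<in> carrier_vec (Suc i) \<Longrightarrow> s\<^sup>2 * nsq (L *\<^sub>v z) \<le> nsq (C *\<^sub>v (L *\<^sub>v z))"
  shows "s \<le> sv C i"
proof -
  obtain V where V: "orth_mat c V"
    and d: "(C * V)\<^sup>T * (C * V) = mat_diag c (\<lambda>i. (sv C i)\<^sup>2)"
    using exists_sv_basis[OF C] by blast
  note Vc = orth_matD[OF V]
  define T where "T = V\<^sup>T * L"
  have T: "T \<in> carrier_mat c (Suc i)" using Vc L by (simp add: T_def)
  \<comment> \<open>The rows give the coordinates of \<open>L *\<^sub>v z\<close> along the first
    \<open>i\<close> right singular vectors, with zero rows past \<open>c\<close>. One row fewer
    than columns forces a kernel.\<close>
  define A where "A = mat i (Suc i) (\<lambda>(p,q). if p < c then T $$ (p,q) else 0)"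
  obtain z where z: "z \<in> carrier_vec (Suc i)" "z \<noteq> 0\<^sub>v (Suc i)" and Az: "A *\<^sub>v z = 0\<^sub>v i"
    using nontrivial_kernel[of A i "Suc i"] by (auto simp: A_def)
  define y where "y = T *\<^sub>v z"
  have y: "y \<in> carrier_vec c" using T z by (simp add: y_def)
  have y0: "y $ p = 0" if "p < i" "p < c" for p
  proof -
    have "row A p = row T p" using that T by (auto simp: A_def)
    then have "y $ p = (A *\<^sub>v z) $ p" using that T by (simp add: y_def A_def)
    then show ?thesis using Az that by simp
  qed
  have Lz: "L *\<^sub>v z \<in> carrier_vec c" using L z by simp
  have Vy: "V *\<^sub>v y = L *\<^sub>v z"
  proof -
    have "V *\<^sub>v y = (V * V\<^sup>T) *\<^sub>v (L *\<^sub>v z)"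
      using Vc(1) L z Lz by (simp add: y_def T_def assoc_mult_mat_vec[of _ c c _ c] 
        assoc_mult_mat_vec[of _ c c _ "Suc i"])
    then show ?thesis using Vc Lz by simp
  qed
  have nLz: "0 < nsq (L *\<^sub>v z)" using nsq_pos[OF Lz] inj[OF z] by simp
  have nn: "nsq (L *\<^sub>v z) = (\<Sum>p<c. (y $ p)\<^sup>2)" using nsq_orth[OF V y] nsq_sum[OF y] Vy by simp
  have "s\<^sup>2 * nsq (L *\<^sub>v z) \<le> nsq (C *\<^sub>v (V *\<^sub>v y))" using ge[OF z(1)] Vy by simp
  also have "\<dots> = (\<Sum>p<c. (sv C p)\<^sup>2 * (y $ p)\<^sup>2)" by (rule nsq_sv_basis[OF C V d y])
  also have "\<dots> \<le> (\<Sum>p<c. (sv C i)\<^sup>2 * (y $ p)\<^sup>2)"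
  proof (rule sum_mono)
    fix p assume p: "p \<in> {..<c}"
    show "(sv C p)\<^sup>2 * (y $ p)\<^sup>2 \<le> (sv C i)\<^sup>2 * (y $ p)\<^sup>2"
    proof (cases "p < i")
      case False
      then have "sv C p \<le> sv C i" using sv_antimono[OF C] by simp
      then show ?thesis using sv_nonneg[OF C] by (intro mult_right_mono power_mono) auto
    qed (use y0 p in auto)
  qed
  also have "\<dots> = (sv C i)\<^sup>2 * nsq (L *\<^sub>v z)" by (simp add: nn sum_distrib_left)
  finally have "s\<^sup>2 \<le> (sv C i)\<^sup>2" using nLz by simp
  then show ?thesis using sv_nonneg[OF C] power2_le_imp_le by blast
qed

text \<open>The subspace attaining \<open>sv B i\<close> serves as a test subspace for
  \<open>C\<close>. The row dimensions may differ, which later allows padding and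
  isometries.\<close>

lemma sv_mono:
  assumes B: "B \<in> carrier_mat m c" and C: "C \<in> carrier_mat m' c"
    and le: "\<And>v. v \<in> carrier_vec c \<Longrightarrow> nsq (B *\<^sub>v v) \<le> nsq (C *\<^sub>v v)"
  shows "sv B i \<le> sv C i"
proof (cases "i < c")
  case True
  obtain L where L: "L \<in> carrier_mat c (Suc i)"
    and inj: "\<And>z. z \<in> carrier_vec (Suc i) \<Longrightarrow> z \<noteq> 0\<^sub>v (Suc i) \<Longrightarrow> L *\<^sub>v z \<noteq> 0\<^sub>v c"
    and ge: "\<And>z. z \<in> carrier_vec (Suc i) \<Longrightarrow> (sv B i)\<^sup>2 * nsq (L *\<^sub>v z) \<le> nsq (B *\<^sub>v (L *\<^sub>v z))"
    using sv_attained_on_subspace[OF B True] by blast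
  show ?thesis
  proof (rule sv_ge_of_subspace[OF C L inj])
    fix z :: "real vec" assume z: "z \<in> carrier_vec (Suc i)"
    then have "L *\<^sub>v z \<in> carrier_vec c" using L by simp
    then show "(sv B i)\<^sup>2 * nsq (L *\<^sub>v z) \<le> nsq (C *\<^sub>v (L *\<^sub>v z))"
      using ge[OF z] le[of "L *\<^sub>v z"] by simp
  qed
qed (use B C in \<open>simp add: sv_def\<close>)

text \<open>The image under \<open>B\<close> of the subspace attaining \<open>sv B i\<close> is the
  test subspace for the transpose: Cauchy-Schwarz for the product of \<open>w\<close> and
  \<open>B\<^sup>T *\<^sub>v (B *\<^sub>v w)\<close> shows that the transpose stretches
  \<open>B *\<^sub>v w\<close> at least as much as \<open>B\<close> stretches \<open>w\<close>. A
  zero singular value is set aside, because \<open>B\<close> may then collapse that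
  subspace.\<close>

lemma sv_le_transpose:
  assumes B: "B \<in> carrier_mat m c"
  shows "sv B i \<le> sv (B\<^sup>T) i"
proof (cases "sv B i = 0")
  case True
  then show ?thesis using sv_nonneg[of "B\<^sup>T" c m i] B by simp
next
  case False
  then have i: "i < c" using B by (auto simp: sv_def split: if_splits)
  have pos: "0 < (sv B i)\<^sup>2" using False by simp
  obtain L where L: "L \<in> carrier_mat c (Suc i)"
    and inj: "\<And>z. z \<in> carrier_vec (Suc i) \<Longrightarrow> z \<noteq> 0\<^sub>v (Suc i) \<Longrightarrow> L *\<^sub>v z \<noteq> 0\<^sub>v c"
    and ge: "\<And>z. z \<in> carrier_vec (Suc i) \<Longrightarrow> (sv B i)\<^sup>2 * nsq (L *\<^sub>v z) \<le> nsq (B *\<^sub>v (L *\<^sub>v z))"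
    using sv_attained_on_subspace[OF B i] by blast
  have BL: "(B * L) *\<^sub>v z = B *\<^sub>v (L *\<^sub>v z)" if "z \<in> carrier_vec (Suc i)" for z
    using B L that by simp
  show ?thesis
  proof (rule sv_ge_of_subspace[of "B\<^sup>T" c m "B * L"])
    fix z :: "real vec" assume z: "z \<in> carrier_vec (Suc i)" "z \<noteq> 0\<^sub>v (Suc i)"
    have "0 < nsq (L *\<^sub>v z)" using inj[OF z] L z by (intro nsq_pos[of _ c]) auto
    then have "0 < (sv B i)\<^sup>2 * nsq (L *\<^sub>v z)" using pos by simp
    then have "0 < nsq (B *\<^sub>v (L *\<^sub>v z))" using ge[OF z(1)] by linarith
    then show "(B * L) *\<^sub>v z \<noteq> 0\<^sub>v m" using BL[OF z(1)] by auto
  next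
    fix z :: "real vec" assume z: "z \<in> carrier_vec (Suc i)"
    define w where "w = L *\<^sub>v z"
    define u where "u = B *\<^sub>v w"
    have w: "w \<in> carrier_vec c" using L z by (simp add: w_def)
    have u: "u \<in> carrier_vec m" using B w by (simp add: u_def)
    have Bu: "B\<^sup>T *\<^sub>v u \<in> carrier_vec c" using B u by simp
    have "(sv B i)\<^sup>2 * nsq u \<le> nsq (B\<^sup>T *\<^sub>v u)"
    proof (cases "w = 0\<^sub>v c")
      case True
      then have "nsq u = 0" using B scalar_prod_mult_mat_vec[OF B _ u, of "0\<^sub>v c"] u by (simp add: u_def)
      then show ?thesis using scalar_prod_self_nonneg by simp
    next
      case False
      then have wpos: "0 < nsq w" using nsq_pos w by blast
      have "(sv B i)\<^sup>2 * nsq w * nsq u \<le> nsq u * nsq u"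
        by (rule mult_right_mono) (use ge[OF z] scalar_prod_self_nonneg in \<open>auto simp: w_def u_def\<close>)
      also have "\<dots> = (w \<bullet> (B\<^sup>T *\<^sub>v u))\<^sup>2"
        using scalar_prod_mult_mat_vec[OF B w u] by (simp add: u_def power2_eq_square)
      also have "\<dots> \<le> nsq w * nsq (B\<^sup>T *\<^sub>v u)" by (rule cauchy_schwarz_vec[OF w Bu])
      finally show ?thesis using wpos by (simp add: mult_ac)
    qed
    then show "(sv B i)\<^sup>2 * nsq ((B * L) *\<^sub>v z) \<le> nsq (B\<^sup>T *\<^sub>v ((B * L) *\<^sub>v z))"
      using BL[OF z] by (simp add: u_def w_def)
  qed (use B L in auto)
qed

lemma sv_transpose:
  assumes "B \<in> carrier_mat m c"
  shows "sv (B\<^sup>T) i = sv B i"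
  using sv_le_transpose[OF assms, of i] sv_le_transpose[of "B\<^sup>T" c m i] assms by simp

section \<open>The singular value decomposition and the Ky Fan inequality\<close>

text \<open>At most \<open>k - 1\<close> vectors, indexed with a gap at \<open>j\<close>, are
  stacked as the rows of a matrix that must have a kernel; indices outside \<open>I\<close> give
  zero rows.\<close>

lemma exists_unit_orthogonal:
  assumes I: "I \<subseteq> {..<k}" and j: "j < k" "j \<notin> I" and u: "\<And>i. i \<in> I \<Longrightarrow> u i \<in> carrier_vec k"
  shows "\<exists>w\<in>carrier_vec k. nsq w = 1 \<and> (\<forall>i\<in>I. u i \<bullet> w = 0)"
proof -
  define A where "A = mat (k - 1) k (\<lambda>(p,q). u (if p < j then p else Suc p) $ q
      * (if (if p < j then p else Suc p) \<in> I then 1 else 0))"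
  have A: "A \<in> carrier_mat (k - 1) k" by (simp add: A_def)
  obtain z where z: "z \<in> carrier_vec k" "z \<noteq> 0\<^sub>v k" "A *\<^sub>v z = 0\<^sub>v (k - 1)"
    using nontrivial_kernel[OF A] j by auto
  have orth: "u i \<bullet> z = 0" if i: "i \<in> I" for i
  proof -
    define p where "p = (if i < j then i else i - 1)"
    have ij: "i \<noteq> j" "i < k" using i j I by auto
    then have p: "p < k - 1" "(if p < j then p else Suc p) = i" using j by (auto simp: p_def)
    have "row A p = u i" using p u[OF i] i by (auto simp: A_def)
    moreover have "row A p \<bullet> z = (A *\<^sub>v z) $ p" using p A by simp
    ultimately show ?thesis using z(3) p by simp
  qed
  have pos: "0 < nsq z" by (rule nsq_pos[OF z(1,2)])
  define w where "w = (1 / sqrt (nsq z)) \<cdot>\<^sub>v z"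
  have "w \<in> carrier_vec k" using z by (simp add: w_def)
  moreover have "nsq w = 1" unfolding w_def nsq_smult using pos by (simp add: power_divide)
  moreover have "u i \<bullet> w = 0" if "i \<in> I" for i
    using orth[OF that] u[OF that] z(1) by (simp add: w_def scalar_prod_smult_distrib[of _ k])
  ultimately show ?thesis by blast
qed

text \<open>The vectors to be kept may occupy any set of indices; the other places are filled one at
  a time by a unit vector orthogonal to all those already placed.\<close>

lemma extend_orthonormal:
  assumes "finite J" and "I \<inter> J = {}" and "I \<union> J \<subseteq> {..<k}"
    and "\<And>i. i \<in> I \<Longrightarrow> u i \<in> carrier_vec k"
    and "\<And>i j. i \<in> I \<Longrightarrow> j \<in> I \<Longrightarrow> u i \<bullet> u j = (if i = j then 1 else 0 :: real)"
  shows "\<exists>w. (\<forall>i\<in>I. w i = u i) \<and> (\<forall>i\<in>I \<union> J. w i \<in> carrier_vec k) \<and>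
    (\<forall>i\<in>I \<union> J. \<forall>j\<in>I \<union> J. w i \<bullet> w j = (if i = j then 1 else 0 :: real))"
  using assms
proof (induction J rule: finite_induct)
  case empty
  then show ?case by (intro exI[of _ u]) auto
next
  case (insert j J)
  have "\<exists>w. (\<forall>i\<in>I. w i = u i) \<and> (\<forall>i\<in>I \<union> J. w i \<in> carrier_vec k) \<and>
    (\<forall>i\<in>I \<union> J. \<forall>j\<in>I \<union> J. w i \<bullet> w j = (if i = j then 1 else 0 :: real))"
    by (rule insert.IH) (use insert.prems in auto)
  then obtain w where h: "(\<forall>i\<in>I. w i = u i) \<and> (\<forall>i\<in>I \<union> J. w i \<in> carrier_vec k) \<and>
    (\<forall>i\<in>I \<union> J. \<forall>j\<in>I \<union> J. w i \<bullet> w j = (if i = j then 1 else 0 :: real))"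
    by (elim exE)
  have w: "w i = u i" if "i \<in> I" for i using h that by blast
  have w2: "w i \<in> carrier_vec k" if "i \<in> I \<union> J" for i using h that by blast
  have w3: "w i \<bullet> w j = (if i = j then 1 else 0)" if "i \<in> I \<union> J" "j \<in> I \<union> J" for i j
    using h that by blast
  have j: "j < k" "j \<notin> I \<union> J" using insert by auto
  obtain x where x: "x \<in> carrier_vec k" "nsq x = 1" "\<And>i. i \<in> I \<union> J \<Longrightarrow> w i \<bullet> x = 0"
    using exists_unit_orthogonal[of "I \<union> J" k j w] insert.prems(2) j w2 by auto
  have x': "x \<bullet> w i = 0" if "i \<in> I \<union> J" for i
    using x(3)[OF that] comm_scalar_prod[OF x(1) w2[OF that]] by simp
  have "(w(j := x)) i \<bullet> (w(j := x)) i' = (if i = i' then 1 else 0)"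
    if "i \<in> I \<union> insert j J" "i' \<in> I \<union> insert j J" for i i'
    using that x x' w3 j by (cases "i = j"; cases "i' = j") auto
  moreover have "(w(j := x)) i = u i" if "i \<in> I" for i using w[OF that] j that by auto
  moreover have "(w(j := x)) i \<in> carrier_vec k" if "i \<in> I \<union> insert j J" for i
    using that w2 x by auto
  ultimately show ?case by (intro exI[of _ "w(j := x)"]) blast
qed

text \<open>The left singular vectors are the normalised images of the right ones; where a singular
  value vanishes, an orthonormal completion supplies the column.\<close>

lemma square_svd:
  assumes M: "M \<in> carrier_mat k k"
  shows "\<exists>U V. orth_mat k U \<and> orth_mat k V \<and> M = U * mat_diag k (sv M) * V\<^sup>T"
proof -
  obtain V where V: "orth_mat k V"
    and d: "(M * V)\<^sup>T * (M * V) = mat_diag k (\<lambda>i. (sv M i)\<^sup>2)"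
    using exists_sv_basis[OF M] by blast
  note Vc = orth_matD[OF V]
  define b where "b i = col (M * V) i" for i
  have b: "b i \<in> carrier_vec k" if "i < k" for i using M Vc that by (simp add: b_def)
  have bb: "b i \<bullet> b j = (if i = j then (sv M i)\<^sup>2 else 0)" if "i < k" "j < k" for i j
  proof -
    have "b i \<bullet> b j = ((M * V)\<^sup>T * (M * V)) $$ (i,j)"
      using M Vc that by (simp add: b_def)
    then show ?thesis unfolding d using that by (simp add: mat_diag_def)
  qed
  define I where "I = {i. i < k \<and> sv M i \<noteq> 0}"
  define u where "u i = (1 / sv M i) \<cdot>\<^sub>v b i" for i
  have "\<exists>w. (\<forall>i\<in>I. w i = u i) \<and> (\<forall>i\<in>I \<union> ({..<k} - I). w i \<in> carrier_vec k) \<and>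
    (\<forall>i\<in>I \<union> ({..<k} - I). \<forall>j\<in>I \<union> ({..<k} - I). w i \<bullet> w j = (if i = j then 1 else 0 :: real))"
  proof (rule extend_orthonormal)
    fix i j assume "i \<in> I" "j \<in> I"
    then show "u i \<bullet> u j = (if i = j then 1 else 0)"
      using b bb by (auto simp: I_def u_def smult_scalar_prod_distrib[of _ k]
          scalar_prod_smult_distrib[of _ k] power2_eq_square)
  qed (use b in \<open>auto simp: I_def u_def\<close>)
  moreover have "I \<union> ({..<k} - I) = {..<k}" by (auto simp: I_def)
  ultimately obtain w where h: "(\<forall>i\<in>I. w i = u i) \<and> (\<forall>i\<in>{..<k}. w i \<in> carrier_vec k) \<and>
    (\<forall>i\<in>{..<k}. \<forall>j\<in>{..<k}. w i \<bullet> w j = (if i = j then 1 else 0 :: real))"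
    by (elim exE) simp
  have w: "w i = u i" if "i \<in> I" for i using h that by blast
  have w2: "w i \<in> carrier_vec k" if "i < k" for i using h that by blast
  have w3: "w i \<bullet> w j = (if i = j then 1 else 0)" if "i < k" "j < k" for i j
    using h that by blast
  define U where "U = mat k k (\<lambda>(p,q). w q $ p)"
  have Uc: "U \<in> carrier_mat k k" by (simp add: U_def)
  have colU: "col U i = w i" if "i < k" for i using w2[OF that] that by (auto simp: U_def)
  have U: "orth_mat k U" unfolding orth_mat_cols using w3 colU Uc by simp
  have "M * V = U * mat_diag k (sv M)"
  proof (rule eq_matI)
    fix p q assume "p < dim_row (U * mat_diag k (sv M))" "q < dim_col (U * mat_diag k (sv M))"
    then have pq: "p < k" "q < k" using Uc by (auto simp: mat_diag_def)
    have "(U * mat_diag k (sv M)) $$ (p,q) = U $$ (p,q) * sv M q"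
      using pq by (simp add: mat_diag_mult_right[OF Uc])
    then have "(U * mat_diag k (sv M)) $$ (p,q) = w q $ p * sv M q"
      using pq by (simp add: U_def)
    moreover have "(M * V) $$ (p,q) = b q $ p" using pq M Vc by (simp add: b_def)
    moreover have "b q $ p = w q $ p * sv M q"
    proof (cases "q \<in> I")
      case True
      then show ?thesis using w[OF True] b[OF pq(2)] pq True by (simp add: u_def I_def)
    next
      case False
      then have "sv M q = 0" "b q = 0\<^sub>v k"
        using pq bb[of q q] scalar_prod_self_eq_0[OF b[of q]] by (auto simp: I_def)
      then show ?thesis using pq by simp
    qed
    ultimately show "(M * V) $$ (p,q) = (U * mat_diag k (sv M)) $$ (p,q)" by simp
  qed (use M Vc Uc in \<open>auto simp: mat_diag_def\<close>)
  then have "U * mat_diag k (sv M) * V\<^sup>T = M * (V * V\<^sup>T)"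
    using M Vc(1) by (simp flip: assoc_mult_mat[of M k k V k "V\<^sup>T" k])
  then have "M = U * mat_diag k (sv M) * V\<^sup>T" using M Vc by simp
  then show ?thesis using U V by blast
qed

lemma sv_eqI:
  assumes "B \<in> carrier_mat m c" "orth_mat c V" "(B * V)\<^sup>T * (B * V) = mat_diag c d"
    "\<And>i j. i \<le> j \<Longrightarrow> j < c \<Longrightarrow> d j \<le> d i" "i < c"
  shows "sv B i = sqrt (d i)"
  using sorted_sqrt_eigenvalues_gram[OF assms(1-4)] assms(1,5) by (simp add: sv_def)

lemma sv_smult:
  assumes B: "B \<in> carrier_mat m c"
  shows "sv (a \<cdot>\<^sub>m B) i = \<bar>a\<bar> * sv B i"
proof (cases "i < c")
  case True
  obtain V where V: "orth_mat c V"
    and d: "(B * V)\<^sup>T * (B * V) = mat_diag c (\<lambda>i. (sv B i)\<^sup>2)"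
    using exists_sv_basis[OF B] by blast
  note Vc = orth_matD[OF V]
  have e: "((a \<cdot>\<^sub>m B) * V)\<^sup>T * ((a \<cdot>\<^sub>m B) * V) = mat_diag c (\<lambda>i. a\<^sup>2 * (sv B i)\<^sup>2)"
  proof -
    have "(a \<cdot>\<^sub>m B) * V = a \<cdot>\<^sub>m (B * V)" using mult_smult_assoc_mat[OF B Vc(1)] .
    moreover have "(a \<cdot>\<^sub>m (B * V))\<^sup>T * (a \<cdot>\<^sub>m (B * V))
       = a\<^sup>2 \<cdot>\<^sub>m ((B * V)\<^sup>T * (B * V))"
      by (rule eq_matI) (use B Vc in \<open>auto simp: power2_eq_square\<close>)
    ultimately show ?thesis unfolding d by (auto simp: mat_diag_def)
  qed
  have "sv (a \<cdot>\<^sub>m B) i = sqrt (a\<^sup>2 * (sv B i)\<^sup>2)"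
    by (rule sv_eqI[OF _ V e]) (use B True sv_nonneg[OF B] sv_antimono[OF B]
      in \<open>auto intro!: mult_left_mono power_mono\<close>)
  then show ?thesis using sv_nonneg[OF B] by (simp add: real_sqrt_mult)
qed (use B in \<open>simp add: sv_def\<close>)

lemma sv_orth_left:
  assumes "B \<in> carrier_mat m c" "orth_mat m U"
  shows "sv (U * B) i = sv B i"
proof (rule antisym)
  note U = orth_matD[OF assms(2)]
  have "nsq ((U * B) *\<^sub>v v) = nsq (B *\<^sub>v v)" if "v \<in> carrier_vec c" for v
    using nsq_orth[OF assms(2), of "B *\<^sub>v v"] assms(1) U that by simp
  then show "sv (U * B) i \<le> sv B i" "sv B i \<le> sv (U * B) i"
    using assms U by (auto intro!: sv_mono[of _ m c _ m])
qed

lemma sv_orth_right: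
  assumes "B \<in> carrier_mat m c" "orth_mat c V"
  shows "sv (B * V) i = sv B i"
proof -
  note V = orth_matD[OF assms(2)]
  have "sv (B * V) i = sv ((B * V)\<^sup>T) i"
    using sv_transpose[of "B * V" m c] assms V by simp
  also have "(B * V)\<^sup>T = V\<^sup>T * B\<^sup>T"
    using assms V by (simp add: transpose_mult[of _ m c _ c])
  also have "sv \<dots> i = sv (B\<^sup>T) i"
    by (rule sv_orth_left[of _ _ m]) (use assms orth_mat_transpose in auto)
  finally show ?thesis using sv_transpose[OF assms(1)] by simp
qed

lemma orth_mat_row_sum:
  assumes "orth_mat k P" "i < k"
  shows "(\<Sum>j<k. (P $$ (i,j))\<^sup>2) = 1" "(\<Sum>j<k. (P $$ (j,i))\<^sup>2) = 1"
proof -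
  have *: "(\<Sum>j<k. (V $$ (j,i))\<^sup>2) = 1" if "orth_mat k V" for V
    using that assms(2) unfolding orth_mat_entries power2_eq_square by auto
  show "(\<Sum>j<k. (P $$ (j,i))\<^sup>2) = 1" by (rule *[OF assms(1)])
  show "(\<Sum>j<k. (P $$ (i,j))\<^sup>2) = 1"
    using *[OF orth_mat_transpose[OF assms(1)]] assms orth_matD(1)[OF assms(1)] by simp
qed

text \<open>Bounding each product of entries of \<open>P\<close> and \<open>Q\<close> by the mean of
  their squares leaves the sum of \<open>sv M j * w j\<close>, with weights in [0, 1] of total
  \<open>l\<close>. Such a sum is largest when the weight sits on the first \<open>l\<close>
  indices.\<close>

lemma trace_le_sum_sv:
  assumes M: "M \<in> carrier_mat k k" and l: "l \<le> k"
  shows "(\<Sum>i<l. M $$ (i,i)) \<le> (\<Sum>i<l. sv M i)"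
proof -
  obtain P Q where P: "orth_mat k P" and Q: "orth_mat k Q"
    and eq: "M = P * mat_diag k (sv M) * Q\<^sup>T"
    using square_svd[OF M] by blast
  note Pc = orth_matD[OF P] and Qc = orth_matD[OF Q]
  have entry: "M $$ (i,i) = (\<Sum>j<k. sv M j * (P $$ (i,j) * Q $$ (i,j)))" if "i < k" for i
    by (subst eq) (use that Pc(1) Qc(1) in
      \<open>simp add: mat_diag_mult_right[OF Pc(1)] scalar_prod_def lessThan_atLeast0 mult_ac\<close>)
  define w where "w j = (\<Sum>i<l. ((P $$ (i,j))\<^sup>2 + (Q $$ (i,j))\<^sup>2) / 2)" for j
  have w1: "w j \<le> 1" if "j < k" for j
  proof -
    have "w j \<le> (\<Sum>i<k. ((P $$ (i,j))\<^sup>2 + (Q $$ (i,j))\<^sup>2) / 2)"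
      unfolding w_def by (rule sum_mono2) (use l in auto)
    then show ?thesis using orth_mat_row_sum[OF P that] orth_mat_row_sum[OF Q that]
      by (simp add: sum.distrib add_divide_distrib flip: sum_divide_distrib)
  qed
  have w0: "0 \<le> w j" for j by (auto simp: w_def intro!: sum_nonneg)
  have wsum: "(\<Sum>j<k. w j) = real l"
  proof -
    have "(\<Sum>j<k. w j) = (\<Sum>i<l. \<Sum>j<k. ((P $$ (i,j))\<^sup>2 + (Q $$ (i,j))\<^sup>2) / 2)"
      unfolding w_def by (rule sum.swap)
    also have "\<dots> = (\<Sum>i<l. 1)"
      by (rule sum.cong) (use l orth_mat_row_sum[OF P] orth_mat_row_sum[OF Q] in
        \<open>auto simp: sum.distrib add_divide_distrib simp flip: sum_divide_distrib\<close>)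
    finally show ?thesis by simp
  qed
  have "(\<Sum>i<l. M $$ (i,i)) = (\<Sum>i<l. \<Sum>j<k. sv M j * (P $$ (i,j) * Q $$ (i,j)))"
    using l by (intro sum.cong) (auto simp: entry)
  also have "\<dots> \<le> (\<Sum>i<l. \<Sum>j<k. sv M j * (((P $$ (i,j))\<^sup>2 + (Q $$ (i,j))\<^sup>2) / 2))"
  proof (intro sum_mono mult_left_mono)
    fix i j
    show "P $$ (i,j) * Q $$ (i,j) \<le> ((P $$ (i,j))\<^sup>2 + (Q $$ (i,j))\<^sup>2) / 2"
      using sum_squares_bound[of "P $$ (i,j)" "Q $$ (i,j)"] by simp
    show "0 \<le> sv M j" by (rule sv_nonneg[OF M])
  qed
  also have "\<dots> = (\<Sum>j<k. sv M j * w j)"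
    unfolding w_def sum_distrib_left by (rule sum.swap)
  also have "\<dots> \<le> (\<Sum>j<k. sv M j * (if j < l then 1 else 0))"
  proof -
    let ?e = "\<lambda>j. if j < l then 1 else 0 :: real"
    \<comment> \<open>Both weight families have total \<open>l\<close>, so subtracting the threshold
      \<open>sv M l\<close> does not affect the comparison, and it makes every term
      nonpositive.\<close>
    have "(\<Sum>j<k. (sv M j - sv M l) * (w j - ?e j)) \<le> 0"
    proof (rule sum_nonpos)
      fix j assume j: "j \<in> {..<k}"
      show "(sv M j - sv M l) * (w j - ?e j) \<le> 0"
      proof (cases "j < l")
        case True
        then have "sv M l \<le> sv M j" using sv_antimono[OF M] by simp
        then show ?thesis using w1[of j] j True by (simp add: mult_nonneg_nonpos)
      next
        case False
        then have "sv M j \<le> sv M l" using sv_antimono[OF M] by simp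
        then show ?thesis using w0[of j] False by (simp add: mult_nonpos_nonneg)
      qed
    qed
    moreover have "(\<Sum>j<k. ?e j) = real l"
    proof -
      have "{..<k} \<inter> {j. j < l} = {..<l}" using l by auto
      then show ?thesis by (simp add: sum.If_cases)
    qed
    moreover have "(\<Sum>j<k. (sv M j - sv M l) * (w j - ?e j))
       = (\<Sum>j<k. sv M j * w j) - (\<Sum>j<k. sv M j * ?e j) - sv M l * ((\<Sum>j<k. w j) - (\<Sum>j<k. ?e j))"
      by (simp only: sum_distrib_left sum_subtractf[symmetric] algebra_simps)
    ultimately show ?thesis using wsum by simp
  qed
  also have "\<dots> = (\<Sum>j<l. sv M j)"
  proof -
    have "(\<Sum>j<k. sv M j * (if j < l then 1 else 0)) = (\<Sum>j\<in>{..<k} \<inter> {j. j < l}. sv M j)"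
      by (simp add: sum.If_cases if_distrib[of "\<lambda>x. _ * x"] cong: if_cong)
    also have "{..<k} \<inter> {j. j < l} = {..<l}" using l by auto
    finally show ?thesis .
  qed
  finally show ?thesis .
qed

text \<open>Orthogonal factors that diagonalise \<open>B + C\<close> turn its leading singular
  values into a diagonal sum, which splits additively over the two summands rotated in the same
  way.\<close>

lemma ky_fan_square:
  assumes B: "B \<in> carrier_mat k k" and C: "C \<in> carrier_mat k k"
  shows "(\<Sum>i<l. sv (B + C) i) \<le> (\<Sum>i<l. sv B i) + (\<Sum>i<l. sv C i)"
proof -
  have le: "(\<Sum>i<l. sv (B + C) i) \<le> (\<Sum>i<l. sv B i) + (\<Sum>i<l. sv C i)" if l: "l \<le> k" for l
  proof -
    have BC: "B + C \<in> carrier_mat k k" using B C by simp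
    obtain U V where U: "orth_mat k U" and V: "orth_mat k V"
      and eq: "B + C = U * mat_diag k (sv (B + C)) * V\<^sup>T"
      using square_svd[OF BC] by blast
    note Uc = orth_matD[OF U] and Vc = orth_matD[OF V]
    let ?S = "mat_diag k (sv (B + C))"
    have "U\<^sup>T * (B + C) * V = (U\<^sup>T * U) * ?S * (V\<^sup>T * V)"
      by (subst eq) (use Uc(1) Vc(1) in \<open>simp add: assoc_mult_mat[of _ k k _ k _ k] mult_carrier_mat[of _ k k _ k]\<close>)
    also have "\<dots> = ?S" using Uc Vc by (simp add: left_mult_one_mat[of _ k k] right_mult_one_mat[of _ k k])
    finally have S: "?S = U\<^sup>T * B * V + U\<^sup>T * C * V"
      using B C Uc(1) Vc(1) by (simp add: mult_add_distrib_mat[of _ k k _ k] add_mult_distrib_mat[of _ k k _ _ k])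
    have sv_eq: "sv (U\<^sup>T * M * V) i = sv M i" if "M \<in> carrier_mat k k" for M i
      using sv_orth_right[of "U\<^sup>T * M" k k V i] sv_orth_left[of M k k "U\<^sup>T" i]
        that U V orth_mat_transpose[OF U] Uc(1) by simp
    have c: "U\<^sup>T * M * V \<in> carrier_mat k k" if "M \<in> carrier_mat k k" for M
      using Uc(1) Vc(1) that by simp
    have e: "sv (B + C) i = (U\<^sup>T * B * V) $$ (i,i) + (U\<^sup>T * C * V) $$ (i,i)"
      if "i < k" for i
    proof -
      have "sv (B + C) i = ?S $$ (i,i)" using that by (simp add: mat_diag_def)
      also have "\<dots> = (U\<^sup>T * B * V + U\<^sup>T * C * V) $$ (i,i)" by (simp only: S)
      finally show ?thesis using that by (simp only: index_add_mat(1) carrier_matD[OF c[OF C]])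
    qed
    have "(\<Sum>i<l. sv (B + C) i)
        = (\<Sum>i<l. (U\<^sup>T * B * V) $$ (i,i)) + (\<Sum>i<l. (U\<^sup>T * C * V) $$ (i,i))"
      by (rule trans[OF sum.cong[OF refl e] sum.distrib]) (use l in simp)
    then show ?thesis
      using trace_le_sum_sv[OF c[OF B] l] trace_le_sum_sv[OF c[OF C] l] by (simp add: sv_eq B C)
  qed
  show ?thesis
  proof (cases "l \<le> k")
    case False
    \<comment> \<open>Past index \<open>k\<close> all singular values vanish, which reduces the
      claim to \<open>l = k\<close>.\<close>
    have "(\<Sum>i<l. sv M i) = (\<Sum>i<k. sv M i)" if "M \<in> carrier_mat k k" for M
      by (rule sum.mono_neutral_right) (use False that in \<open>auto simp: sv_def\<close>)
    then show ?thesis using le[of k] B C by simp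
  qed (use le in blast)
qed

definition pad_rows :: "nat \<Rightarrow> real mat \<Rightarrow> real mat" where
  "pad_rows N B = mat N (dim_col B) (\<lambda>(i,j). if i < dim_row B then B $$ (i,j) else 0)"

lemma nsq_pad_rows:
  assumes B: "B \<in> carrier_mat m c" and N: "m \<le> N" and v: "v \<in> carrier_vec c"
  shows "nsq (pad_rows N B *\<^sub>v v) = nsq (B *\<^sub>v v)"
proof -
  have P: "pad_rows N B \<in> carrier_mat N c" using B by (simp add: pad_rows_def)
  have e: "(pad_rows N B *\<^sub>v v) $ i = (if i < m then (B *\<^sub>v v) $ i else 0)" if "i < N" for i
    using that B v N by (auto simp: pad_rows_def scalar_prod_def)
  have "nsq (pad_rows N B *\<^sub>v v) = (\<Sum>i<N. ((pad_rows N B *\<^sub>v v) $ i)\<^sup>2)"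
    by (rule nsq_sum) (use P v in simp)
  also have "\<dots> = (\<Sum>i<N. if i < m then ((B *\<^sub>v v) $ i)\<^sup>2 else 0)"
    by (rule sum.cong) (auto simp: e)
  also have "\<dots> = (\<Sum>i<m. ((B *\<^sub>v v) $ i)\<^sup>2)"
  proof -
    have "{..<N} \<inter> {i. i < m} = {..<m}" using N by auto
    then show ?thesis by (simp add: sum.If_cases)
  qed
  also have "\<dots> = nsq (B *\<^sub>v v)" by (rule nsq_sum[symmetric]) (use B v in simp)
  finally show ?thesis .
qed

lemma sv_pad_rows:
  assumes B: "B \<in> carrier_mat m c" and N: "m \<le> N"
  shows "sv (pad_rows N B) i = sv B i"
proof (rule antisym)
  have P: "pad_rows N B \<in> carrier_mat N c" using B by (simp add: pad_rows_def)
  show "sv (pad_rows N B) i \<le> sv B i"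
    by (rule sv_mono[OF P B]) (simp add: nsq_pad_rows[OF B N])
  show "sv B i \<le> sv (pad_rows N B) i"
    by (rule sv_mono[OF B P]) (simp add: nsq_pad_rows[OF B N])
qed

text \<open>Padding the rows, transposing and padding again embeds both matrices additively into
  square ones with the same singular values.\<close>

lemma ky_fan:
  assumes B: "B \<in> carrier_mat m c" and C: "C \<in> carrier_mat m c"
  shows "(\<Sum>i<l. sv (B + C) i) \<le> (\<Sum>i<l. sv B i) + (\<Sum>i<l. sv C i)"
proof -
  define N where "N = max m c"
  define p where "p M = pad_rows N ((pad_rows N M)\<^sup>T)" for M
  have c: "pad_rows N M \<in> carrier_mat N c" "p M \<in> carrier_mat N N" if "M \<in> carrier_mat m c" for M
    using that by (auto simp: p_def pad_rows_def)
  have sv_p: "sv (p M) i = sv M i" if M: "M \<in> carrier_mat m c" for M i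
  proof -
    have "sv (p M) i = sv ((pad_rows N M)\<^sup>T) i"
      unfolding p_def by (rule sv_pad_rows[of _ c N]) (use c[OF M] in \<open>auto simp: N_def\<close>)
    also have "\<dots> = sv (pad_rows N M) i" by (rule sv_transpose[OF c(1)[OF M]])
    also have "\<dots> = sv M i" by (rule sv_pad_rows[OF M]) (simp add: N_def)
    finally show ?thesis .
  qed
  have "p (B + C) = p B + p C"
    by (rule eq_matI) (use B C in \<open>auto simp: p_def pad_rows_def\<close>)
  then have "(\<Sum>i<l. sv (p (B + C)) i) \<le> (\<Sum>i<l. sv (p B) i) + (\<Sum>i<l. sv (p C) i)"
    using ky_fan_square[OF c(2)[OF B] c(2)[OF C], of l] by simp
  then show ?thesis using sv_p[of B] sv_p[of C] sv_p[of "B + C"] B C by simp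
qed

section \<open>Symmetric gauges and unitarily invariant norms\<close>

text \<open>The axioms are restated for coordinate functions, which can be updated and combined
  pointwise.\<close>

lemma
  assumes "symmetric_gauge N \<Phi>"
  shows gauge_smult: "\<Phi> (vec N (\<lambda>i. a * f i)) = \<bar>a\<bar> * \<Phi> (vec N f)"
    and gauge_add: "\<Phi> (vec N (\<lambda>i. f i + g i)) \<le> \<Phi> (vec N f) + \<Phi> (vec N g)"
    and gauge_permute: "p permutes {..<N} \<Longrightarrow> \<Phi> (vec N (\<lambda>i. f (p i))) = \<Phi> (vec N f)"
    and gauge_sign: "(\<And>i. s i = 1 \<or> s i = -1) \<Longrightarrow> \<Phi> (vec N (\<lambda>i. s i * f i)) = \<Phi> (vec N f)"
proof -
  have sm: "\<forall>c. \<forall>x\<in>carrier_vec N. \<Phi> (c \<cdot>\<^sub>v x) = \<bar>c\<bar> * \<Phi> x"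
    and ad: "\<forall>x\<in>carrier_vec N. \<forall>y\<in>carrier_vec N. \<Phi> (x + y) \<le> \<Phi> x + \<Phi> y"
    and pe: "\<forall>p. \<forall>x\<in>carrier_vec N. p permutes {..<N} \<longrightarrow> \<Phi> (vec N (\<lambda>i. x $ p i)) = \<Phi> x"
    and si: "\<forall>s. \<forall>x\<in>carrier_vec N. (\<forall>i<N. s i = 1 \<or> s i = -1) \<longrightarrow> \<Phi> (vec N (\<lambda>i. s i * x $ i)) = \<Phi> x"
    using assms unfolding symmetric_gauge_def by simp_all
  have "a \<cdot>\<^sub>v vec N f = vec N (\<lambda>i. a * f i)" by auto
  then show "\<Phi> (vec N (\<lambda>i. a * f i)) = \<bar>a\<bar> * \<Phi> (vec N f)"
    using sm[rule_format, of "vec N f" a] by simp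
  have "vec N f + vec N g = vec N (\<lambda>i. f i + g i)" by auto
  then show "\<Phi> (vec N (\<lambda>i. f i + g i)) \<le> \<Phi> (vec N f) + \<Phi> (vec N g)"
    using ad[rule_format, of "vec N f" "vec N g"] by simp
  show "\<Phi> (vec N (\<lambda>i. f (p i))) = \<Phi> (vec N f)" if p: "p permutes {..<N}"
  proof -
    have "p i < N" if "i < N" for i using permutes_in_image[OF p, of i] that by simp
    then have "vec N (\<lambda>i. vec N f $ p i) = vec N (\<lambda>i. f (p i))"
      by (intro eq_vecI) simp_all
    then show ?thesis using pe[rule_format, of "vec N f" p] p by simp
  qed
  show "\<Phi> (vec N (\<lambda>i. s i * f i)) = \<Phi> (vec N f)" if s: "\<And>i. s i = 1 \<or> s i = -1"
  proof -
    have "vec N (\<lambda>i. s i * vec N f $ i) = vec N (\<lambda>i. s i * f i)" by (intro eq_vecI) simp_all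
    moreover have "\<Phi> (vec N (\<lambda>i. s i * vec N f $ i)) = \<Phi> (vec N f)"
      by (rule si[rule_format]) (simp_all only: vec_carrier s)
    ultimately show ?thesis by simp
  qed
qed

text \<open>With \<open>t = a / f j\<close> in [-1, 1], the changed vector is a convex combination,
  with weights \<open>(1 + t) / 2\<close> and \<open>(1 - t) / 2\<close>, of the vector and its
  reflection in coordinate \<open>j\<close>.\<close>

lemma gauge_shrink_coordinate:
  assumes G: "symmetric_gauge N \<Phi>" and a: "\<bar>a\<bar> \<le> \<bar>f j\<bar>"
  shows "\<Phi> (vec N (f(j := a))) \<le> \<Phi> (vec N f)"
proof (cases "f j = 0")
  case False
  define t where "t = a / f j"
  have t: "\<bar>t\<bar> \<le> 1" using a False by (simp add: t_def)
  let ?s = "\<lambda>i. if i = j then -1 else 1 :: real"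
  have "f(j := a) = (\<lambda>i. (1 + t) / 2 * f i + (1 - t) / 2 * (?s i * f i))"
    using False by (auto simp: t_def field_simps)
  then have "\<Phi> (vec N (f(j := a))) = \<Phi> (vec N (\<lambda>i. (1 + t) / 2 * f i + (1 - t) / 2 * (?s i * f i)))"
    by simp
  also have "\<dots> \<le> \<Phi> (vec N (\<lambda>i. (1 + t) / 2 * f i)) + \<Phi> (vec N (\<lambda>i. (1 - t) / 2 * (?s i * f i)))"
    by (rule gauge_add[OF G])
  also have "\<dots> = \<bar>(1 + t) / 2\<bar> * \<Phi> (vec N f) + \<bar>(1 - t) / 2\<bar> * \<Phi> (vec N f)"
    using gauge_sign[OF G, of ?s f] by (simp only: gauge_smult[OF G]) simp
  also have "\<dots> = \<Phi> (vec N f)" using t by (simp add: abs_if field_simps split: if_splits)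
  finally show ?thesis .
qed (use a in \<open>simp add: fun_upd_idem\<close>)

text \<open>The coordinates are replaced one at a time, each replacement being a shrinking.\<close>

lemma gauge_mono:
  assumes G: "symmetric_gauge N \<Phi>" and le: "\<And>i. i < N \<Longrightarrow> \<bar>f i\<bar> \<le> \<bar>g i\<bar>"
  shows "\<Phi> (vec N f) \<le> \<Phi> (vec N g)"
proof -
  have "\<Phi> (vec N (\<lambda>i. if i < m then f i else g i)) \<le> \<Phi> (vec N g)" if "m \<le> N" for m
    using that
  proof (induction m)
    case (Suc m)
    let ?h = "\<lambda>i. if i < m then f i else g i"
    have "(\<lambda>i. if i < Suc m then f i else g i) = ?h(m := f m)" by (auto simp: less_Suc_eq)
    then have "\<Phi> (vec N (\<lambda>i. if i < Suc m then f i else g i)) = \<Phi> (vec N (?h(m := f m)))" by simp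
    also have "\<dots> \<le> \<Phi> (vec N ?h)"
      by (rule gauge_shrink_coordinate[OF G]) (use le[of m] Suc.prems in simp)
    finally show ?case using Suc by simp
  qed simp
  from this[of N] have "\<Phi> (vec N (\<lambda>i. if i < N then f i else g i)) \<le> \<Phi> (vec N g)" by simp
  moreover have "vec N (\<lambda>i. if i < N then f i else g i) = vec N f" by auto
  ultimately show ?thesis by simp
qed

text \<open>The changed vector is a convex combination of \<open>f\<close> and of \<open>f\<close>
  with coordinates \<open>i\<close> and \<open>j\<close> exchanged, the latter with weight
  \<open>\<delta> / (f i - f j)\<close>.\<close>

lemma gauge_transfer:
  assumes G: "symmetric_gauge N \<Phi>" and ij: "i < N" "j < N" "i \<noteq> j"
    and \<delta>: "0 \<le> \<delta>" "\<delta> \<le> f i - f j"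
  shows "\<Phi> (vec N (f(i := f i - \<delta>, j := f j + \<delta>))) \<le> \<Phi> (vec N f)"
proof (cases "\<delta> = 0")
  case False
  define t where "t = \<delta> / (f i - f j)"
  have t: "0 \<le> t" "t \<le> 1" using \<delta> False by (auto simp: t_def)
  have td: "t * (f i - f j) = \<delta>" using \<delta> False by (simp add: t_def)
  let ?p = "Transposition.transpose i j"
  have "f(i := f i - \<delta>, j := f j + \<delta>) = (\<lambda>l. (1 - t) * f l + t * f (?p l))"
    unfolding td[symmetric] using ij(3) by (auto simp: Transposition.transpose_def algebra_simps)
  then have "\<Phi> (vec N (f(i := f i - \<delta>, j := f j + \<delta>))) = \<Phi> (vec N (\<lambda>l. (1 - t) * f l + t * f (?p l)))"
    by simp
  also have "\<dots> \<le> \<Phi> (vec N (\<lambda>l. (1 - t) * f l)) + \<Phi> (vec N (\<lambda>l. t * f (?p l)))"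
    by (rule gauge_add[OF G])
  also have "\<dots> = \<bar>1 - t\<bar> * \<Phi> (vec N f) + \<bar>t\<bar> * \<Phi> (vec N f)"
    using gauge_permute[OF G, of ?p f] ij by (simp only: gauge_smult[OF G]) (simp add: permutes_swap_id)
  also have "\<dots> = \<Phi> (vec N f)" using t by (simp add: algebra_simps)
  finally show ?thesis .
qed simp

text \<open>Hardy-Littlewood-Polya: as long as \<open>x\<close> does not dominate \<open>y\<close>, mass can be moved from an
  earlier to a later coordinate of \<open>x\<close> so that one more coordinate agrees with \<open>y\<close>.\<close>

lemma gauge_weak_majorization:
  assumes G: "symmetric_gauge N \<Phi>"
    and y0: "\<And>i. i < N \<Longrightarrow> 0 \<le> y i" and dec: "\<And>i j. i \<le> j \<Longrightarrow> j < N \<Longrightarrow> y j \<le> y i"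
    and x0: "\<And>i. i < N \<Longrightarrow> 0 \<le> x i"
    and maj: "\<And>m. m \<le> N \<Longrightarrow> (\<Sum>i<m. y i) \<le> (\<Sum>i<m. x i)"
  shows "\<Phi> (vec N y) \<le> \<Phi> (vec N x)"
  using x0 maj
proof (induction "card {i. i < N \<and> x i \<noteq> y i}" arbitrary: x rule: less_induct)
  case (less x)
  show ?case
  proof (cases "\<forall>i<N. y i \<le> x i")
    case True
    then show ?thesis using y0 less.prems(1) by (intro gauge_mono[OF G]) auto
  next
    case False
    define j where "j = (LEAST j. j < N \<and> x j < y j)"
    have j: "j < N" "x j < y j"
      using LeastI_ex[of "\<lambda>j. j < N \<and> x j < y j"] False by (auto simp: j_def not_le)
    have before: "y l \<le> x l" if "l < j" for l
      using not_less_Least[of l "\<lambda>j. j < N \<and> x j < y j"] that j(1) by (auto simp: j_def)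
    \<comment> \<open>Without a surplus before \<open>j\<close> the partial sums would agree up to
      \<open>j\<close>, and the deficit at \<open>j\<close> would violate majorization for
      \<open>Suc j\<close>.\<close>
    obtain i where i: "i < j" "y i < x i"
    proof (rule ccontr)
      assume "\<not> thesis"
      then have "x l = y l" if "l < j" for l
        using before[OF that] that \<open>\<And>i. i < j \<Longrightarrow> y i < x i \<Longrightarrow> thesis\<close> by fastforce
      then have "(\<Sum>l<j. x l) = (\<Sum>l<j. y l)" by simp
      then show False using less.prems(2)[of "Suc j"] j by simp
    qed
    \<comment> \<open>The largest amount that keeps \<open>x i\<close> at or above
      \<open>y i\<close> and \<open>x j\<close> at or below \<open>y j\<close>; it makes one of the
      two coordinates agree.\<close>
    define \<delta> where "\<delta> = min (x i - y i) (y j - x j)"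
    have \<delta>: "0 < \<delta>" "\<delta> \<le> x i - y i" "\<delta> \<le> y j - x j" using i j by (auto simp: \<delta>_def)
    have yij: "y j \<le> y i" using dec[of i j] i j by simp
    define x' where "x' = x(i := x i - \<delta>, j := x j + \<delta>)"
    have x'i: "x' i = x i - \<delta>" and x'j: "x' j = x j + \<delta>"
      and x'l: "\<And>l. l \<noteq> i \<Longrightarrow> l \<noteq> j \<Longrightarrow> x' l = x l"
      using i by (auto simp: x'_def)
    have x'0: "0 \<le> x' l" if "l < N" for l
    proof -
      consider "l = i" | "l = j" | "l \<noteq> i" "l \<noteq> j" by blast
      then show ?thesis using that less.prems(1)[OF that] x'i x'j x'l \<delta> y0[OF that] by cases auto
    qed
    have "\<Phi> (vec N y) \<le> \<Phi> (vec N x')"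
    proof (rule less.hyps)
      have "{l. l < N \<and> x' l \<noteq> y l} \<subset> {l. l < N \<and> x l \<noteq> y l}"
      proof (rule psubsetI)
        show "{l. l < N \<and> x' l \<noteq> y l} \<subseteq> {l. l < N \<and> x l \<noteq> y l}"
        proof (rule subsetI)
          fix l assume "l \<in> {l. l < N \<and> x' l \<noteq> y l}"
          then have l: "l < N" "x' l \<noteq> y l" by simp_all
          consider "l = i" | "l = j" | "l \<noteq> i" "l \<noteq> j" by blast
          then have "x l \<noteq> y l" using l(2) x'l i(2) j(2) by cases simp_all
          then show "l \<in> {l. l < N \<and> x l \<noteq> y l}" using l(1) by simp
        qed
        have "i \<in> {l. l < N \<and> x l \<noteq> y l}" "j \<in> {l. l < N \<and> x l \<noteq> y l}"
          using i j by simp_all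
        moreover have "x' i = y i \<or> x' j = y j" unfolding x'i x'j \<delta>_def by (auto simp: min_def)
        then have "i \<notin> {l. l < N \<and> x' l \<noteq> y l} \<or> j \<notin> {l. l < N \<and> x' l \<noteq> y l}" by simp
        ultimately show "{l. l < N \<and> x' l \<noteq> y l} \<noteq> {l. l < N \<and> x l \<noteq> y l}" by metis
      qed
      then show "card {l. l < N \<and> x' l \<noteq> y l} < card {l. l < N \<and> x l \<noteq> y l}"
        by (intro psubset_card_mono) auto
      show "0 \<le> x' l" if "l < N" for l using x'0[OF that] .
      show "(\<Sum>l<m. y l) \<le> (\<Sum>l<m. x' l)" if m: "m \<le> N" for m
      \<comment> \<open>Before \<open>j\<close> every coordinate still dominates; beyond
        \<open>j\<close> the transfer leaves the partial sum unchanged.\<close>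
      proof (cases "m \<le> j")
        case True
        show ?thesis
        proof (rule sum_mono)
          fix l assume "l \<in> {..<m}"
          then have "l < j" using True by simp
          then show "y l \<le> x' l" using before[of l] x'l[of l] x'i \<delta>(2) by (cases "l = i") auto
        qed
      next
        case False
        have split: "(\<Sum>l<m. g l) = g i + g j + (\<Sum>l\<in>{..<m} - {i,j}. g l)" for g :: "nat \<Rightarrow> real"
        proof -
          have "(\<Sum>l<m. g l) = (\<Sum>l\<in>{i,j}. g l) + (\<Sum>l\<in>{..<m} - {i,j}. g l)"
            by (subst add.commute, rule sum.subset_diff) (use i False in auto)
          then show ?thesis using i by simp
        qed
        have "(\<Sum>l\<in>{..<m} - {i,j}. x' l) = (\<Sum>l\<in>{..<m} - {i,j}. x l)"
          by (rule sum.cong) (auto simp: x'l)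
        then have "(\<Sum>l<m. x' l) = (\<Sum>l<m. x l)" unfolding split[of x'] split[of x] x'i x'j by simp
        then show ?thesis using less.prems(2)[OF m] by simp
      qed
    qed
    \<comment> \<open>The transfer is admissible: \<open>\<delta>\<close> is at most
      \<open>x i - x j\<close>, because \<open>x j < y j\<close> and
      \<open>y j \<le> y i\<close>.\<close>
    also have "\<Phi> (vec N x') \<le> \<Phi> (vec N x)"
      unfolding x'_def by (rule gauge_transfer[OF G]) (use i j \<delta> yij in auto)
    finally show ?thesis .
  qed
qed

section \<open>The three norms as monotone norms\<close>

lemma sv_ge_dim_row: "B \<in> carrier_mat m c \<Longrightarrow> m \<le> i \<Longrightarrow> sv B i = 0"
  using sv_transpose[of B m c i] by (simp add: sv_def)

lemma singular_values_eq:
  assumes B: "B \<in> carrier_mat m c"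
  shows "singular_values B = map (sv B) [0..<min m c]"
proof -
  let ?l = "rev (sorted_list_of_multiset (image_mset sqrt (proots (char_poly (B\<^sup>T * B)))))"
  obtain V where "orth_mat c V" "(B * V)\<^sup>T * (B * V) = mat_diag c (\<lambda>i. (sv B i)\<^sup>2)"
    using exists_sv_basis[OF B] by blast
  then have "?l = map (\<lambda>i. sqrt ((sv B i)\<^sup>2)) [0..<c]"
    by (rule sorted_sqrt_eigenvalues_gram[OF B]) (use sv_nonneg[OF B] sv_antimono[OF B] in \<open>auto intro: power_mono\<close>)
  also have "\<dots> = map (sv B) [0..<c]" using sv_nonneg[OF B] by simp
  finally show ?thesis using B by (simp add: singular_values_def take_map)
qed

lemma ui_norm_eq:
  assumes B: "B \<in> carrier_mat m c"
  shows "ui_norm N \<Phi> B = \<Phi> (vec N (sv B))"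
proof -
  have "(if i < length (singular_values B) then singular_values B ! i else 0) = sv B i" for i
    using B sv_ge_dim_row[OF B, of i] sv_beyond[of B i] unfolding singular_values_eq[OF B] by auto
  then show ?thesis by (simp add: ui_norm_def)
qed

lemma spectral_norm_eq:
  assumes B: "B \<in> carrier_mat m c"
  shows "spectral_norm B = sv B 0"
proof (cases "min m c = 0")
  case True
  then have "sv B 0 = 0" using B sv_ge_dim_row[OF B, of 0] sv_beyond[of B 0] by (cases "m = 0") auto
  then show ?thesis using True by (simp add: spectral_norm_def singular_values_eq[OF B])
next
  case False
  have "Max (insert 0 (set (singular_values B))) = sv B 0"
    by (rule Max_eqI) (use False sv_nonneg[OF B] sv_antimono[OF B] in \<open>auto simp: singular_values_eq[OF B]\<close>)
  then show ?thesis by (simp add: spectral_norm_def)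
qed

text \<open>The properties of unitarily invariant norms that the proof uses. Monotonicity under
  \<open>B\<^sup>T B \<le> C\<^sup>T C\<close> contains the unitary invariance, and makes the norm dimension-free.\<close>

locale monotone_matrix_norm =
  fixes nrm :: "real mat \<Rightarrow> real" and N :: nat
  assumes nrm_mono: "\<And>m m' c B C. B \<in> carrier_mat m c \<Longrightarrow> C \<in> carrier_mat m' c \<Longrightarrow>
      m \<le> N \<Longrightarrow> m' \<le> N \<Longrightarrow> c \<le> N \<Longrightarrow>
      (\<And>v. v \<in> carrier_vec c \<Longrightarrow> nsq (B *\<^sub>v v) \<le> nsq (C *\<^sub>v v)) \<Longrightarrow> nrm B \<le> nrm C"
    and nrm_add: "\<And>m c B C. B \<in> carrier_mat m c \<Longrightarrow> C \<in> carrier_mat m c \<Longrightarrow> m \<le> N \<Longrightarrow> c \<le> N \<Longrightarrow>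
      nrm (B + C) \<le> nrm B + nrm C"
    and nrm_transpose: "\<And>m c B. B \<in> carrier_mat m c \<Longrightarrow> m \<le> N \<Longrightarrow> c \<le> N \<Longrightarrow>
      nrm (B\<^sup>T) = nrm B"
    and nrm_smult: "\<And>m c B a. B \<in> carrier_mat m c \<Longrightarrow> m \<le> N \<Longrightarrow> c \<le> N \<Longrightarrow>
      nrm (a \<cdot>\<^sub>m B) = \<bar>a\<bar> * nrm B"

lemma ui_norm_monotone_matrix_norm:
  assumes G: "symmetric_gauge N \<Phi>"
  shows "monotone_matrix_norm (ui_norm N \<Phi>) N"
proof
  fix m m' c and B C :: "real mat"
  assume B: "B \<in> carrier_mat m c" and C: "C \<in> carrier_mat m' c"
    and le: "\<And>v. v \<in> carrier_vec c \<Longrightarrow> nsq (B *\<^sub>v v) \<le> nsq (C *\<^sub>v v)"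
  show "ui_norm N \<Phi> B \<le> ui_norm N \<Phi> C"
    unfolding ui_norm_eq[OF B] ui_norm_eq[OF C]
    by (rule gauge_mono[OF G]) (use sv_mono[OF B C le] sv_nonneg[OF B] sv_nonneg[OF C] in simp)
next
  fix m c and B C :: "real mat"
  assume B: "B \<in> carrier_mat m c" and C: "C \<in> carrier_mat m c"
  have BC: "B + C \<in> carrier_mat m c" using B C by simp
  have "\<Phi> (vec N (sv (B + C))) \<le> \<Phi> (vec N (\<lambda>i. sv B i + sv C i))"
    by (rule gauge_weak_majorization[OF G])
      (use sv_nonneg[OF BC] sv_antimono[OF BC] sv_nonneg[OF B] sv_nonneg[OF C] ky_fan[OF B C]
        in \<open>auto simp: sum.distrib\<close>)
  also have "\<dots> \<le> \<Phi> (vec N (sv B)) + \<Phi> (vec N (sv C))" by (rule gauge_add[OF G])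
  finally show "ui_norm N \<Phi> (B + C) \<le> ui_norm N \<Phi> B + ui_norm N \<Phi> C"
    unfolding ui_norm_eq[OF B] ui_norm_eq[OF C] ui_norm_eq[OF BC] .
next
  fix m c and B :: "real mat"
  assume B: "B \<in> carrier_mat m c"
  have BT: "B\<^sup>T \<in> carrier_mat c m" using B by simp
  show "ui_norm N \<Phi> (B\<^sup>T) = ui_norm N \<Phi> B"
    unfolding ui_norm_eq[OF B] ui_norm_eq[OF BT] sv_transpose[OF B] ..
next
  fix m c and B :: "real mat" and a :: real
  assume B: "B \<in> carrier_mat m c"
  have aB: "a \<cdot>\<^sub>m B \<in> carrier_mat m c" using B by simp
  have "sv (a \<cdot>\<^sub>m B) = (\<lambda>i. \<bar>a\<bar> * sv B i)" using sv_smult[OF B] by auto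
  then show "ui_norm N \<Phi> (a \<cdot>\<^sub>m B) = \<bar>a\<bar> * ui_norm N \<Phi> B"
    unfolding ui_norm_eq[OF B] ui_norm_eq[OF aB] using gauge_smult[OF G, of "\<bar>a\<bar>" "sv B"] by simp
qed

lemma spectral_norm_monotone_matrix_norm: "monotone_matrix_norm spectral_norm N"
proof
  fix m m' c and B C :: "real mat"
  assume B: "B \<in> carrier_mat m c" and C: "C \<in> carrier_mat m' c"
    and le: "\<And>v. v \<in> carrier_vec c \<Longrightarrow> nsq (B *\<^sub>v v) \<le> nsq (C *\<^sub>v v)"
  show "spectral_norm B \<le> spectral_norm C"
    unfolding spectral_norm_eq[OF B] spectral_norm_eq[OF C] by (rule sv_mono[OF B C le])
next
  fix m c and B C :: "real mat"
  assume B: "B \<in> carrier_mat m c" and C: "C \<in> carrier_mat m c"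
  have BC: "B + C \<in> carrier_mat m c" using B C by simp
  show "spectral_norm (B + C) \<le> spectral_norm B + spectral_norm C"
    unfolding spectral_norm_eq[OF B] spectral_norm_eq[OF C] spectral_norm_eq[OF BC]
    using ky_fan[OF B C, of 1] by simp
next
  fix m c and B :: "real mat"
  assume B: "B \<in> carrier_mat m c"
  have BT: "B\<^sup>T \<in> carrier_mat c m" using B by simp
  show "spectral_norm (B\<^sup>T) = spectral_norm B"
    unfolding spectral_norm_eq[OF B] spectral_norm_eq[OF BT] sv_transpose[OF B] ..
next
  fix m c and B :: "real mat" and a :: real
  assume B: "B \<in> carrier_mat m c"
  have aB: "a \<cdot>\<^sub>m B \<in> carrier_mat m c" using B by simp
  show "spectral_norm (a \<cdot>\<^sub>m B) = \<bar>a\<bar> * spectral_norm B"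
    unfolding spectral_norm_eq[OF B] spectral_norm_eq[OF aB] by (rule sv_smult[OF B])
qed

lemma frobenius_norm_L2_set:
  assumes "B \<in> carrier_mat m c"
  shows "frobenius_norm B = L2_set (\<lambda>p. B $$ p) ({..<m} \<times> {..<c})"
  using assms by (simp add: frobenius_norm_def L2_set_def sum.cartesian_product)

text \<open>As a sum over the images of the unit vectors, the norm is visibly monotone in the
  lengths of images.\<close>

lemma frobenius_norm_cols:
  assumes B: "B \<in> carrier_mat m c"
  shows "(frobenius_norm B)\<^sup>2 = (\<Sum>j<c. nsq (B *\<^sub>v unit_vec c j))"
proof -
  have "nsq (B *\<^sub>v unit_vec c j) = (\<Sum>i<m. (B $$ (i,j))\<^sup>2)" if "j < c" for j
    using B that nsq_sum[of "B *\<^sub>v unit_vec c j" m] by simp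
  then have "(\<Sum>j<c. nsq (B *\<^sub>v unit_vec c j)) = (\<Sum>j<c. \<Sum>i<m. (B $$ (i,j))\<^sup>2)" by simp
  also have "\<dots> = (\<Sum>i<m. \<Sum>j<c. (B $$ (i,j))\<^sup>2)" by (rule sum.swap)
  finally show ?thesis using B by (simp add: frobenius_norm_def sum_nonneg)
qed

lemma frobenius_norm_nonneg: "0 \<le> frobenius_norm B"
  by (simp add: frobenius_norm_def sum_nonneg)

lemma frobenius_norm_monotone_matrix_norm: "monotone_matrix_norm frobenius_norm N"
proof
  fix m m' c and B C :: "real mat"
  assume B: "B \<in> carrier_mat m c" and C: "C \<in> carrier_mat m' c"
    and le: "\<And>v. v \<in> carrier_vec c \<Longrightarrow> nsq (B *\<^sub>v v) \<le> nsq (C *\<^sub>v v)"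
  have "(frobenius_norm B)\<^sup>2 \<le> (frobenius_norm C)\<^sup>2"
    unfolding frobenius_norm_cols[OF B] frobenius_norm_cols[OF C] by (intro sum_mono le) simp
  then show "frobenius_norm B \<le> frobenius_norm C"
    using frobenius_norm_nonneg power2_le_imp_le by blast
next
  fix m c and B C :: "real mat"
  assume B: "B \<in> carrier_mat m c" and C: "C \<in> carrier_mat m c"
  have BC: "B + C \<in> carrier_mat m c" using B C by simp
  have "L2_set (\<lambda>p. (B + C) $$ p) ({..<m} \<times> {..<c}) = L2_set (\<lambda>p. B $$ p + C $$ p) ({..<m} \<times> {..<c})"
    by (rule L2_set_cong) (use B C in auto)
  then show "frobenius_norm (B + C) \<le> frobenius_norm B + frobenius_norm C"
    unfolding frobenius_norm_L2_set[OF B] frobenius_norm_L2_set[OF C] frobenius_norm_L2_set[OF BC]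
    using L2_set_triangle_ineq[of "\<lambda>p. B $$ p" "\<lambda>p. C $$ p" "{..<m} \<times> {..<c}"] by simp
next
  fix m c and B :: "real mat"
  assume B: "B \<in> carrier_mat m c"
  have "(\<Sum>i<c. \<Sum>j<m. (B $$ (j,i))\<^sup>2) = (\<Sum>i<m. \<Sum>j<c. (B $$ (i,j))\<^sup>2)" by (rule sum.swap)
  then show "frobenius_norm (B\<^sup>T) = frobenius_norm B"
    using B by (simp add: frobenius_norm_def)
next
  fix m c and B :: "real mat" and a :: real
  assume B: "B \<in> carrier_mat m c"
  then show "frobenius_norm (a \<cdot>\<^sub>m B) = \<bar>a\<bar> * frobenius_norm B"
    by (simp add: frobenius_norm_def power_mult_distrib real_sqrt_mult flip: sum_distrib_left)
qed

section \<open>Alignment of orthonormal bases\<close>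

lemma nsq_minus:
  assumes "u \<in> carrier_vec n" "v \<in> carrier_vec n"
  shows "nsq (u - v) = nsq u - 2 * (u \<bullet> v) + nsq v"
  using assms comm_scalar_prod[of v n u]
  by (simp add: minus_scalar_prod_distrib[of _ n] scalar_prod_minus_distrib[of _ n])

text \<open>Pythagoras for the orthogonal projection \<open>G * G\<^sup>T\<close>, which sends
  \<open>y\<close> to a vector as long as \<open>G\<^sup>T *\<^sub>v y\<close>.\<close>

lemma nsq_projection_complement:
  assumes G: "G \<in> carrier_mat p q" "G\<^sup>T * G = 1\<^sub>m q" and y: "y \<in> carrier_vec p"
  shows "nsq ((1\<^sub>m p - G * G\<^sup>T) *\<^sub>v y) = nsq y - nsq (G\<^sup>T *\<^sub>v y)"
proof -
  define z where "z = G\<^sup>T *\<^sub>v y"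
  have z: "z \<in> carrier_vec q" using G y by (simp add: z_def)
  have Gz: "G *\<^sub>v z \<in> carrier_vec p" using G z by simp
  have "(1\<^sub>m p - G * G\<^sup>T) *\<^sub>v y = y - G *\<^sub>v z"
    using G y by (simp add: z_def minus_mult_distrib_mat_vec[of _ p p] assoc_mult_mat_vec[of G p q])
  then have "nsq ((1\<^sub>m p - G * G\<^sup>T) *\<^sub>v y) = nsq y - 2 * (y \<bullet> (G *\<^sub>v z)) + nsq (G *\<^sub>v z)"
    using nsq_minus[OF y Gz] by simp
  moreover have "y \<bullet> (G *\<^sub>v z) = nsq z"
    using transpose_vec_mult_scalar[OF G(1) z y] by (simp add: z_def)
  moreover have "nsq (G *\<^sub>v z) = nsq z" by (rule nsq_isometry[OF G z])
  ultimately show ?thesis by (simp add: z_def)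
qed

lemma nsq_transpose_isometry_le:
  assumes "G \<in> carrier_mat p q" "G\<^sup>T * G = 1\<^sub>m q" "y \<in> carrier_vec p"
  shows "nsq (G\<^sup>T *\<^sub>v y) \<le> nsq y"
  using nsq_projection_complement[OF assms] scalar_prod_self_nonneg
  by (metis diff_ge_0_iff_ge)

lemma sv_one: "i < c \<Longrightarrow> sv (1\<^sub>m c) i = 1"
  using sv_eqI[of "1\<^sub>m c" c c "1\<^sub>m c" "\<lambda>_. 1" i] by simp

lemma nsq_mat_diag:
  "z \<in> carrier_vec k \<Longrightarrow> nsq (mat_diag k f *\<^sub>v z) = (\<Sum>i<k. (f i)\<^sup>2 * (z $ i)\<^sup>2)"
  by (simp add: mat_diag_mult_vec scalar_prod_def lessThan_atLeast0 power2_eq_square mult_ac)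

text \<open>The orthogonal factor \<open>W\<close> of the polar decomposition of \<open>G\<^sup>T H\<close> aligns \<open>G\<close> with \<open>H\<close>; the
  constant comes from \<open>1 - cos \<theta> \<le> sin\<^sup>2 \<theta>\<close>.\<close>

lemma polar_alignment:
  assumes G: "G \<in> carrier_mat p q" "G\<^sup>T * G = 1\<^sub>m q"
    and H: "H \<in> carrier_mat p q" "H\<^sup>T * H = 1\<^sub>m q"
  shows "\<exists>W. orth_mat q W \<and> (\<forall>v\<in>carrier_vec q.
    nsq ((H - G * W) *\<^sub>v v) \<le> 2 * nsq ((1\<^sub>m p - G * G\<^sup>T) *\<^sub>v (H *\<^sub>v v)))"
proof -
  define M where "M = G\<^sup>T * H"
  have M: "M \<in> carrier_mat q q" using G H by (simp add: M_def)
  have Mv: "M *\<^sub>v v = G\<^sup>T *\<^sub>v (H *\<^sub>v v)" if "v \<in> carrier_vec q" for v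
    using G H that by (simp add: M_def assoc_mult_mat_vec[of _ q p _ q])
  obtain U V where U: "orth_mat q U" and V: "orth_mat q V"
    and eq: "M = U * mat_diag q (sv M) * V\<^sup>T"
    using square_svd[OF M] by blast
  note Uc = orth_matD[OF U] and Vc = orth_matD[OF V]
  define W where "W = U * V\<^sup>T"
  have W: "orth_mat q W" unfolding W_def by (intro orth_mat_mult U orth_mat_transpose V)
  have s: "0 \<le> sv M i" "sv M i \<le> 1" if "i < q" for i
  proof -
    show "0 \<le> sv M i" by (rule sv_nonneg[OF M])
    have "sv M i \<le> sv (1\<^sub>m q) i"
    proof (rule sv_mono[OF M one_carrier_mat])
      fix v :: "real vec" assume v: "v \<in> carrier_vec q"
      have "nsq (M *\<^sub>v v) \<le> nsq (H *\<^sub>v v)"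
        unfolding Mv[OF v] by (rule nsq_transpose_isometry_le[OF G]) (use H v in simp)
      then show "nsq (M *\<^sub>v v) \<le> nsq (1\<^sub>m q *\<^sub>v v)" using nsq_isometry[OF H v] v by simp
    qed
    then show "sv M i \<le> 1" using sv_one that by simp
  qed
  have "nsq ((H - G * W) *\<^sub>v v) \<le> 2 * nsq ((1\<^sub>m p - G * G\<^sup>T) *\<^sub>v (H *\<^sub>v v))"
    if v: "v \<in> carrier_vec q" for v
  proof -
    define z where "z = V\<^sup>T *\<^sub>v v"
    have z: "z \<in> carrier_vec q" using Vc v by (simp add: z_def)
    have nz: "nsq z = nsq v" unfolding z_def by (rule nsq_orth[OF orth_mat_transpose[OF V] v])
    have Sz: "mat_diag q (sv M) *\<^sub>v z \<in> carrier_vec q" using z by (simp add: mat_diag_mult_vec)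
    have Mz: "M *\<^sub>v v = U *\<^sub>v (mat_diag q (sv M) *\<^sub>v z)"
      by (subst eq) (use Uc Vc v z in \<open>simp add: z_def assoc_mult_mat_vec[of _ q q _ q] mult_carrier_mat[of _ q q _ q]\<close>)
    have Wz: "W *\<^sub>v v = U *\<^sub>v z"
      using Uc Vc v by (simp add: W_def z_def assoc_mult_mat_vec[of _ q q _ q])
    have Wv: "W *\<^sub>v v \<in> carrier_vec q" using orth_matD(1)[OF W] v by simp
    have Hv: "H *\<^sub>v v \<in> carrier_vec p" using H v by simp
    have GW: "(H - G * W) *\<^sub>v v = H *\<^sub>v v - G *\<^sub>v (W *\<^sub>v v)"
      using G H v orth_matD(1)[OF W] by (simp add: minus_mult_distrib_mat_vec[of _ p q] assoc_mult_mat_vec[of G p q _ q])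
    have "nsq ((H - G * W) *\<^sub>v v) = nsq (H *\<^sub>v v) - 2 * ((H *\<^sub>v v) \<bullet> (G *\<^sub>v (W *\<^sub>v v))) + nsq (G *\<^sub>v (W *\<^sub>v v))"
      unfolding GW by (rule nsq_minus[OF Hv]) (use G Wv in simp)
    also have "(H *\<^sub>v v) \<bullet> (G *\<^sub>v (W *\<^sub>v v)) = (M *\<^sub>v v) \<bullet> (W *\<^sub>v v)"
      unfolding Mv[OF v] by (rule transpose_vec_mult_scalar[OF G(1) Wv Hv, symmetric])
    also have "\<dots> = (U *\<^sub>v (mat_diag q (sv M) *\<^sub>v z)) \<bullet> (U *\<^sub>v z)" by (simp add: Mz Wz)
    also have "\<dots> = (mat_diag q (sv M) *\<^sub>v z) \<bullet> ((U\<^sup>T * U) *\<^sub>v z)"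
      using scalar_prod_mult_mat_vec[OF Uc(1) Sz, of "U *\<^sub>v z"] Uc(1) z by (simp add: assoc_mult_mat_vec[of _ q q _ q])
    also have "\<dots> = (\<Sum>i<q. sv M i * (z $ i)\<^sup>2)"
      using z Uc by (simp add: mat_diag_mult_vec scalar_prod_def lessThan_atLeast0 power2_eq_square mult_ac)
    also have "nsq (H *\<^sub>v v) = nsq v" by (rule nsq_isometry[OF H v])
    also have "nsq (G *\<^sub>v (W *\<^sub>v v)) = nsq v" using nsq_isometry[OF G Wv] nsq_orth[OF W v] by simp
    finally have "nsq ((H - G * W) *\<^sub>v v) = 2 * nsq v - 2 * (\<Sum>i<q. sv M i * (z $ i)\<^sup>2)" by simp
    moreover have "(\<Sum>i<q. (sv M i)\<^sup>2 * (z $ i)\<^sup>2) \<le> (\<Sum>i<q. sv M i * (z $ i)\<^sup>2)"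
      by (intro sum_mono mult_right_mono) (use s in \<open>auto simp: power2_eq_square mult_left_le\<close>)
    moreover have "nsq (M *\<^sub>v v) = (\<Sum>i<q. (sv M i)\<^sup>2 * (z $ i)\<^sup>2)"
      using nsq_orth[OF U Sz] nsq_mat_diag[OF z] Mz by simp
    moreover have "nsq ((1\<^sub>m p - G * G\<^sup>T) *\<^sub>v (H *\<^sub>v v)) = nsq v - nsq (M *\<^sub>v v)"
      using nsq_projection_complement[OF G Hv] nsq_isometry[OF H v] Mv[OF v] by simp
    ultimately show ?thesis by simp
  qed
  with W show ?thesis by blast
qed

text \<open>The functional calculus in the eigenbasis \<open>V\<close>.\<close>

definition fc :: "nat \<Rightarrow> real mat \<Rightarrow> (nat \<Rightarrow> real) \<Rightarrow> real mat" where
  "fc k V f = V * mat_diag k f * V\<^sup>T"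

context
  fixes k :: nat and V :: "real mat"
  assumes V: "orth_mat k V"
begin

lemma fc_carrier: "fc k V f \<in> carrier_mat k k"
  using orth_matD(1)[OF V] by (simp add: fc_def mult_carrier_mat[of _ k k _ k])

lemma fc_transpose: "(fc k V f)\<^sup>T = fc k V f"
proof -
  have "(mat_diag k f)\<^sup>T = mat_diag k f" by (rule eq_matI) (auto simp: mat_diag_def)
  then show ?thesis using orth_matD(1)[OF V]
    by (simp add: fc_def transpose_mult[of _ k k _ k] mult_carrier_mat[of _ k k _ k] assoc_mult_mat[of _ k k _ k _ k])
qed

lemma fc_mult: "fc k V f * fc k V g = fc k V (\<lambda>i. f i * g i)"
proof -
  note Vc = orth_matD[OF V]
  have "fc k V f * fc k V g = V * mat_diag k f * ((V\<^sup>T * V) * (mat_diag k g * V\<^sup>T))"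
    using Vc(1) by (simp add: fc_def assoc_mult_mat[of _ k k _ k _ k] mult_carrier_mat[of _ k k _ k])
  also have "\<dots> = V * (mat_diag k f * mat_diag k g) * V\<^sup>T"
    unfolding Vc(2) using Vc(1)
    by (simp add: assoc_mult_mat[of _ k k _ k _ k] mult_carrier_mat[of _ k k _ k]
        left_mult_one_mat[of _ k k] del: mat_diag_diag)
  finally show ?thesis by (simp add: fc_def)
qed

lemma fc_cong: "(\<And>i. i < k \<Longrightarrow> f i = g i) \<Longrightarrow> fc k V f = fc k V g"
proof -
  assume "\<And>i. i < k \<Longrightarrow> f i = g i"
  then have "mat_diag k f = mat_diag k g" by (auto simp: mat_diag_def)
  then show ?thesis by (simp add: fc_def)
qed

lemma fc_one: "fc k V (\<lambda>_. 1) = 1\<^sub>m k"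
  using orth_matD[OF V] by (simp add: fc_def)

lemma fc_add: "fc k V f + fc k V g = fc k V (\<lambda>i. f i + g i)"
proof -
  note Vc = orth_matD[OF V]
  have "mat_diag k (\<lambda>i. f i + g i) = mat_diag k f + mat_diag k g"
    by (rule eq_matI) (auto simp: mat_diag_def)
  then show ?thesis using Vc(1) unfolding fc_def
    by (simp add: mult_add_distrib_mat[of _ k k _ k] add_mult_distrib_mat[of _ k k _ _ k] mult_carrier_mat[of _ k k _ k])
qed

lemma fc_smult: "fc k V (\<lambda>i. a * f i) = a \<cdot>\<^sub>m fc k V f"
proof -
  note Vc = orth_matD[OF V]
  have "mat_diag k (\<lambda>i. a * f i) = a \<cdot>\<^sub>m mat_diag k f"
    by (rule eq_matI) (auto simp: mat_diag_def)
  then show ?thesis using Vc(1) unfolding fc_def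
    by (simp add: mult_smult_distrib[of _ k k _ k] mult_smult_assoc_mat[of _ k k _ k] mult_carrier_mat[of _ k k _ k])
qed

lemma fc_minus: "fc k V f - fc k V g = fc k V (\<lambda>i. f i - g i)"
proof -
  have "fc k V (\<lambda>i. f i - g i) = fc k V (\<lambda>i. f i + (- 1) * g i)" by simp
  also have "\<dots> = fc k V f + (- 1) \<cdot>\<^sub>m fc k V g" by (simp only: fc_add[symmetric] fc_smult)
  also have "\<dots> = fc k V f - fc k V g"
    by (rule eq_matI) (use fc_carrier[of f] fc_carrier[of g] in auto)
  finally show ?thesis ..
qed

lemma nsq_fc:
  assumes v: "v \<in> carrier_vec k"
  shows "nsq (fc k V f *\<^sub>v v) = (\<Sum>i<k. (f i)\<^sup>2 * ((V\<^sup>T *\<^sub>v v) $ i)\<^sup>2)"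
proof -
  note Vc = orth_matD[OF V]
  define z where "z = V\<^sup>T *\<^sub>v v"
  have z: "z \<in> carrier_vec k" using Vc v by (simp add: z_def)
  have Sz: "mat_diag k f *\<^sub>v z \<in> carrier_vec k" using z by (simp add: mat_diag_mult_vec)
  have "fc k V f *\<^sub>v v = V *\<^sub>v (mat_diag k f *\<^sub>v z)"
    using Vc(1) v by (simp add: fc_def z_def assoc_mult_mat_vec[of _ k k _ k] mult_carrier_mat[of _ k k _ k])
  then have "nsq (fc k V f *\<^sub>v v) = nsq (mat_diag k f *\<^sub>v z)" using nsq_orth[OF V Sz] by simp
  then show ?thesis using nsq_mat_diag[OF z] by (simp add: z_def)
qed

lemma nsq_fc_mono:
  assumes "v \<in> carrier_vec k" and "\<And>i. i < k \<Longrightarrow> \<bar>f i\<bar> \<le> \<bar>g i\<bar>"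
  shows "nsq (fc k V f *\<^sub>v v) \<le> nsq (fc k V g *\<^sub>v v)"
  unfolding nsq_fc[OF assms(1)]
  by (intro sum_mono mult_right_mono) (use assms(2) in \<open>auto simp: abs_le_square_iff\<close>)

end

section \<open>Calculus of monotone norms\<close>

context monotone_matrix_norm
begin

lemma nrm_eqI:
  assumes "B \<in> carrier_mat m c" "C \<in> carrier_mat m' c" "m \<le> N" "m' \<le> N" "c \<le> N"
    and "\<And>v. v \<in> carrier_vec c \<Longrightarrow> nsq (B *\<^sub>v v) = nsq (C *\<^sub>v v)"
  shows "nrm B = nrm C"
  using assms by (intro antisym nrm_mono[of B m c C m'] nrm_mono[of C m' c B m]) simp_all

lemma nrm_zero: "m \<le> N \<Longrightarrow> c \<le> N \<Longrightarrow> nrm (0\<^sub>m m c) = 0"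
  using nrm_smult[of "0\<^sub>m m c" m c 0] by simp

lemma nrm_nonneg:
  assumes "B \<in> carrier_mat m c" "m \<le> N" "c \<le> N"
  shows "0 \<le> nrm B"
proof -
  have "nrm (0\<^sub>m m c) \<le> nrm B"
  proof (rule nrm_mono[of _ m c _ m])
    fix v :: "real vec" assume v: "v \<in> carrier_vec c"
    have "0\<^sub>m m c *\<^sub>v v = 0\<^sub>v m" using v by (intro eq_vecI) auto
    then show "nsq (0\<^sub>m m c *\<^sub>v v) \<le> nsq (B *\<^sub>v v)" using scalar_prod_self_nonneg by simp
  qed (use assms in auto)
  then show ?thesis using nrm_zero assms by simp
qed

lemma nrm_uminus:
  assumes "B \<in> carrier_mat m c" "m \<le> N" "c \<le> N"
  shows "nrm (- B) = nrm B"
proof -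
  have "- B = (- 1) \<cdot>\<^sub>m B" by (rule eq_matI) auto
  then show ?thesis using nrm_smult[OF assms, of "- 1"] by simp
qed

lemma nrm_minus:
  assumes "B \<in> carrier_mat m c" "C \<in> carrier_mat m c" "m \<le> N" "c \<le> N"
  shows "nrm (B - C) \<le> nrm B + nrm C"
proof -
  have "B - C = B + (- C)" using assms by (intro eq_matI) auto
  then show ?thesis using nrm_add[of B m c "- C"] nrm_uminus[of C m c] assms by simp
qed

lemma nrm_isometry_left:
  assumes "G \<in> carrier_mat p m" "G\<^sup>T * G = 1\<^sub>m m" "B \<in> carrier_mat m c" "p \<le> N" "m \<le> N" "c \<le> N"
  shows "nrm (G * B) = nrm B"
proof (rule nrm_eqI[of _ p c _ m])
  fix v :: "real vec" assume v: "v \<in> carrier_vec c"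
  have "(G * B) *\<^sub>v v = G *\<^sub>v (B *\<^sub>v v)" using assms v by (simp add: assoc_mult_mat_vec[of G p m])
  then show "nsq ((G * B) *\<^sub>v v) = nsq (B *\<^sub>v v)"
    using nsq_isometry[OF assms(1,2), of "B *\<^sub>v v"] assms v by simp
qed (use assms in auto)

lemma nrm_isometry_right:
  assumes "G \<in> carrier_mat p c" "G\<^sup>T * G = 1\<^sub>m c" "B \<in> carrier_mat m c" "p \<le> N" "m \<le> N" "c \<le> N"
  shows "nrm (B * G\<^sup>T) = nrm B"
proof -
  have "nrm (B * G\<^sup>T) = nrm ((B * G\<^sup>T)\<^sup>T)"
    using nrm_transpose[of "B * G\<^sup>T" m p] assms by simp
  also have "(B * G\<^sup>T)\<^sup>T = G * B\<^sup>T"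
    using assms by (simp add: transpose_mult[of B m c _ p])
  also have "nrm \<dots> = nrm (B\<^sup>T)"
    by (rule nrm_isometry_left[OF assms(1,2), of _ m]) (use assms in auto)
  finally show ?thesis using nrm_transpose[OF assms(3)] assms by simp
qed

lemma nrm_orth_left:
  assumes "orth_mat m U" "B \<in> carrier_mat m c" "m \<le> N" "c \<le> N"
  shows "nrm (U * B) = nrm B"
  using nrm_isometry_left[of U m m B c] assms orth_matD[OF assms(1)] by simp

lemma nrm_orth_right:
  assumes "orth_mat c U" "B \<in> carrier_mat m c" "m \<le> N" "c \<le> N"
  shows "nrm (B * U) = nrm B"
  using nrm_isometry_right[of "U\<^sup>T" c c B m] assms orth_matD[OF assms(1)] by simp

text \<open>The symmetry of the sines. The squared lengths on the two sides complement those of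
  \<open>M = G\<^sup>T * H\<close> and of its transpose. From the singular value decomposition of
  \<open>M\<close>, the factor \<open>W = V * U\<^sup>T\<close> makes \<open>M * W\<close> and
  \<open>M\<^sup>T\<close> equally long on every vector, so that the two sides agree up to an
  orthogonal factor on the right.\<close>

lemma nrm_projection_complement_swap:
  assumes G: "G \<in> carrier_mat p q" "G\<^sup>T * G = 1\<^sub>m q"
    and H: "H \<in> carrier_mat p q" "H\<^sup>T * H = 1\<^sub>m q" and N: "p \<le> N" "q \<le> N"
  shows "nrm ((1\<^sub>m p - H * H\<^sup>T) * G) = nrm ((1\<^sub>m p - G * G\<^sup>T) * H)"
proof -
  define M where "M = G\<^sup>T * H"
  have M: "M \<in> carrier_mat q q" using G H by (simp add: M_def)
  have MT: "M\<^sup>T = H\<^sup>T * G"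
    using G H by (simp add: M_def transpose_mult[of _ q p _ q])
  obtain U V where U: "orth_mat q U" and V: "orth_mat q V"
    and eq: "M = U * mat_diag q (sv M) * V\<^sup>T"
    using square_svd[OF M] by blast
  note Uc = orth_matD[OF U] and Vc = orth_matD[OF V]
  define W where "W = V * U\<^sup>T"
  have W: "orth_mat q W" unfolding W_def by (intro orth_mat_mult V orth_mat_transpose U)
  note Wc = orth_matD[OF W]
  have c: "((1\<^sub>m p - G * G\<^sup>T) * H) \<in> carrier_mat p q" "((1\<^sub>m p - H * H\<^sup>T) * G) \<in> carrier_mat p q"
    using G H by (auto intro!: mult_carrier_mat minus_carrier_mat)
  have nsq1: "nsq (((1\<^sub>m p - A * A\<^sup>T) * B) *\<^sub>v v) = nsq v - nsq ((A\<^sup>T * B) *\<^sub>v v)"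
    if "A \<in> carrier_mat p q" "A\<^sup>T * A = 1\<^sub>m q"
      "B \<in> carrier_mat p q" "B\<^sup>T * B = 1\<^sub>m q" "v \<in> carrier_vec q" for A B v
  proof -
    have "1\<^sub>m p - A * A\<^sup>T \<in> carrier_mat p p" using that by (auto intro!: minus_carrier_mat)
    then have "((1\<^sub>m p - A * A\<^sup>T) * B) *\<^sub>v v = (1\<^sub>m p - A * A\<^sup>T) *\<^sub>v (B *\<^sub>v v)"
      using that by (simp add: assoc_mult_mat_vec[of _ p p _ q])
    then show ?thesis
      using nsq_projection_complement[OF that(1,2), of "B *\<^sub>v v"] nsq_isometry[OF that(3,4,5)] that
      by (simp add: assoc_mult_mat_vec[of _ q p _ q])
  qed
  have "nrm ((1\<^sub>m p - H * H\<^sup>T) * G) = nrm (((1\<^sub>m p - G * G\<^sup>T) * H) * W)"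
  proof (rule nrm_eqI[of _ p q _ p])
    fix v :: "real vec" assume v: "v \<in> carrier_vec q"
    have Wv: "W *\<^sub>v v \<in> carrier_vec q" using Wc v by simp
    define z where "z = U\<^sup>T *\<^sub>v v"
    have z: "z \<in> carrier_vec q" using Uc v by (simp add: z_def)
    have Sz: "mat_diag q (sv M) *\<^sub>v z \<in> carrier_vec q" using z by (simp add: mat_diag_mult_vec)
    have diagT: "(mat_diag q (sv M))\<^sup>T = mat_diag q (sv M)"
      by (rule eq_matI) (auto simp: mat_diag_def)
    have "M\<^sup>T = V * mat_diag q (sv M) * U\<^sup>T"
      by (subst eq) (use Uc(1) Vc(1) diagT in \<open>simp add: transpose_mult[of _ q q _ q]
        mult_carrier_mat[of _ q q _ q] assoc_mult_mat[of _ q q _ q _ q]\<close>)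
    then have "M\<^sup>T *\<^sub>v v = V *\<^sub>v (mat_diag q (sv M) *\<^sub>v z)"
      using Uc(1) Vc(1) v by (simp add: z_def assoc_mult_mat_vec[of _ q q _ q] mult_carrier_mat[of _ q q _ q])
    then have 1: "nsq (M\<^sup>T *\<^sub>v v) = nsq (mat_diag q (sv M) *\<^sub>v z)"
      using nsq_orth[OF V Sz] by simp
    have "M * W = U * mat_diag q (sv M) * ((V\<^sup>T * V) * U\<^sup>T)"
      by (subst eq) (use Uc(1) Vc(1) in \<open>simp add: W_def mult_carrier_mat[of _ q q _ q] assoc_mult_mat[of _ q q _ q _ q]\<close>)
    then have "M * W = U * mat_diag q (sv M) * U\<^sup>T"
      using Uc Vc by simp
    moreover have "(M * W) *\<^sub>v v = M *\<^sub>v (W *\<^sub>v v)"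
      using assoc_mult_mat_vec[OF M Wc(1) v] .
    ultimately have "M *\<^sub>v (W *\<^sub>v v) = (U * mat_diag q (sv M) * U\<^sup>T) *\<^sub>v v" by simp
    then have "M *\<^sub>v (W *\<^sub>v v) = U *\<^sub>v (mat_diag q (sv M) *\<^sub>v z)"
      using Uc(1) v by (simp add: assoc_mult_mat_vec[of _ q q _ q] z_def mult_carrier_mat[of _ q q _ q])
    then have 2: "nsq (M *\<^sub>v (W *\<^sub>v v)) = nsq (mat_diag q (sv M) *\<^sub>v z)"
      using nsq_orth[OF U Sz] by simp
    have "nsq ((((1\<^sub>m p - G * G\<^sup>T) * H) * W) *\<^sub>v v) = nsq (((1\<^sub>m p - G * G\<^sup>T) * H) *\<^sub>v (W *\<^sub>v v))"
      using c(1) Wc(1) v by (simp add: assoc_mult_mat_vec[of _ p q _ q])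
    then show "nsq (((1\<^sub>m p - H * H\<^sup>T) * G) *\<^sub>v v) = nsq ((((1\<^sub>m p - G * G\<^sup>T) * H) * W) *\<^sub>v v)"
      using nsq1[OF G H Wv] nsq1[OF H G v] nsq_orth[OF W v] 1 2
      unfolding MT[symmetric] M_def[symmetric] by simp
  qed (use c N Wc in auto)
  also have "\<dots> = nrm ((1\<^sub>m p - G * G\<^sup>T) * H)"
    by (rule nrm_orth_right[OF W c(1) N])
  finally show ?thesis .
qed

lemma nrm_fc_left:
  assumes V: "orth_mat k V" and B: "B \<in> carrier_mat k c" and N: "k \<le> N" "c \<le> N"
    and le: "\<And>i. i < k \<Longrightarrow> \<bar>f i\<bar> \<le> \<bar>g i\<bar>"
  shows "nrm (fc k V f * B) \<le> nrm (fc k V g * B)"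
proof (rule nrm_mono[of _ k c _ k])
  fix v :: "real vec" assume v: "v \<in> carrier_vec c"
  have e: "(fc k V h * B) *\<^sub>v v = fc k V h *\<^sub>v (B *\<^sub>v v)" for h
    using fc_carrier[OF V, of h] B v by (simp add: assoc_mult_mat_vec[of _ k k _ c])
  show "nsq ((fc k V f * B) *\<^sub>v v) \<le> nsq ((fc k V g * B) *\<^sub>v v)"
    unfolding e by (rule nsq_fc_mono[OF V _ le]) (use B v in auto)
qed (use B N fc_carrier[OF V, of f] fc_carrier[OF V, of g] in auto)

lemma nrm_fc_right:
  assumes V: "orth_mat k V" and B: "B \<in> carrier_mat m k" and N: "k \<le> N" "m \<le> N"
    and le: "\<And>i. i < k \<Longrightarrow> \<bar>f i\<bar> \<le> \<bar>g i\<bar>"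
  shows "nrm (B * fc k V f) \<le> nrm (B * fc k V g)"
proof -
  have "nrm (B * fc k V h) = nrm (fc k V h * B\<^sup>T)" for h
    using nrm_transpose[of "B * fc k V h" m k] B N fc_carrier[OF V, of h] fc_transpose[OF V, of h]
    by (simp add: transpose_mult[of B m k _ k])
  then show ?thesis using nrm_fc_left[OF V, of "B\<^sup>T" m f g] B N le by simp
qed

text \<open>Shifting by \<open>c \<ge> \<parallel>A\<parallel>\<close> turns the Sylvester equation \<open>T A + A' T = R\<close> into
  \<open>(A' + c) T = R + T (c - A)\<close>, whose two coefficients are bounded on the relevant ranges.\<close>

lemma sylvester_bound:
  assumes V: "orth_mat k V" and V': "orth_mat k V'" and T: "T \<in> carrier_mat k k" and N: "k \<le> N"
    and T1: "fc k V' p' * T = T" and T2: "T * fc k V p = T"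
    and p: "\<And>i. i < k \<Longrightarrow> p i = 0 \<or> p i = 1 \<and> s \<le> a i" and p': "\<And>i. i < k \<Longrightarrow> p' i = 0 \<or> p' i = 1 \<and> s' \<le> a' i"
    and s: "0 \<le> s" "0 \<le> s'"
  shows "(s + s') * nrm T \<le> nrm (T * fc k V a + fc k V' a' * T)"
proof -
  \<comment> \<open>A crude bound that is at least \<open>s\<close> and at least every
    \<open>a i\<close>; it cancels at the end.\<close>
  define c where "c = s + (\<Sum>i<k. \<bar>a i\<bar>)"
  have c: "a i \<le> c" if "i < k" for i
  proof -
    have "\<bar>a i\<bar> \<le> (\<Sum>i<k. \<bar>a i\<bar>)" by (rule member_le_sum) (use that in auto)
    then show ?thesis using s by (simp add: c_def)
  qed
  have cs: "s \<le> c" by (simp add: c_def sum_nonneg)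
  note fcV = fc_carrier[OF V] and fcV' = fc_carrier[OF V']
  let ?R = "T * fc k V a + fc k V' a' * T"
  have R: "?R \<in> carrier_mat k k" using T fcV fcV' by (simp add: mult_carrier_mat[of _ k k _ k])
  have TC: "T * fc k V f \<in> carrier_mat k k" "fc k V' f * T \<in> carrier_mat k k" for f
    using T fcV fcV' by (simp_all add: mult_carrier_mat[of _ k k _ k])
  have const: "fc k V (\<lambda>_. x) = x \<cdot>\<^sub>m 1\<^sub>m k" "fc k V' (\<lambda>_. x) = x \<cdot>\<^sub>m 1\<^sub>m k" for x
    using fc_smult[OF V, of x "\<lambda>_. 1"] fc_one[OF V] fc_smult[OF V', of x "\<lambda>_. 1"] fc_one[OF V'] by auto
  have alg: "X + Z = (Y + X) + (Z - Y)"
    if "X \<in> carrier_mat k k" "Y \<in> carrier_mat k k" "Z \<in> carrier_mat k k" for X Y Z :: "real mat"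
    by (rule eq_matI) (use that in auto)
  have "fc k V' (\<lambda>i. a' i + c) * T = fc k V' a' * T + c \<cdot>\<^sub>m T"
    unfolding fc_add[OF V', symmetric] const using T fcV'[of a']
    by (simp add: add_mult_distrib_mat[of _ k k _ _ k] mult_smult_assoc_mat[of _ k k _ k])
  moreover have "T * fc k V (\<lambda>i. c - a i) = c \<cdot>\<^sub>m T - T * fc k V a"
    unfolding fc_minus[OF V, symmetric] const using T fcV[of a]
    by (simp add: mult_minus_distrib_mat[of _ k k _ k] mult_smult_distrib[of _ k k _ k])
  ultimately have split: "fc k V' (\<lambda>i. a' i + c) * T = ?R + T * fc k V (\<lambda>i. c - a i)"
    using alg[OF TC(2)[of a'] TC(1)[of a], of "c \<cdot>\<^sub>m T"] T by (simp only: smult_carrier_mat)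
  have "(s' + c) * nrm T = nrm ((s' + c) \<cdot>\<^sub>m T)"
    using nrm_smult[OF T N N, of "s' + c"] s cs by simp
  \<comment> \<open>Inserting the projection that fixes \<open>T\<close> on the left restricts the
    lower bound to indices with \<open>p' i = 1\<close>, where \<open>s' \<le> a' i\<close>.\<close>
  also have "(s' + c) \<cdot>\<^sub>m T = fc k V' (\<lambda>i. (s' + c) * p' i) * T"
    unfolding fc_smult[OF V'] using T fcV'[of p'] T1 by (simp add: mult_smult_assoc_mat[of _ k k _ k])
  also have "nrm \<dots> \<le> nrm (fc k V' (\<lambda>i. a' i + c) * T)"
    by (rule nrm_fc_left[OF V' T N N]) (use p' s cs in fastforce)
  also have "\<dots> \<le> nrm ?R + nrm (T * fc k V (\<lambda>i. c - a i))"
    unfolding split by (rule nrm_add[OF R TC(1) N N])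
  \<comment> \<open>The projection on the right discards every index at which \<open>a i\<close> may
    fall below \<open>s\<close>, so \<open>c - a i\<close> stays between \<open>0\<close> and
    \<open>c - s\<close>.\<close>
  also have "T * fc k V (\<lambda>i. c - a i) = T * fc k V (\<lambda>i. p i * (c - a i))"
  proof -
    have "T * fc k V (\<lambda>i. c - a i) = (T * fc k V p) * fc k V (\<lambda>i. c - a i)" by (simp only: T2)
    also have "\<dots> = T * (fc k V p * fc k V (\<lambda>i. c - a i))" by (rule assoc_mult_mat[OF T fcV fcV])
    finally show ?thesis by (simp only: fc_mult[OF V])
  qed
  also have "nrm (T * fc k V (\<lambda>i. p i * (c - a i))) \<le> nrm (T * fc k V (\<lambda>_. c - s))"
    by (rule nrm_fc_right[OF V T N N]) (use p c cs in fastforce)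
  also have "T * fc k V (\<lambda>_. c - s) = (c - s) \<cdot>\<^sub>m T"
    unfolding const using T by (simp add: mult_smult_distrib[of _ k k _ k])
  also have "nrm \<dots> = (c - s) * nrm T" using nrm_smult[OF T N N, of "c - s"] cs by simp
  finally show ?thesis by (simp add: algebra_simps)
qed

end

section \<open>Perturbation of the range of a semidefinite matrix\<close>

text \<open>Translates between a block of consecutive columns of an eigenbasis and a spectral
  projection. The offset \<open>b\<close> is \<open>0\<close> for ranges and \<open>r\<close> for
  kernels.\<close>

lemma column_block:
  assumes V: "orth_mat k V" and bq: "b + q \<le> k"
    and G: "G \<in> carrier_mat k q" "\<And>i j. i < k \<Longrightarrow> j < q \<Longrightarrow> G $$ (i,j) = V $$ (i, b + j)"
  shows "G\<^sup>T * G = 1\<^sub>m q"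
    and "G * G\<^sup>T = fc k V (\<lambda>i. if b \<le> i \<and> i < b + q then 1 else 0)"
proof -
  note Vc = orth_matD[OF V]
  show "G\<^sup>T * G = 1\<^sub>m q"
  proof (rule eq_matI)
    fix i j assume "i < dim_row (1\<^sub>m q :: real mat)" "j < dim_col (1\<^sub>m q :: real mat)"
    then have ij: "i < q" "j < q" by auto
    have "(G\<^sup>T * G) $$ (i,j) = (\<Sum>p<k. V $$ (p, b + i) * V $$ (p, b + j))"
      using ij G by (simp add: scalar_prod_def lessThan_atLeast0)
    also have "\<dots> = (if b + i = b + j then 1 else 0)"
      using V ij bq unfolding orth_mat_entries by auto
    finally show "(G\<^sup>T * G) $$ (i,j) = 1\<^sub>m q $$ (i,j)" using ij by simp
  qed (use G in auto)
  let ?f = "\<lambda>i. if b \<le> i \<and> i < b + q then 1 else 0 :: real"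
  show "G * G\<^sup>T = fc k V ?f"
  proof (rule eq_matI)
    fix i j assume "i < dim_row (fc k V ?f)" "j < dim_col (fc k V ?f)"
    then have ij: "i < k" "j < k" using fc_carrier[OF V, of ?f] by auto
    have "fc k V ?f $$ (i,j) = (\<Sum>l = 0..<k. V $$ (i,l) * ?f l * V $$ (j,l))"
      using ij Vc(1) by (simp add: fc_def mat_diag_mult_right[OF Vc(1)] scalar_prod_def)
    also have "\<dots> = (\<Sum>l\<in>{b..<b + q}. V $$ (i,l) * V $$ (j,l))"
      by (rule sum.mono_neutral_cong_right) (use bq in auto)
    also have "\<dots> = (\<Sum>l = 0..<q. V $$ (i, b + l) * V $$ (j, b + l))"
      using sum.shift_bounds_nat_ivl[of "\<lambda>l. V $$ (i,l) * V $$ (j,l)" 0 b q] by (simp add: add.commute)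
    also have "\<dots> = (G * G\<^sup>T) $$ (i,j)"
      using ij G by (simp add: scalar_prod_def)
    finally show "(G * G\<^sup>T) $$ (i,j) = fc k V ?f $$ (i,j)" ..
  qed (use G fc_carrier[OF V, of ?f] in auto)
qed

lemma fc_zero:
  assumes V: "orth_mat k V" and f: "\<And>i. i < k \<Longrightarrow> f i = 0"
  shows "fc k V f = 0\<^sub>m k k"
proof -
  have "fc k V f = fc k V (\<lambda>i. 0 * f i)" by (rule fc_cong[OF V]) (simp add: f)
  also have "\<dots> = 0 \<cdot>\<^sub>m fc k V f" by (rule fc_smult[OF V])
  also have "\<dots> = 0\<^sub>m k k" by (rule eq_matI) (use fc_carrier[OF V, of f] in auto)
  finally show ?thesis .
qed

lemma nsq_le_spectral_norm:
  assumes B: "B \<in> carrier_mat m c" and v: "v \<in> carrier_vec c"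
  shows "nsq (B *\<^sub>v v) \<le> (spectral_norm B)\<^sup>2 * nsq v"
proof -
  obtain V where V: "orth_mat c V"
    and d: "(B * V)\<^sup>T * (B * V) = mat_diag c (\<lambda>i. (sv B i)\<^sup>2)"
    using exists_sv_basis[OF B] by blast
  note Vc = orth_matD[OF V]
  define z where "z = V\<^sup>T *\<^sub>v v"
  have z: "z \<in> carrier_vec c" using Vc v by (simp add: z_def)
  have "(V * V\<^sup>T) *\<^sub>v v = V *\<^sub>v z"
    using Vc(1) v by (simp add: z_def assoc_mult_mat_vec[of _ c c _ c])
  then have Vz: "V *\<^sub>v z = v" using Vc v by simp
  have "nsq (B *\<^sub>v v) = (\<Sum>i<c. (sv B i)\<^sup>2 * (z $ i)\<^sup>2)"
    using nsq_sv_basis[OF B V d z] Vz by simp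
  also have "\<dots> \<le> (\<Sum>i<c. (sv B 0)\<^sup>2 * (z $ i)\<^sup>2)"
    by (intro sum_mono mult_right_mono power_mono) (use sv_nonneg[OF B] sv_antimono[OF B] in auto)
  also have "\<dots> = (sv B 0)\<^sup>2 * nsq v"
    using nsq_orth[OF V z] nsq_sum[OF z] Vz by (simp add: sum_distrib_left)
  finally show ?thesis by (simp add: spectral_norm_eq[OF B])
qed

lemma spectral_norm_le:
  assumes B: "B \<in> carrier_mat m c" and d: "0 \<le> d"
    and le: "\<And>v. v \<in> carrier_vec c \<Longrightarrow> nsq (B *\<^sub>v v) \<le> d\<^sup>2 * nsq v"
  shows "spectral_norm B \<le> d"
proof -
  have "sv B 0 \<le> sv (d \<cdot>\<^sub>m 1\<^sub>m c) 0"
  proof (rule sv_mono[OF B])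
    fix v :: "real vec" assume v: "v \<in> carrier_vec c"
    have "(d \<cdot>\<^sub>m 1\<^sub>m c) *\<^sub>v v = d \<cdot>\<^sub>v v"
      using v by (intro eq_vecI) auto
    then show "nsq (B *\<^sub>v v) \<le> nsq ((d \<cdot>\<^sub>m 1\<^sub>m c) *\<^sub>v v)" using le[OF v] by (simp only: nsq_smult)
  qed auto
  also have "\<dots> = d * sv (1\<^sub>m c) 0" using sv_smult[of "1\<^sub>m c" c c d 0] d by simp
  also have "\<dots> \<le> d" using sv_one[of 0 c] sv_beyond[of "1\<^sub>m c" 0] d by (cases "c = 0") auto
  finally show ?thesis by (simp add: spectral_norm_eq[OF B])
qed

lemma spectral_norm_nonneg: "0 \<le> spectral_norm B"
  using spectral_norm_eq[of B "dim_row B" "dim_col B"] sv_nonneg[of B "dim_row B" "dim_col B" 0] by simp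

lemma spectral_norm_transpose:
  "B \<in> carrier_mat m c \<Longrightarrow> spectral_norm (B\<^sup>T) = spectral_norm B"
  using spectral_norm_eq[of B m c] spectral_norm_eq[of "B\<^sup>T" c m] sv_transpose[of B m c 0] by simp

text \<open>Monotonicity compares lengths of images and thus controls a factor on the left;
  transposing puts \<open>D\<close> there.\<close>

lemma (in monotone_matrix_norm) nrm_mult_spectral_norm:
  assumes B: "B \<in> carrier_mat n c" and D: "D \<in> carrier_mat n k" and N: "n \<le> N" "k \<le> N" "c \<le> N"
  shows "nrm (B\<^sup>T * D) \<le> spectral_norm D * nrm B"
proof -
  have "nrm (B\<^sup>T * D) = nrm ((B\<^sup>T * D)\<^sup>T)"
    using nrm_transpose[of "B\<^sup>T * D" c k] B D N by simp
  also have "(B\<^sup>T * D)\<^sup>T = D\<^sup>T * B"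
    using B D by (simp add: transpose_mult[of _ c n _ k])
  also have "nrm \<dots> \<le> nrm (spectral_norm D \<cdot>\<^sub>m B)"
  proof (rule nrm_mono[of _ k c _ n])
    fix v :: "real vec" assume v: "v \<in> carrier_vec c"
    have Bv: "B *\<^sub>v v \<in> carrier_vec n" using B v by simp
    have "(D\<^sup>T * B) *\<^sub>v v = D\<^sup>T *\<^sub>v (B *\<^sub>v v)"
      using B D v by (simp add: assoc_mult_mat_vec[of _ k n _ c])
    then have "nsq ((D\<^sup>T * B) *\<^sub>v v) \<le> (spectral_norm D)\<^sup>2 * nsq (B *\<^sub>v v)"
      using nsq_le_spectral_norm[of "D\<^sup>T" k n "B *\<^sub>v v"] spectral_norm_transpose[OF D] D Bv by simp
    also have "\<dots> = nsq (spectral_norm D \<cdot>\<^sub>v (B *\<^sub>v v))" by (simp only: nsq_smult)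
    also have "spectral_norm D \<cdot>\<^sub>v (B *\<^sub>v v) = (spectral_norm D \<cdot>\<^sub>m B) *\<^sub>v v"
      using B v by (intro eq_vecI) auto
    finally show "nsq ((D\<^sup>T * B) *\<^sub>v v) \<le> nsq ((spectral_norm D \<cdot>\<^sub>m B) *\<^sub>v v)" .
  qed (use B D N in auto)
  also have "\<dots> = spectral_norm D * nrm B"
    using nrm_smult[OF B N(1,3)] spectral_norm_nonneg[of D] by simp
  finally show ?thesis .
qed

lemma nsq_fc_split:
  assumes Y: "orth_mat k Y" and v: "v \<in> carrier_vec k"
  shows "nsq v = nsq (fc k Y (\<lambda>i. if i < r then 1 else 0) *\<^sub>v v)
    + nsq (fc k Y (\<lambda>i. if i < r then 0 else 1) *\<^sub>v v)"
proof -
  have "nsq v = nsq (fc k Y (\<lambda>_. 1) *\<^sub>v v)" using v by (simp add: fc_one[OF Y])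
  also have "\<dots> = nsq (fc k Y (\<lambda>i. if i < r then 1 else 0) *\<^sub>v v)
    + nsq (fc k Y (\<lambda>i. if i < r then 0 else 1) *\<^sub>v v)"
    unfolding nsq_fc[OF Y v] sum.distrib[symmetric] by (intro sum.cong) simp_all
  finally show ?thesis .
qed

text \<open>In the application \<open>A = X\<^sup>T D\<close>, \<open>A' = X'\<^sup>T D\<close>, \<open>U\<close> is the transposed polar factor of
  \<open>X\<^sup>T X'\<close>, and \<open>s\<close>, \<open>s'\<close> are the smallest nonzero eigenvalues. \<open>P\<close>, \<open>P'\<close> project onto the ranges,
  \<open>Pc\<close>, \<open>Pc'\<close> onto the kernels.\<close>

locale aligned_psd_pair =
  fixes k r :: nat and V V' U :: "real mat" and a a' :: "nat \<Rightarrow> real" and s s' :: real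
  assumes V: "orth_mat k V" and V': "orth_mat k V'" and U: "orth_mat k U" and r: "r \<le> k"
    and a: "\<And>i. i < r \<Longrightarrow> s \<le> a i" "\<And>i. r \<le> i \<Longrightarrow> i < k \<Longrightarrow> a i = 0"
    and a': "\<And>i. i < r \<Longrightarrow> s' \<le> a' i" "\<And>i. r \<le> i \<Longrightarrow> i < k \<Longrightarrow> a' i = 0"
    and s: "0 < s" "0 < s'"
begin

definition "A = fc k V a"
definition "A' = fc k V' a'"
definition "P = fc k V (\<lambda>i. if i < r then 1 else 0)"
definition "P' = fc k V' (\<lambda>i. if i < r then 1 else 0)"
definition "Pc = fc k V (\<lambda>i. if i < r then 0 else 1)"
definition "Pc' = fc k V' (\<lambda>i. if i < r then 0 else 1)"
definition "E = U * A - A'"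
text \<open>This is \<open>E\<^sup>T * U\<close> in expanded form, which makes its products with the
  kernel projections as direct as those of \<open>E\<close>.\<close>

definition "E2 = A - A' * U"
definition "T = P' * (U * P) - P' * P"

lemmas fc_defs = A_def A'_def P_def P'_def Pc_def Pc'_def

lemma carriers: "A \<in> carrier_mat k k" "A' \<in> carrier_mat k k" "P \<in> carrier_mat k k" "P' \<in> carrier_mat k k"
  "Pc \<in> carrier_mat k k" "Pc' \<in> carrier_mat k k" "U \<in> carrier_mat k k" "E \<in> carrier_mat k k"
  "E2 \<in> carrier_mat k k" "T \<in> carrier_mat k k"
  using fc_carrier[OF V] fc_carrier[OF V'] orth_matD(1)[OF U]
  by (simp_all add: fc_defs E_def E2_def T_def mult_carrier_mat[of _ k k _ k] minus_carrier_mat[of _ k k])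

lemmas square_simps = mult_carrier_mat[of _ k k _ k] minus_carrier_mat[of _ k k] carriers
  minus_mult_distrib_mat[of _ k k _ _ k] mult_minus_distrib_mat[of _ k k _ k] assoc_mult_mat[of _ k k _ k _ k]

lemma transposes: "A\<^sup>T = A" "A'\<^sup>T = A'" "P\<^sup>T = P" "P'\<^sup>T = P'"
  "Pc\<^sup>T = Pc" "Pc'\<^sup>T = Pc'"
  using fc_transpose[OF V] fc_transpose[OF V'] by (simp_all add: fc_defs)

lemma products: "P * A = A" "A * P = A" "P * P = P" "A' * P' = A'" "P' * A' = A'" "P' * P' = P'"
    "Pc * Pc = Pc" "Pc' * Pc' = Pc'"
  unfolding fc_defs fc_mult[OF V] fc_mult[OF V']
  by (auto intro!: fc_cong[OF V] fc_cong[OF V'] simp: a a')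

lemma zero_products: "A * Pc = 0\<^sub>m k k" "Pc' * A' = 0\<^sub>m k k" "Pc' * P' = 0\<^sub>m k k" "P * Pc = 0\<^sub>m k k"
proof -
  show "A * Pc = 0\<^sub>m k k" "P * Pc = 0\<^sub>m k k" unfolding fc_defs fc_mult[OF V] by (rule fc_zero[OF V], simp add: a)+
  show "Pc' * A' = 0\<^sub>m k k" "Pc' * P' = 0\<^sub>m k k" unfolding fc_defs fc_mult[OF V'] by (rule fc_zero[OF V'], simp add: a')+
qed

lemma complement: "Pc = 1\<^sub>m k - P" "Pc' = 1\<^sub>m k - P'"
proof -
  have "fc k V (\<lambda>_. 1) - P = Pc" unfolding fc_defs fc_minus[OF V] by (rule fc_cong[OF V]) simp
  then show "Pc = 1\<^sub>m k - P" by (simp add: fc_one[OF V])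
  have "fc k V' (\<lambda>_. 1) - P' = Pc'" unfolding fc_defs fc_minus[OF V'] by (rule fc_cong[OF V']) simp
  then show "Pc' = 1\<^sub>m k - P'" by (simp add: fc_one[OF V'])
qed

lemma E2_eq: "E2 = E\<^sup>T * U"
proof -
  note Uc = orth_matD[OF U]
  have "E\<^sup>T * U = A * (U\<^sup>T * U) - A' * U"
    by (simp add: E_def square_simps transpose_minus[of _ k k] transpose_mult[of _ k k _ k] transposes)
  then show ?thesis by (simp add: E2_def Uc(2) carriers right_mult_one_mat[of _ k k])
qed

text \<open>\<open>square_simps\<close> associates products to the right, where adjacent factors
  meet only in front of a tail \<open>X\<close>; these rules act on that normal form.\<close>

lemma left_products:
  assumes "X \<in> carrier_mat k k"
  shows "P' * (P' * X) = P' * X" "P' * (A' * X) = A' * X" "A' * (P' * X) = A' * X"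
    "Pc' * (P' * X) = 0\<^sub>m k k" "Pc' * (A' * X) = 0\<^sub>m k k"
  using assms products zero_products carriers left_mult_zero_mat[OF assms, of k]
  by (simp_all flip: assoc_mult_mat[of _ k k _ k X k])

lemma zero_minus: "X \<in> carrier_mat k k \<Longrightarrow> 0\<^sub>m k k - X = - X" "X \<in> carrier_mat k k \<Longrightarrow> X - 0\<^sub>m k k = X"
  for X :: "real mat"
  by auto

text \<open>Here and in the next three facts a kernel projection annihilates one of the two terms of
  the error, leaving an off-diagonal block multiplied by \<open>A\<close> or
  \<open>A'\<close>.\<close>

lemma E_Pc: "E * Pc = - (A' * Pc)"
  by (simp add: E_def square_simps zero_products zero_minus right_mult_zero_mat[of _ k k])

lemma Pc'_E: "Pc' * E = Pc' * (U * A)"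
  by (simp add: E_def square_simps zero_products zero_minus)

lemma E2_Pc: "E2 * Pc = - (A' * (U * Pc))"
  by (simp add: E2_def square_simps zero_products zero_minus)

lemma Pc'_E2: "Pc' * E2 = Pc' * A"
  by (simp add: E2_def square_simps left_products zero_minus)

lemma P'_T: "P' * T = T" and T_P: "T * P = T"
  by (simp_all add: T_def square_simps left_products products)

text \<open>\<open>A\<close> and \<open>A'\<close> absorb their own range projections, so the left
  side reduces to the terms \<open>P' * (U * A)\<close>, \<open>A' * P\<close>,
  \<open>P' * A\<close> and \<open>A' * (U * P)\<close>. The first two make up the part with
  \<open>E\<close>, the last two the part with \<open>E2\<close>.\<close>

lemma T_sylvester: "T * A + A' * T = P' * (E * P) - P' * (E2 * P)"
proof -
  have alg: "(w - x) + (y - z) = (w - z) - (x - y)"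
    if "w \<in> carrier_mat k k" "x \<in> carrier_mat k k" "y \<in> carrier_mat k k" "z \<in> carrier_mat k k"
    for w x y z :: "real mat"
    by (rule eq_matI) (use that in auto)
  show ?thesis
    by (simp add: T_def E_def E2_def square_simps left_products products)
      (rule alg; simp add: square_simps)
qed

text \<open>\<open>U * P\<close> vanishes on the kernel of \<open>A\<close>, and \<open>P'\<close>
  maps into the range of \<open>A'\<close>; hence the block between the two kernels is zero and
  three blocks remain.\<close>

lemma UP_minus_P': "U * P - P' = T - P' * Pc + Pc' * (U * P)"
proof -
  have alg: "w - x = (y - z) - (x - z) + (w - y)"
    if "w \<in> carrier_mat k k" "x \<in> carrier_mat k k" "y \<in> carrier_mat k k" "z \<in> carrier_mat k k"
    for w x y z :: "real mat"
    by (rule eq_matI) (use that in auto)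
  have "P' * Pc = P' - P' * P" "Pc' * (U * P) = U * P - P' * (U * P)"
    unfolding complement by (simp_all add: square_simps right_mult_one_mat[of _ k k] left_mult_one_mat[of _ k k])
  then show ?thesis
    by (simp only: T_def) (rule alg; simp add: square_simps)
qed

end

locale aligned_psd_pair_norm = aligned_psd_pair + monotone_matrix_norm +
  assumes kN: "k \<le> N"
begin

lemma nrm_left_le:
  assumes "orth_mat k Y" "B \<in> carrier_mat k k" "\<And>i. i < k \<Longrightarrow> \<bar>f i\<bar> \<le> 1"
  shows "nrm (fc k Y f * B) \<le> nrm B"
  using nrm_fc_left[OF assms(1,2) kN kN, of f "\<lambda>_. 1"] assms fc_one[OF assms(1)] by simp

lemma nrm_right_le:
  assumes "orth_mat k Y" "B \<in> carrier_mat k k" "\<And>i. i < k \<Longrightarrow> \<bar>f i\<bar> \<le> 1"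
  shows "nrm (B * fc k Y f) \<le> nrm B"
  using nrm_fc_right[OF assms(1,2) kN kN, of f "\<lambda>_. 1"] assms fc_one[OF assms(1)] by simp

lemma nrm_proj_le:
  assumes "B \<in> carrier_mat k k"
  shows "nrm (P' * B) \<le> nrm B" "nrm (Pc' * B) \<le> nrm B" "nrm (B * P) \<le> nrm B" "nrm (B * Pc) \<le> nrm B"
  unfolding fc_defs by (intro nrm_left_le[OF V' assms] nrm_right_le[OF V assms]; simp)+

lemma nrm_A'_ge:
  assumes B: "B \<in> carrier_mat k k"
  shows "s' * nrm (P' * B) \<le> nrm (A' * B)"
proof -
  have "s' * nrm (P' * B) = nrm (s' \<cdot>\<^sub>m (P' * B))"
    using nrm_smult[of "P' * B" k k s'] s B kN by (simp add: square_simps)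
  also have "s' \<cdot>\<^sub>m (P' * B) = fc k V' (\<lambda>i. s' * (if i < r then 1 else 0)) * B"
    unfolding fc_smult[OF V'] using B by (simp add: mult_smult_assoc_mat[of _ k k _ k] P'_def fc_carrier[OF V'])
  also have "nrm \<dots> \<le> nrm (A' * B)"
    unfolding A'_def by (rule nrm_fc_left[OF V' B kN kN]) (use a' s in force)
  finally show ?thesis .
qed

lemma nrm_A_ge:
  assumes B: "B \<in> carrier_mat k k"
  shows "s * nrm (B * P) \<le> nrm (B * A)"
proof -
  have "s * nrm (B * P) = nrm (s \<cdot>\<^sub>m (B * P))"
    using nrm_smult[of "B * P" k k s] s B kN by (simp add: square_simps)
  also have "s \<cdot>\<^sub>m (B * P) = B * fc k V (\<lambda>i. s * (if i < r then 1 else 0))"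
    unfolding fc_smult[OF V] using B by (simp add: mult_smult_distrib[of _ k k _ k] P_def fc_carrier[OF V])
  also have "nrm \<dots> \<le> nrm (B * A)"
    unfolding A_def by (rule nrm_fc_right[OF V B kN kN]) (use a s in force)
  finally show ?thesis .
qed

lemma nrm_E2: "nrm E2 = nrm E"
  unfolding E2_eq using nrm_orth_right[OF U, of "E\<^sup>T" k] nrm_transpose[OF carriers(8)] kN carriers
  by simp

text \<open>\<open>Q * P * Q\<^sup>T\<close> and \<open>P'\<close> project onto subspaces of the
  same dimension \<open>r\<close>, so their sines can be exchanged. The isometries
  \<open>Q * G\<close> and \<open>H\<close> onto these subspaces bring the claim into the form
  required; afterwards the isometric factors are stripped and a transposition restores the order.
  Used for the identity and for \<open>U\<close>.\<close>

lemma nrm_complement_swap: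
  assumes Q: "orth_mat k Q"
  shows "nrm (Pc' * (Q * P)) = nrm (P' * (Q * Pc))"
proof -
  note Qc = orth_matD[OF Q]
  have rN: "r \<le> N" using r kN by simp
  define G where "G = mat k r (\<lambda>(i,j). V $$ (i,j))"
  define H where "H = mat k r (\<lambda>(i,j). V' $$ (i,j))"
  have G: "G \<in> carrier_mat k r" and H: "H \<in> carrier_mat k r" by (simp_all add: G_def H_def)
  have G1: "G\<^sup>T * G = 1\<^sub>m r" and GP: "G * G\<^sup>T = P"
    using column_block[OF V, of 0 r G] r by (simp_all add: G_def P_def)
  have H1: "H\<^sup>T * H = 1\<^sub>m r" and HP: "H * H\<^sup>T = P'"
    using column_block[OF V', of 0 r H] r by (simp_all add: H_def P'_def)
  have QG: "Q * G \<in> carrier_mat k r" using Qc G by simp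
  have QGT: "(Q * G)\<^sup>T = G\<^sup>T * Q\<^sup>T"
    using Qc G by (simp add: transpose_mult[of _ k k _ r])
  have "(Q * G)\<^sup>T * (Q * G) = G\<^sup>T * ((Q\<^sup>T * Q) * G)"
    unfolding QGT using Qc(1) G by (simp add: assoc_mult_mat[of _ r k _ k _ r] assoc_mult_mat[of _ k k _ k _ r])
  then have QG1: "(Q * G)\<^sup>T * (Q * G) = 1\<^sub>m r" using Qc(2) G G1 by simp
  have QGP: "(Q * G) * (Q * G)\<^sup>T = Q * (P * Q\<^sup>T)"
    unfolding QGT GP[symmetric] using Qc(1) G
    by (simp add: assoc_mult_mat[of _ k k _ r _ k] assoc_mult_mat[of _ k r _ k _ k])
  have "nrm (Pc' * (Q * P)) = nrm ((Pc' * (Q * G)) * G\<^sup>T)"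
    unfolding GP[symmetric] using Qc(1) G carriers
    by (simp add: assoc_mult_mat[of _ k k _ r _ k] assoc_mult_mat[of _ k k _ k _ k] assoc_mult_mat[of _ k k _ k _ r])
  also have "\<dots> = nrm (Pc' * (Q * G))"
    by (rule nrm_isometry_right[OF G G1]) (use QG carriers kN rN in auto)
  also have "\<dots> = nrm ((1\<^sub>m k - (Q * G) * (Q * G)\<^sup>T) * H)"
    unfolding complement HP[symmetric] by (rule nrm_projection_complement_swap[OF QG QG1 H H1 kN rN])
  also have "1\<^sub>m k - (Q * G) * (Q * G)\<^sup>T = Q * (Pc * Q\<^sup>T)"
  proof -
    have "Q * (Pc * Q\<^sup>T) = Q * Q\<^sup>T - Q * (P * Q\<^sup>T)"
      unfolding complement using Qc(1) by (simp add: square_simps left_mult_one_mat[of _ k k])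
    then show ?thesis by (simp add: QGP Qc(3))
  qed
  also have "nrm (Q * (Pc * Q\<^sup>T) * H) = nrm ((Q * (Pc * Q\<^sup>T)) * H * H\<^sup>T)"
    by (rule nrm_isometry_right[OF H H1, symmetric]) (use Qc(1) H kN rN in \<open>auto simp: square_simps intro!: mult_carrier_mat[of _ k k _ r]\<close>)
  also have "(Q * (Pc * Q\<^sup>T)) * H * H\<^sup>T = Q * (Pc * (Q\<^sup>T * P'))"
    unfolding HP[symmetric] using Qc(1) H
    by (simp add: square_simps assoc_mult_mat[of _ k k _ r _ k] assoc_mult_mat[of _ k k _ k _ r] mult_carrier_mat[of _ k k _ r])
  also have "nrm \<dots> = nrm (Pc * (Q\<^sup>T * P'))"
    by (rule nrm_orth_left[OF Q _ kN kN]) (use Qc(1) in \<open>simp add: square_simps\<close>)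
  also have "\<dots> = nrm ((Pc * (Q\<^sup>T * P'))\<^sup>T)"
    by (rule nrm_transpose[symmetric, OF _ kN kN]) (use Qc(1) in \<open>simp add: square_simps\<close>)
  also have "(Pc * (Q\<^sup>T * P'))\<^sup>T = P' * (Q * Pc)"
    using Qc(1) by (simp add: square_simps transpose_mult[of _ k k _ k] transposes)
  finally show ?thesis .
qed

lemma nrm_Pc'_P: "nrm (Pc' * P) = nrm (P' * Pc)"
  using nrm_complement_swap[OF orth_mat_one] carriers by (simp add: left_mult_one_mat[of _ k k])

text \<open>The first two bounds come from \<open>E\<close>, on whose compressions \<open>A'\<close>
  and \<open>A\<close> act invertibly from the range side; the other two reach the same blocks
  through \<open>E2\<close> and the exchange of sines, with the other eigenvalue bound. The right
  sides keep their projections because the Frobenius estimate counts them as separate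
  blocks.\<close>

lemma offdiagonal_bounds:
  "s' * nrm (P' * Pc) \<le> nrm (E * Pc)" "s * nrm (Pc' * (U * P)) \<le> nrm (Pc' * E)"
  "s * nrm (P' * Pc) \<le> nrm (Pc' * E2)" "s' * nrm (Pc' * (U * P)) \<le> nrm (E2 * Pc)"
proof -
  show "s' * nrm (P' * Pc) \<le> nrm (E * Pc)"
    using nrm_A'_ge[OF carriers(5)] nrm_uminus[of "A' * Pc" k k] kN by (simp add: E_Pc square_simps)
  show "s * nrm (Pc' * (U * P)) \<le> nrm (Pc' * E)"
    using nrm_A_ge[of "Pc' * U"] by (simp add: Pc'_E square_simps)
  show "s * nrm (P' * Pc) \<le> nrm (Pc' * E2)"
    using nrm_A_ge[OF carriers(6)] by (simp add: Pc'_E2 nrm_Pc'_P)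
  show "s' * nrm (Pc' * (U * P)) \<le> nrm (E2 * Pc)"
    using nrm_A'_ge[of "U * Pc"] nrm_uminus[of "A' * (U * Pc)" k k] kN
    by (simp add: E2_Pc square_simps nrm_complement_swap[OF U])
qed

lemma offdiagonal_bounds_max:
  "nrm (P' * Pc) \<le> nrm E / max s s'" "nrm (Pc' * (U * P)) \<le> nrm E / max s s'"
proof -
  have "s' * nrm (P' * Pc) \<le> nrm E" "s * nrm (P' * Pc) \<le> nrm E"
    "s' * nrm (Pc' * (U * P)) \<le> nrm E" "s * nrm (Pc' * (U * P)) \<le> nrm E"
    using offdiagonal_bounds nrm_proj_le(2,4)[OF carriers(8)] nrm_proj_le(2,4)[OF carriers(9)] nrm_E2
    by linarith+
  then show "nrm (P' * Pc) \<le> nrm E / max s s'" "nrm (Pc' * (U * P)) \<le> nrm E / max s s'"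
    using s by (auto simp: max_def pos_le_divide_eq mult.commute)
qed

lemma T_bound: "(s + s') * nrm T \<le> nrm (P' * (E * P)) + nrm (P' * (E2 * P))"
proof -
  have "(s + s') * nrm T \<le> nrm (T * A + A' * T)"
    unfolding A_def A'_def
  proof (rule sylvester_bound[OF V V' carriers(10) kN])
    show "fc k V' (\<lambda>i. if i < r then 1 else 0) * T = T" using P'_T by (simp add: P'_def)
    show "T * fc k V (\<lambda>i. if i < r then 1 else 0) = T" using T_P by (simp add: P_def)
  qed (use a a' s in auto)
  also have "\<dots> \<le> nrm (P' * (E * P)) + nrm (P' * (E2 * P))"
    unfolding T_sylvester by (rule nrm_minus[of _ k k]) (auto simp: square_simps kN)
  finally show ?thesis .
qed

lemma T_bound_E: "nrm T \<le> 2 * nrm E / (s + s')"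
proof -
  have le: "nrm (P' * (B * P)) \<le> nrm B" if B: "B \<in> carrier_mat k k" for B
    using nrm_proj_le(1)[of "B * P"] nrm_proj_le(3)[OF B] B by (simp add: square_simps)
  have "(s + s') * nrm T \<le> 2 * nrm E" using T_bound le[OF carriers(8)] le[OF carriers(9)] nrm_E2 by linarith
  then show ?thesis using s by (simp add: pos_le_divide_eq mult.commute)
qed

lemma UP_minus_P'_bound: "nrm (U * P - P') \<le> nrm T + nrm (P' * Pc) + nrm (Pc' * (U * P))"
proof -
  have "nrm (U * P - P') \<le> nrm (T - P' * Pc) + nrm (Pc' * (U * P))"
    unfolding UP_minus_P' by (rule nrm_add[of _ k k]) (auto simp: square_simps kN)
  moreover have "nrm (T - P' * Pc) \<le> nrm T + nrm (P' * Pc)"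
    by (rule nrm_minus[of _ k k]) (auto simp: square_simps kN)
  ultimately show ?thesis by linarith
qed

end

section \<open>Block estimates in the Frobenius and spectral norms\<close>

lemma nsq_le_frobenius_norm:
  assumes B: "B \<in> carrier_mat m c" and v: "v \<in> carrier_vec c"
  shows "nsq (B *\<^sub>v v) \<le> (frobenius_norm B)\<^sup>2 * nsq v"
proof -
  have "nsq (B *\<^sub>v v) = (\<Sum>i<m. (row B i \<bullet> v)\<^sup>2)"
    using B v nsq_sum[of "B *\<^sub>v v" m] by simp
  also have "\<dots> \<le> (\<Sum>i<m. nsq (row B i) * nsq v)"
    by (intro sum_mono cauchy_schwarz_vec[of _ c]) (use B v in auto)
  also have "\<dots> = (\<Sum>i<m. \<Sum>j<c. (B $$ (i,j))\<^sup>2) * nsq v"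
  proof -
    have "nsq (row B i) = (\<Sum>j<c. (B $$ (i,j))\<^sup>2)" if "i < m" for i
      using B that nsq_sum[of "row B i" c] by simp
    then show ?thesis by (simp add: sum_distrib_right)
  qed
  finally show ?thesis using B by (simp add: frobenius_norm_def sum_nonneg)
qed

lemma frobenius_norm_split_left:
  assumes Y: "orth_mat k Y" and B: "B \<in> carrier_mat k c"
  shows "(frobenius_norm B)\<^sup>2 = (frobenius_norm (fc k Y (\<lambda>i. if i < r then 1 else 0) * B))\<^sup>2
    + (frobenius_norm (fc k Y (\<lambda>i. if i < r then 0 else 1) * B))\<^sup>2"
proof -
  have e: "(fc k Y f * B) *\<^sub>v v = fc k Y f *\<^sub>v (B *\<^sub>v v)" if "v \<in> carrier_vec c" for f v
    using fc_carrier[OF Y, of f] B that by (simp add: assoc_mult_mat_vec[of _ k k _ c])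
  have c: "fc k Y f * B \<in> carrier_mat k c" for f using fc_carrier[OF Y, of f] B by simp
  have Bv: "B *\<^sub>v unit_vec c j \<in> carrier_vec k" for j using B by simp
  show ?thesis
    unfolding frobenius_norm_cols[OF B] frobenius_norm_cols[OF c] sum.distrib[symmetric]
    by (intro sum.cong refl, subst nsq_fc_split[OF Y Bv, of _ r]) (simp only: e unit_vec_carrier)
qed

lemma frobenius_norm_split_right:
  assumes Y: "orth_mat k Y" and B: "B \<in> carrier_mat m k"
  shows "(frobenius_norm B)\<^sup>2 = (frobenius_norm (B * fc k Y (\<lambda>i. if i < r then 1 else 0)))\<^sup>2
    + (frobenius_norm (B * fc k Y (\<lambda>i. if i < r then 0 else 1)))\<^sup>2"
proof -
  have t: "frobenius_norm (M\<^sup>T) = frobenius_norm M" if "M \<in> carrier_mat m c" for M m c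
    using monotone_matrix_norm.nrm_transpose[OF frobenius_norm_monotone_matrix_norm[of "max m c"] that] by simp
  have e: "fc k Y f * B\<^sup>T = (B * fc k Y f)\<^sup>T" for f
    using B fc_carrier[OF Y, of f] fc_transpose[OF Y, of f] by (simp add: transpose_mult[of B m k _ k])
  have c: "B * fc k Y f \<in> carrier_mat m k" for f using fc_carrier[OF Y, of f] B by simp
  show ?thesis
    using frobenius_norm_split_left[OF Y, of "B\<^sup>T" m r] B
    unfolding e t[OF c] t[OF B] by simp
qed

text \<open>The squared lengths add for each single vector, but the two parts may attain their norms
  at different vectors, which leaves an inequality.\<close>

lemma spectral_norm_split_left:
  assumes Y: "orth_mat k Y" and B: "B \<in> carrier_mat k c"
  shows "(spectral_norm B)\<^sup>2 \<le> (spectral_norm (fc k Y (\<lambda>i. if i < r then 1 else 0) * B))\<^sup>2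
    + (spectral_norm (fc k Y (\<lambda>i. if i < r then 0 else 1) * B))\<^sup>2" (is "_ \<le> ?x\<^sup>2 + ?y\<^sup>2")
proof -
  have e: "(fc k Y f * B) *\<^sub>v v = fc k Y f *\<^sub>v (B *\<^sub>v v)" if "v \<in> carrier_vec c" for f v
    using fc_carrier[OF Y, of f] B that by (simp add: assoc_mult_mat_vec[of _ k k _ c])
  have c: "fc k Y f * B \<in> carrier_mat k c" for f using fc_carrier[OF Y, of f] B by simp
  have "spectral_norm B \<le> sqrt (?x\<^sup>2 + ?y\<^sup>2)"
  proof (rule spectral_norm_le[OF B])
    fix v :: "real vec" assume v: "v \<in> carrier_vec c"
    have Bv: "B *\<^sub>v v \<in> carrier_vec k" using B v by simp
    have "nsq (B *\<^sub>v v) \<le> ?x\<^sup>2 * nsq v + ?y\<^sup>2 * nsq v"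
      unfolding nsq_fc_split[OF Y Bv, of r] e[OF v, symmetric]
      by (intro add_mono nsq_le_spectral_norm[OF c v])
    then show "nsq (B *\<^sub>v v) \<le> (sqrt (?x\<^sup>2 + ?y\<^sup>2))\<^sup>2 * nsq v" by (simp add: algebra_simps)
  qed simp
  then have "(spectral_norm B)\<^sup>2 \<le> (sqrt (?x\<^sup>2 + ?y\<^sup>2))\<^sup>2"
    by (rule power_mono) (rule spectral_norm_nonneg)
  then show ?thesis by simp
qed

lemma spectral_norm_split_right:
  assumes Y: "orth_mat k Y" and B: "B \<in> carrier_mat m k"
  shows "(spectral_norm B)\<^sup>2 \<le> (spectral_norm (B * fc k Y (\<lambda>i. if i < r then 1 else 0)))\<^sup>2
    + (spectral_norm (B * fc k Y (\<lambda>i. if i < r then 0 else 1)))\<^sup>2"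
proof -
  have e: "fc k Y f * B\<^sup>T = (B * fc k Y f)\<^sup>T" for f
    using B fc_carrier[OF Y, of f] fc_transpose[OF Y, of f] by (simp add: transpose_mult[of B m k _ k])
  have c: "B * fc k Y f \<in> carrier_mat m k" for f using fc_carrier[OF Y, of f] B by simp
  show ?thesis
    using spectral_norm_split_left[OF Y, of "B\<^sup>T" m r] B
    unfolding e spectral_norm_transpose[OF c] spectral_norm_transpose[OF B] by simp
qed

context aligned_psd_pair
begin

lemma blocks_of_UP_minus_P':
  "P' * (U * P - P') * P = T" "P' * (U * P - P') * Pc = - (P' * Pc)" "Pc' * (U * P - P') = Pc' * (U * P)"
  by (simp_all add: square_simps T_def products zero_products left_products zero_minus right_mult_zero_mat[of _ k k])

text \<open>Splitting \<open>E\<close> and \<open>E2\<close> into three orthogonal blocks each gives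
  two inequalities which together contain
  \<open>(s\<^sup>2 + s'\<^sup>2) * (x\<^sup>2 + y\<^sup>2)\<close>. Since
  \<open>(s + s')\<^sup>2\<close> is at most twice \<open>s\<^sup>2 + s'\<^sup>2\<close>, the
  off-diagonal blocks fit into the constant that \<open>T\<close> alone requires.\<close>

lemma frobenius_bound: "frobenius_norm (U * P - P') \<le> 2 * frobenius_norm E / (s + s')"
proof -
  interpret aligned_psd_pair_norm k r V V' U a a' s s' frobenius_norm k
    by (intro aligned_psd_pair_norm.intro aligned_psd_pair_norm_axioms.intro
        aligned_psd_pair_axioms frobenius_norm_monotone_matrix_norm) simp
  let ?F = frobenius_norm
  have nn: "0 \<le> ?F B" for B by (rule frobenius_norm_nonneg)
  have sq: "(c * ?F B)\<^sup>2 \<le> (?F C)\<^sup>2" if "c * ?F B \<le> ?F C" "0 \<le> c" for B C c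
    by (rule power_mono[OF that(1)]) (use that(2) nn in simp)
  have split: "(?F B)\<^sup>2 = (?F (B * Pc))\<^sup>2 + (?F (P' * (B * P)))\<^sup>2 + (?F (Pc' * (B * P)))\<^sup>2"
    if "B \<in> carrier_mat k k" for B
  proof -
    have "B * P \<in> carrier_mat k k" using that by (simp add: square_simps)
    then show ?thesis
      using frobenius_norm_split_right[OF V that, of r] frobenius_norm_split_left[OF V', of "B * P" k r]
      by (simp add: P_def Pc_def P'_def Pc'_def)
  qed
  \<comment> \<open>These products are supported on the range of \<open>A\<close>, so the fourth
    block, between the two kernels, is zero.\<close>
  have PcE: "Pc' * (E * P) = Pc' * E" "Pc' * (E2 * P) = Pc' * E2"
    using Pc'_E Pc'_E2 by (simp_all add: products carriers square_simps flip: assoc_mult_mat[of Pc' k k _ k P k])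
  have e: "(?F E)\<^sup>2 = (?F (E * Pc))\<^sup>2 + (?F (P' * (E * P)))\<^sup>2 + (?F (Pc' * E))\<^sup>2"
    using split[OF carriers(8)] by (simp only: PcE)
  have e2: "(?F E)\<^sup>2 = (?F (E2 * Pc))\<^sup>2 + (?F (P' * (E2 * P)))\<^sup>2 + (?F (Pc' * E2))\<^sup>2"
    using split[OF carriers(9)] by (simp only: PcE nrm_E2)
  have UP: "U * P - P' \<in> carrier_mat k k" "P' * (U * P - P') \<in> carrier_mat k k" by (simp_all add: square_simps)
  define t x y where "t = ?F T" and "x = ?F (P' * Pc)" and "y = ?F (Pc' * (U * P))"
  define e1 e2' where "e1 = ?F (P' * (E * P))" and "e2' = ?F (P' * (E2 * P))"
  have "(?F (U * P - P'))\<^sup>2 = (?F (P' * (U * P - P')))\<^sup>2 + y\<^sup>2"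
    using frobenius_norm_split_left[OF V' UP(1), of r] blocks_of_UP_minus_P'(3)
    unfolding y_def P'_def[symmetric] Pc'_def[symmetric] by simp
  moreover have "(?F (P' * (U * P - P')))\<^sup>2 = t\<^sup>2 + x\<^sup>2"
  proof -
    have "P' * Pc \<in> carrier_mat k k" by (simp add: square_simps)
    then show ?thesis
      using frobenius_norm_split_right[OF V UP(2), of r] blocks_of_UP_minus_P'(1,2)
        nrm_uminus[of "P' * Pc" k k]
      unfolding t_def x_def P_def[symmetric] Pc_def[symmetric] by simp
  qed
  ultimately have total: "(?F (U * P - P'))\<^sup>2 = t\<^sup>2 + x\<^sup>2 + y\<^sup>2" by simp
  have "((s + s') * t)\<^sup>2 \<le> (e1 + e2')\<^sup>2"
    by (rule power_mono) (use T_bound s nn in \<open>auto simp: t_def e1_def e2'_def\<close>)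
  also have "\<dots> \<le> 2 * e1\<^sup>2 + 2 * e2'\<^sup>2"
    using zero_le_power2[of "e1 - e2'"] by (simp add: power2_eq_square algebra_simps)
  finally have T: "(s + s')\<^sup>2 * t\<^sup>2 \<le> 2 * e1\<^sup>2 + 2 * e2'\<^sup>2" by (simp add: power_mult_distrib)
  have b1: "s'\<^sup>2 * x\<^sup>2 + s\<^sup>2 * y\<^sup>2 + e1\<^sup>2 \<le> (?F E)\<^sup>2"
    using e sq[OF offdiagonal_bounds(1)] sq[OF offdiagonal_bounds(2)] s
    by (simp add: x_def y_def e1_def power_mult_distrib)
  have b2: "s\<^sup>2 * x\<^sup>2 + s'\<^sup>2 * y\<^sup>2 + e2'\<^sup>2 \<le> (?F E)\<^sup>2"
    using e2 sq[OF offdiagonal_bounds(3)] sq[OF offdiagonal_bounds(4)] s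
    by (simp add: x_def y_def e2'_def power_mult_distrib)
  have "(s + s')\<^sup>2 * (x\<^sup>2 + y\<^sup>2) \<le> (2 * s\<^sup>2 + 2 * s'\<^sup>2) * (x\<^sup>2 + y\<^sup>2)"
    by (rule mult_right_mono)
      (use zero_le_power2[of "s - s'"] in \<open>simp_all add: power2_eq_square algebra_simps\<close>)
  \<comment> \<open>Twice \<open>b1\<close> plus twice \<open>b2\<close> absorbs the bound
    \<open>T\<close> for the remaining term.\<close>
  then have "(s + s')\<^sup>2 * (t\<^sup>2 + x\<^sup>2 + y\<^sup>2) \<le> 4 * (?F E)\<^sup>2"
    using T b1 b2 by (simp add: algebra_simps)
  then have "((s + s') * ?F (U * P - P'))\<^sup>2 \<le> (2 * ?F E)\<^sup>2"
    by (simp add: power_mult_distrib total)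
  then have "(s + s') * ?F (U * P - P') \<le> 2 * ?F E"
    by (rule power2_le_imp_le) (use nn in simp)
  then show ?thesis using s by (simp add: pos_le_divide_eq mult.commute)
qed

lemma spectral_bound:
  "(spectral_norm (U * P - P'))\<^sup>2
     \<le> (spectral_norm T)\<^sup>2 + (spectral_norm (P' * Pc))\<^sup>2 + (spectral_norm (Pc' * (U * P)))\<^sup>2"
proof -
  interpret aligned_psd_pair_norm k r V V' U a a' s s' spectral_norm k
    by (intro aligned_psd_pair_norm.intro aligned_psd_pair_norm_axioms.intro
        aligned_psd_pair_axioms spectral_norm_monotone_matrix_norm) simp
  have UP: "U * P - P' \<in> carrier_mat k k" "P' * (U * P - P') \<in> carrier_mat k k" by (simp_all add: square_simps)
  have "P' * Pc \<in> carrier_mat k k" by (simp add: square_simps)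
  then have "(spectral_norm (P' * (U * P - P')))\<^sup>2 \<le> (spectral_norm T)\<^sup>2 + (spectral_norm (P' * Pc))\<^sup>2"
    using spectral_norm_split_right[OF V UP(2), of r] blocks_of_UP_minus_P'(1,2) nrm_uminus[of "P' * Pc" k k]
    unfolding P_def[symmetric] Pc_def[symmetric] by simp
  then show ?thesis
    using spectral_norm_split_left[OF V' UP(1), of r] blocks_of_UP_minus_P'(3)
    unfolding P'_def[symmetric] Pc'_def[symmetric] by simp
qed

end

section \<open>Choice of the free orthogonal factor\<close>

context monotone_matrix_norm
begin

lemma nrm_sqrt2_le:
  assumes "B \<in> carrier_mat m c" "C \<in> carrier_mat m' c" "m \<le> N" "m' \<le> N" "c \<le> N"
    and "\<And>v. v \<in> carrier_vec c \<Longrightarrow> nsq (B *\<^sub>v v) \<le> 2 * nsq (C *\<^sub>v v)"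
  shows "nrm B \<le> sqrt 2 * nrm C"
proof -
  have "nrm B \<le> nrm (sqrt 2 \<cdot>\<^sub>m C)"
  proof (rule nrm_mono[of _ m c _ m'])
    fix v :: "real vec" assume v: "v \<in> carrier_vec c"
    have "(sqrt 2 \<cdot>\<^sub>m C) *\<^sub>v v = sqrt 2 \<cdot>\<^sub>v (C *\<^sub>v v)"
      using assms(2) v by (intro eq_vecI) auto
    then have "nsq ((sqrt 2 \<cdot>\<^sub>m C) *\<^sub>v v) = (sqrt 2)\<^sup>2 * nsq (C *\<^sub>v v)" by (simp only: nsq_smult)
    then show "nsq (B *\<^sub>v v) \<le> nsq ((sqrt 2 \<cdot>\<^sub>m C) *\<^sub>v v)" using assms(6)[OF v] by simp
  qed (use assms in auto)
  also have "\<dots> = sqrt 2 * nrm C" using nrm_smult[OF assms(2,4,5), of "sqrt 2"] by simp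
  finally show ?thesis .
qed

text \<open>The two terms on the right measure how far \<open>Q * H\<close> and \<open>H\<close> are
  from the range of \<open>G\<close>. Aligning \<open>Q * H\<close> with \<open>G * W1\<close> and
  \<open>H\<close> with \<open>G * W2\<close> takes \<open>Q * (H * H\<^sup>T)\<close> first to
  \<open>G * W1 * H\<^sup>T\<close> and then to \<open>G * W1 * W2\<^sup>T * G\<^sup>T\<close>. In
  the application \<open>H\<close> spans the kernel of \<open>A'\<close> and \<open>G\<close> is
  \<open>V2\<close>, which spans that of \<open>A\<close>.\<close>

lemma complement_rotation:
  assumes G: "G \<in> carrier_mat k m" "G\<^sup>T * G = 1\<^sub>m m"
    and H: "H \<in> carrier_mat k m" "H\<^sup>T * H = 1\<^sub>m m"
    and Q: "orth_mat k Q" and N: "k \<le> N" "m \<le> N"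
  shows "\<exists>W. orth_mat m W \<and> nrm (Q * (H * H\<^sup>T) - G * W * G\<^sup>T)
     \<le> sqrt 2 * nrm ((1\<^sub>m k - G * G\<^sup>T) * (Q * H))
       + sqrt 2 * nrm ((1\<^sub>m k - G * G\<^sup>T) * H)"
proof -
  note Qc = orth_matD[OF Q]
  let ?R = "1\<^sub>m k - G * G\<^sup>T"
  have R: "?R \<in> carrier_mat k k" using G by (simp add: minus_carrier_mat)
  have QH: "Q * H \<in> carrier_mat k m" using Qc H by simp
  have "(Q * H)\<^sup>T * (Q * H) = H\<^sup>T * ((Q\<^sup>T * Q) * H)"
    using Qc(1) H by (simp add: transpose_mult[of _ k k _ m] assoc_mult_mat[of _ m k _ k _ m] assoc_mult_mat[of _ k k _ k _ m])
  then have QH1: "(Q * H)\<^sup>T * (Q * H) = 1\<^sub>m m" using Qc H by simp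
  obtain W1 where W1: "orth_mat m W1" and le1: "\<And>v. v \<in> carrier_vec m \<Longrightarrow>
      nsq ((Q * H - G * W1) *\<^sub>v v) \<le> 2 * nsq (?R *\<^sub>v ((Q * H) *\<^sub>v v))"
    using polar_alignment[OF G QH QH1] by blast
  obtain W2 where W2: "orth_mat m W2" and le2: "\<And>v. v \<in> carrier_vec m \<Longrightarrow>
      nsq ((H - G * W2) *\<^sub>v v) \<le> 2 * nsq (?R *\<^sub>v (H *\<^sub>v v))"
    using polar_alignment[OF G H] by blast
  note W1c = orth_matD[OF W1] and W2c = orth_matD[OF W2]
  define W where "W = W1 * W2\<^sup>T"
  have W: "orth_mat m W" unfolding W_def by (intro orth_mat_mult W1 orth_mat_transpose W2)
  have c1: "Q * H - G * W1 \<in> carrier_mat k m" and c2: "H - G * W2 \<in> carrier_mat k m"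
    using G W1c W2c by (auto intro!: minus_carrier_mat)
  have n1: "nrm (Q * H - G * W1) \<le> sqrt 2 * nrm (?R * (Q * H))"
  proof (rule nrm_sqrt2_le[OF c1])
    show "nsq ((Q * H - G * W1) *\<^sub>v v) \<le> 2 * nsq ((?R * (Q * H)) *\<^sub>v v)" if "v \<in> carrier_vec m" for v
      using le1[OF that] assoc_mult_mat_vec[OF R QH that] by simp
  qed (use R QH N in auto)
  have n2: "nrm (H - G * W2) \<le> sqrt 2 * nrm (?R * H)"
  proof (rule nrm_sqrt2_le[OF c2])
    show "nsq ((H - G * W2) *\<^sub>v v) \<le> 2 * nsq ((?R * H) *\<^sub>v v)" if "v \<in> carrier_vec m" for v
      using le2[OF that] assoc_mult_mat_vec[OF R H(1) that] by simp
  qed (use R H N in auto)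
  define C where "C = W1 * (H - G * W2)\<^sup>T"
  have C: "C \<in> carrier_mat m k" using W1c c2 by (simp add: C_def)
  have alg: "x - z = (x - y) + (y - z)"
    if "x \<in> carrier_mat k k" "y \<in> carrier_mat k k" "z \<in> carrier_mat k k" for x y z :: "real mat"
    by (rule eq_matI) (use that in auto)
  have p1: "(Q * H - G * W1) * H\<^sup>T = Q * (H * H\<^sup>T) - G * W1 * H\<^sup>T"
    using Qc(1) G H W1c(1) by (simp add: minus_mult_distrib_mat[of _ k m _ _ k] assoc_mult_mat[of _ k k _ m _ k])
  have "C = W1 * H\<^sup>T - W1 * (W2\<^sup>T * G\<^sup>T)"
    unfolding C_def using G H W1c(1) W2c(1)
    by (simp add: transpose_minus[of _ k m] transpose_mult[of _ k m _ m] mult_minus_distrib_mat[of _ m m _ k])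
  then have p2: "G * C = G * W1 * H\<^sup>T - G * W * G\<^sup>T"
    using G H W1c(1) W2c(1)
    by (simp add: W_def mult_minus_distrib_mat[of _ k m _ k] assoc_mult_mat[of _ k m _ m _ k]
        assoc_mult_mat[of _ m m _ m _ k] mult_carrier_mat[of _ m m _ k])
  have "Q * (H * H\<^sup>T) - G * W * G\<^sup>T = (Q * H - G * W1) * H\<^sup>T + G * C"
    unfolding p1 p2 by (rule alg) (use Qc(1) G H W1c(1) orth_matD(1)[OF W] in \<open>auto intro!: mult_carrier_mat\<close>)
  also have "nrm \<dots> \<le> nrm ((Q * H - G * W1) * H\<^sup>T) + nrm (G * C)"
    by (rule nrm_add[of _ k k]) (use c1 H G C N in auto)
  also have "nrm ((Q * H - G * W1) * H\<^sup>T) = nrm (Q * H - G * W1)"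
    by (rule nrm_isometry_right[OF H c1]) (use N in auto)
  also have "nrm (G * C) = nrm C" by (rule nrm_isometry_left[OF G C]) (use N in auto)
  also have "nrm C = nrm ((H - G * W2)\<^sup>T)"
    unfolding C_def by (rule nrm_orth_left[OF W1, of _ k]) (use c2 N in auto)
  also have "\<dots> = nrm (H - G * W2)" by (rule nrm_transpose[OF c2 N])
  finally show ?thesis using W n1 n2 by (intro exI[of _ W]) auto
qed

text \<open>The distance is Lipschitz in \<open>W\<close>: \<open>X\<close> and \<open>V2\<close>
  are isometries, and \<open>L - W\<close> is dominated by its Frobenius norm times the identity.
  Compactness of the orthogonal group then yields a minimiser, and the given \<open>W\<close> bounds
  the minimum.\<close>

lemma attains_min_on_basis_family:
  assumes X: "X \<in> carrier_mat n k" "X\<^sup>T * X = 1\<^sub>m k" and X': "X' \<in> carrier_mat n k"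
    and V1: "V1 \<in> carrier_mat k r" and V2: "V2 \<in> carrier_mat k m" "V2\<^sup>T * V2 = 1\<^sub>m m"
    and N: "n \<le> N" "k \<le> N" "m \<le> N"
    and W: "orth_mat m W"
    and le: "nrm (X' - (X * V1 * V1\<^sup>T + X * V2 * W * V2\<^sup>T)) \<le> c"
  shows "minimum_le (\<lambda>Y. nrm (X' - Y)) (basis_family m X V1 V2) c"
proof -
  let ?Y = "\<lambda>W. X * V1 * V1\<^sup>T + X * V2 * W * V2\<^sup>T"
  define f where "f W = nrm (X' - ?Y W)" for W
  have XV1: "X * V1 * V1\<^sup>T \<in> carrier_mat n k" using X V1 by (auto intro!: mult_carrier_mat)
  have Yc: "?Y W \<in> carrier_mat n k" if "W \<in> carrier_mat m m" for W
    using X V1 V2 that by (auto intro!: mult_carrier_mat)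
  have lip: "f W \<le> f L + frobenius_norm (L - W) * nrm (1\<^sub>m m)" if W: "W \<in> carrier_mat m m" and L: "L \<in> carrier_mat m m" for W L
  proof -
    have LW: "L - W \<in> carrier_mat m m" using W by (simp add: minus_carrier_mat)
    have XV: "X * V2 \<in> carrier_mat n m" using X V2 by simp
    have dist: "(X * V2 * L) * V2\<^sup>T - (X * V2 * W) * V2\<^sup>T = X * (V2 * ((L - W) * V2\<^sup>T))"
    proof -
      have "X * V2 * Z * V2\<^sup>T = X * (V2 * (Z * V2\<^sup>T))" if "Z \<in> carrier_mat m m" for Z
        using X V2 that by (simp add: assoc_mult_mat[of _ n k _ m _ k] assoc_mult_mat[of _ n k _ m _ m] 
            assoc_mult_mat[of _ n m _ m _ k] assoc_mult_mat[of _ k m _ m _ k] mult_carrier_mat[of _ k m _ m])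
      then show ?thesis using X V2 W L
        by (simp add: minus_mult_distrib_mat[of _ m m _ _ k] mult_minus_distrib_mat[of _ k m _ k]
            mult_minus_distrib_mat[of _ n k _ k] mult_carrier_mat[of _ m m _ k] mult_carrier_mat[of _ k m _ k])
    qed
    have alg: "x - (y + w) = (x - (y + l)) + (l - w)"
      if "x \<in> carrier_mat n k" "y \<in> carrier_mat n k" "w \<in> carrier_mat n k" "l \<in> carrier_mat n k"
      for x y w l :: "real mat"
      by (rule eq_matI) (use that in auto)
    have "X' - ?Y W = (X' - ?Y L) + (X * V2 * L * V2\<^sup>T - X * V2 * W * V2\<^sup>T)"
      by (rule alg[OF X' XV1]) (use X V2 W L in \<open>auto intro!: mult_carrier_mat\<close>)
    then have "f W \<le> f L + nrm (X * (V2 * ((L - W) * V2\<^sup>T)))"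
      unfolding f_def dist
      using nrm_add[of "X' - ?Y L" n k "X * (V2 * ((L - W) * V2\<^sup>T))"] X V2 LW Yc[OF L] N
      by (simp add: minus_carrier_mat mult_carrier_mat[of _ n k _ k] mult_carrier_mat[of _ k m _ k] mult_carrier_mat[of _ m m _ k])
    also have "nrm (X * (V2 * ((L - W) * V2\<^sup>T))) = nrm (V2 * ((L - W) * V2\<^sup>T))"
      by (rule nrm_isometry_left[OF X, of _ k])
        (use V2 LW N in \<open>auto simp: mult_carrier_mat[of _ k m _ k] mult_carrier_mat[of _ m m _ k]\<close>)
    also have "\<dots> = nrm ((L - W) * V2\<^sup>T)"
      by (rule nrm_isometry_left[OF V2, of _ k]) (use V2 LW N in \<open>auto simp: mult_carrier_mat[of _ m m _ k]\<close>)
    also have "\<dots> = nrm (L - W)" by (rule nrm_isometry_right[OF V2 LW]) (use N in auto)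
    also have "nrm (L - W) \<le> nrm (frobenius_norm (L - W) \<cdot>\<^sub>m 1\<^sub>m m)"
    proof (rule nrm_mono[of _ m m _ m])
      fix v :: "real vec" assume v: "v \<in> carrier_vec m"
      have "(frobenius_norm (L - W) \<cdot>\<^sub>m 1\<^sub>m m) *\<^sub>v v = frobenius_norm (L - W) \<cdot>\<^sub>v v"
        using v by (intro eq_vecI) auto
      then show "nsq ((L - W) *\<^sub>v v) \<le> nsq ((frobenius_norm (L - W) \<cdot>\<^sub>m 1\<^sub>m m) *\<^sub>v v)"
        using nsq_le_frobenius_norm[OF LW v] by (simp only: nsq_smult)
    qed (use LW N in auto)
    also have "\<dots> = frobenius_norm (L - W) * nrm (1\<^sub>m m)"
      using nrm_smult[of "1\<^sub>m m" m m "frobenius_norm (L - W)"] N frobenius_norm_nonneg[of "L - W"] by simp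
    finally show ?thesis by simp
  qed
  have "\<exists>V. orth_mat m V \<and> (\<forall>Z. orth_mat m Z \<longrightarrow> f V \<le> f Z)"
  proof (rule attains_min_on_orthogonal)
    show "0 \<le> f V" if "orth_mat m V" for V
      unfolding f_def using Yc[OF orth_matD(1)[OF that]] N by (intro nrm_nonneg[of _ n k] minus_carrier_mat) auto
    fix Vn :: "nat \<Rightarrow> real mat" and L
    assume Vn: "\<And>n. orth_mat m (Vn n)" and L: "orth_mat m L"
      and lim: "\<And>i j. i < m \<Longrightarrow> j < m \<Longrightarrow> (\<lambda>n. Vn n $$ (i,j)) \<longlonglongrightarrow> L $$ (i,j)"
    note Vc = orth_matD(1)[OF Vn] and Lc = orth_matD(1)[OF L]
    have fro: "frobenius_norm (A - B) = sqrt (\<Sum>i<m. \<Sum>j<m. (A $$ (i,j) - B $$ (i,j))\<^sup>2)"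
      if "A \<in> carrier_mat m m" "B \<in> carrier_mat m m" for A B
      using that by (simp add: frobenius_norm_def)
    have g: "(\<lambda>n. sqrt (\<Sum>i<m. \<Sum>j<m. (Vn n $$ (i,j) - L $$ (i,j))\<^sup>2) * nrm (1\<^sub>m m)) \<longlonglongrightarrow>
        sqrt (\<Sum>i<m. \<Sum>j<m. (L $$ (i,j) - L $$ (i,j))\<^sup>2) * nrm (1\<^sub>m m)"
      by (intro tendsto_mult tendsto_real_sqrt tendsto_sum tendsto_power tendsto_diff lim tendsto_const) auto
    then have g0: "(\<lambda>n. frobenius_norm (Vn n - L) * nrm (1\<^sub>m m)) \<longlonglongrightarrow> 0"
      by (simp add: fro[OF Vc Lc])
    have sym: "frobenius_norm (L - Vn n) = frobenius_norm (Vn n - L)" for n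
      by (simp add: fro[OF Vc Lc] fro[OF Lc Vc] power2_commute)
    have "(\<lambda>n. f (Vn n) - f L) \<longlonglongrightarrow> 0"
    proof (rule tendsto_0_le[OF g0, of _ 1], rule always_eventually, rule allI)
      fix n
      have "\<bar>f (Vn n) - f L\<bar> \<le> frobenius_norm (Vn n - L) * nrm (1\<^sub>m m)"
        using lip[OF Vc[of n] Lc] lip[OF Lc Vc[of n]] sym[of n] by (simp add: abs_le_iff)
      then show "norm (f (Vn n) - f L) \<le> norm (frobenius_norm (Vn n - L) * nrm (1\<^sub>m m)) * 1"
        by simp
    qed
    then show "(\<lambda>n. f (Vn n)) \<longlonglongrightarrow> f L" by (simp add: LIM_zero_iff)
  qed
  then obtain W0 where W0: "orth_mat m W0" and min: "\<And>Z. orth_mat m Z \<Longrightarrow> f W0 \<le> f Z" by blast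
  show ?thesis unfolding minimum_le_def
  proof (intro bexI[of _ "?Y W0"] conjI ballI)
    show "?Y W0 \<in> basis_family m X V1 V2"
      using orth_matD[OF W0] unfolding basis_family_def by blast
    show "nrm (X' - ?Y W0) \<le> nrm (X' - Z)" if "Z \<in> basis_family m X V1 V2" for Z
    proof -
      obtain Wz where "Wz \<in> carrier_mat m m" "Wz\<^sup>T * Wz = 1\<^sub>m m" "Z = ?Y Wz"
        using \<open>Z \<in> basis_family m X V1 V2\<close> unfolding basis_family_def by blast
      then show ?thesis using min[of Wz] by (simp add: orth_mat_def f_def)
    qed
    show "nrm (X' - ?Y W0) \<le> c" using min[OF W] le by (simp add: f_def)
  qed
qed

end

section \<open>Semidefinite factors and canonical angles\<close>

text \<open>The right singular basis diagonalises \<open>A * A\<close>. For a basis vector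
  \<open>v\<close> with singular value \<sigma>, the residual \<open>w\<close> = A v - \<sigma> v
  satisfies A w = - \<sigma> w, which positivity rules out for \<sigma> > 0 unless \<open>w\<close>
  is zero; for \<sigma> = 0 the vector A v has length zero.\<close>

lemma psd_eq_fc_sv:
  assumes A: "A \<in> carrier_mat k k" and psd: "psd A"
  shows "\<exists>V. orth_mat k V \<and> A = fc k V (sv A)"
proof -
  have AT: "A\<^sup>T = A" and pos: "\<And>v. v \<in> carrier_vec k \<Longrightarrow> 0 \<le> v \<bullet> (A *\<^sub>v v)"
    using psd A unfolding psd_def by auto
  obtain V where V: "orth_mat k V"
    and d: "(A * V)\<^sup>T * (A * V) = mat_diag k (\<lambda>i. (sv A i)\<^sup>2)"
    using exists_sv_basis[OF A] by blast
  note Vc = orth_matD[OF V]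
  have AAV: "A * (A * V) = V * mat_diag k (\<lambda>i. (sv A i)\<^sup>2)"
  proof -
    have "V * mat_diag k (\<lambda>i. (sv A i)\<^sup>2) = (V * V\<^sup>T) * (A * (A * V))"
      unfolding d[symmetric] using A Vc(1)
      by (simp add: transpose_mult[of _ k k _ k] AT assoc_mult_mat[of _ k k _ k _ k] mult_carrier_mat[of _ k k _ k])
    then show ?thesis using A Vc by simp
  qed
  have eig: "A *\<^sub>v col V i = sv A i \<cdot>\<^sub>v col V i" if i: "i < k" for i
  proof -
    define v where "v = col V i"
    have v: "v \<in> carrier_vec k" using Vc i by (simp add: v_def)
    have Av: "A *\<^sub>v v \<in> carrier_vec k" using A v by simp
    have AAv: "A *\<^sub>v (A *\<^sub>v v) = (sv A i)\<^sup>2 \<cdot>\<^sub>v v"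
    proof -
      have "A *\<^sub>v (A *\<^sub>v v) = col (A * (A * V)) i"
        using A Vc(1) i col_mult2[of A k k "A * V" k i] col_mult2[OF A Vc(1) i]
        by (simp add: v_def del: col_mult col_mult2)
      also have "\<dots> = (sv A i)\<^sup>2 \<cdot>\<^sub>v v"
        unfolding AAV mat_diag_mult_right[OF Vc(1)] v_def using i Vc(1) by (intro eq_vecI) auto
      finally show ?thesis .
    qed
    define w where "w = A *\<^sub>v v - sv A i \<cdot>\<^sub>v v"
    have w: "w \<in> carrier_vec k" using Av v by (simp add: w_def)
    have Aw: "A *\<^sub>v w = (- sv A i) \<cdot>\<^sub>v w"
    proof -
      have "A *\<^sub>v w = A *\<^sub>v (A *\<^sub>v v) - sv A i \<cdot>\<^sub>v (A *\<^sub>v v)"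
        using A Av v by (simp add: w_def mult_minus_distrib_mat_vec[of _ k k] mult_mat_vec[of _ k k])
      also have "\<dots> = (- sv A i) \<cdot>\<^sub>v w"
      proof -
        have "t\<^sup>2 \<cdot>\<^sub>v v - t \<cdot>\<^sub>v y = (- t) \<cdot>\<^sub>v (y - t \<cdot>\<^sub>v v)" if "y \<in> carrier_vec k" for t y
          using v that by (intro eq_vecI) (auto simp: power2_eq_square algebra_simps)
        then show ?thesis unfolding AAv w_def using Av by blast
      qed
      finally show ?thesis .
    qed
    have w0: "w = 0\<^sub>v k"
    proof (cases "sv A i = 0")
      case True
      have "nsq (A *\<^sub>v v) = v \<bullet> (A *\<^sub>v (A *\<^sub>v v))"
        using scalar_prod_mult_mat_vec[OF A v Av] AT by simp
      also have "\<dots> = 0" unfolding AAv using True v by simp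
      finally have "A *\<^sub>v v = 0\<^sub>v k" using scalar_prod_self_eq_0[OF Av] by simp
      then show ?thesis unfolding w_def True using v by (intro eq_vecI) auto
    next
      case False
      then have "0 < sv A i" using sv_nonneg[OF A, of i] by simp
      moreover have "0 \<le> - (sv A i * nsq w)" using pos[OF w] w unfolding Aw by simp
      ultimately have "nsq w \<le> 0" by (simp add: mult_le_0_iff)
      then have "nsq w = 0" using scalar_prod_self_nonneg[of w] by simp
      then show ?thesis using scalar_prod_self_eq_0[OF w] by simp
    qed
    have eqI: "y = z" if "y - z = 0\<^sub>v k" "y \<in> carrier_vec k" "z \<in> carrier_vec k" for y z :: "real vec"
    proof (rule eq_vecI)
      fix j assume "j < dim_vec z"
      then have j: "j < k" using that(3) by simp
      then have "y $ j - z $ j = (y - z) $ j" using that(3) by simp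
      also have "\<dots> = 0" unfolding that(1) using j by simp
      finally show "y $ j = z $ j" by simp
    qed (use that in simp)
    show ?thesis
      unfolding v_def[symmetric] by (rule eqI[OF w0[unfolded w_def] Av]) (use v in simp)
  qed
  have "A * V = V * mat_diag k (sv A)"
  proof (rule mat_col_eqI)
    fix i assume "i < dim_col (V * mat_diag k (sv A))"
    then have i: "i < k" by (simp add: mat_diag_def)
    have "col (V * mat_diag k (sv A)) i = sv A i \<cdot>\<^sub>v col V i"
      unfolding mat_diag_mult_right[OF Vc(1)] using i Vc(1) by (intro eq_vecI) auto
    then show "col (A * V) i = col (V * mat_diag k (sv A)) i"
      unfolding col_mult2[OF A Vc(1) i] using eig[OF i] by (rule trans[OF _ sym, rotated])
  qed (use A Vc in \<open>auto simp: mat_diag_def\<close>)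
  then have "fc k V (sv A) = A * (V * V\<^sup>T)"
    using A Vc(1) assoc_mult_mat[of A k k V k "V\<^sup>T" k] by (simp add: fc_def)
  then show ?thesis using V A Vc by auto
qed

lemma rank_eq_of_col_space_eq:
  fixes A G :: "real mat"
  assumes "vec_space.col_space k A = vec_space.col_space k G"
  shows "vec_space.rank k A = vec_space.rank k G"
proof -
  interpret vec_space "TYPE(real)" k .
  show ?thesis using assms unfolding rank_def col_space_def by simp
qed

lemma col_space_iff:
  fixes A :: "real mat"
  assumes "A \<in> carrier_mat n c"
  shows "vec_space.col_space n A = {A *\<^sub>v x | x. x \<in> carrier_vec c}"
proof -
  interpret vec_space "TYPE(real)" n .
  show ?thesis using col_space_eq[OF assms] assms by auto
qed

lemma rank_isometry:
  fixes G :: "real mat"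
  assumes G: "G \<in> carrier_mat k p" "G\<^sup>T * G = 1\<^sub>m p"
  shows "vec_space.rank k G = p"
proof -
  interpret vec_space "TYPE(real)" k .
  have entry: "col G i \<bullet> col G j = (if i = j then 1 else 0)" if "i < p" "j < p" for i j
  proof -
    have "col G i \<bullet> col G j = (G\<^sup>T * G) $$ (i,j)" using G(1) that by simp
    then show ?thesis unfolding G(2) using that by simp
  qed
  have "distinct (cols G)"
  proof (subst distinct_conv_nth, intro allI impI)
    fix i j assume ij: "i < length (cols G)" "j < length (cols G)" "i \<noteq> j"
    then have "col G i \<bullet> col G i \<noteq> col G i \<bullet> col G j" using entry G(1) by simp
    then show "cols G ! i \<noteq> cols G ! j" using ij G(1) by auto
  qed
  moreover have "lin_indpt (set (cols G))"
  proof
    assume "lin_dep (set (cols G))"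
    then obtain v where v: "v \<in> carrier_vec p" "v \<noteq> 0\<^sub>v p" "G *\<^sub>v v = 0\<^sub>v k"
      using lin_depE[OF G(1)] \<open>distinct (cols G)\<close> by blast
    have "nsq v = 0" using nsq_isometry[OF G v(1)] v(3) by simp
    then show False using scalar_prod_self_eq_0[OF v(1)] v(2) by simp
  qed
  ultimately show ?thesis by (rule lin_indpt_full_rank[OF G(1)])
qed

text \<open>The first \<open>p\<close> eigenvectors, those with positive eigenvalue, form an
  isometry \<open>G\<close> with the same column space as \<open>A\<close>:
  \<open>G * G\<^sup>T\<close> fixes \<open>A\<close>, and the spectral pseudoinverse
  \<open>?I\<close> provides preimages under \<open>A\<close> for the range of
  \<open>G\<close>.\<close>

lemma psd_rank:
  assumes A: "A \<in> carrier_mat k k" and psd: "psd A"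
  defines "r \<equiv> vec_space.rank k A"
  shows "r \<le> k" and "i < r \<Longrightarrow> 0 < sv A i" and "r \<le> i \<Longrightarrow> sv A i = 0"
proof -
  define p where "p = (LEAST i. sv A i = 0)"
  have k: "sv A k = 0" using A by (simp add: sv_def)
  have pk: "p \<le> k" unfolding p_def by (rule Least_le) (rule k)
  have p0: "sv A p = 0" unfolding p_def by (rule LeastI[of "\<lambda>i. sv A i = 0", OF k])
  have pos: "0 < sv A i" if "i < p" for i
    using not_less_Least[of i "\<lambda>i. sv A i = 0"] that sv_nonneg[OF A, of i] by (simp add: p_def)
  have zero: "sv A i = 0" if "p \<le> i" for i
    using sv_antimono[OF A that] sv_nonneg[OF A, of i] p0 by simp
  obtain V where V: "orth_mat k V" and eq: "A = fc k V (sv A)"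
    using psd_eq_fc_sv[OF A psd] by blast
  define G where "G = mat k p (\<lambda>(i,j). V $$ (i,j))"
  have G: "G \<in> carrier_mat k p" by (simp add: G_def)
  have G1: "G\<^sup>T * G = 1\<^sub>m p" and GG: "G * G\<^sup>T = fc k V (\<lambda>i. if i < p then 1 else 0)"
    using column_block[OF V, of 0 p G] pk by (simp_all add: G_def)
  let ?P = "fc k V (\<lambda>i. if i < p then 1 else 0)"
  let ?I = "fc k V (\<lambda>i. if i < p then 1 / sv A i else 0)"
  have PA: "?P * A = A"
    by (subst (1 2) eq, subst fc_mult[OF V], rule fc_cong[OF V]) (use zero in auto)
  have AI: "A * ?I = ?P"
    by (subst eq, subst fc_mult[OF V], rule fc_cong[OF V]) (use pos in force)
  have I: "?I \<in> carrier_mat k k" by (rule fc_carrier[OF V])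
  have PG: "?P * G = G"
    unfolding GG[symmetric] using G G1 by (simp add: assoc_mult_mat[of G k p "G\<^sup>T" k G p])
  have "vec_space.col_space k A = vec_space.col_space k G"
    unfolding col_space_iff[OF A] col_space_iff[OF G]
  proof (intro subset_antisym subsetI)
    fix y assume "y \<in> {A *\<^sub>v x | x. x \<in> carrier_vec k}"
    then obtain x where x: "x \<in> carrier_vec k" "y = A *\<^sub>v x" by blast
    have "y = (?P * A) *\<^sub>v x" using PA x by simp
    also have "\<dots> = G *\<^sub>v (G\<^sup>T *\<^sub>v (A *\<^sub>v x))"
      unfolding GG[symmetric] using G A x
      by (simp add: assoc_mult_mat_vec[of _ k k _ k] assoc_mult_mat_vec[of _ k p _ k])
    finally show "y \<in> {G *\<^sub>v x | x. x \<in> carrier_vec p}" using G A x by auto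
  next
    fix y assume "y \<in> {G *\<^sub>v x | x. x \<in> carrier_vec p}"
    then obtain x where x: "x \<in> carrier_vec p" "y = G *\<^sub>v x" by blast
    have "y = (A * ?I * G) *\<^sub>v x" using PG AI x by simp
    also have "\<dots> = A *\<^sub>v (?I *\<^sub>v (G *\<^sub>v x))"
      using G A I x by (simp add: assoc_mult_mat_vec[of _ k k _ p] assoc_mult_mat_vec[of _ k k _ k])
    finally show "y \<in> {A *\<^sub>v x | x. x \<in> carrier_vec k}" using G I x by auto
  qed
  then have "r = p" unfolding r_def using rank_eq_of_col_space_eq rank_isometry[OF G G1] by metis
  then show "r \<le> k" "i < r \<Longrightarrow> 0 < sv A i" "r \<le> i \<Longrightarrow> sv A i = 0" using pk pos zero by auto
qed

lemma nonzero_singular_values_psd: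
  assumes A: "A \<in> carrier_mat k k" and psd: "psd A"
  shows "nonzero_singular_values A = map (sv A) [0..<vec_space.rank k A]"
proof -
  let ?r = "vec_space.rank k A"
  note R = psd_rank[OF A psd]
  have "[0..<k] = [0..<?r] @ [?r..<k]" using R(1) upt_add_eq_append[of 0 ?r "k - ?r"] by simp
  then have "singular_values A = map (sv A) [0..<?r] @ map (sv A) [?r..<k]"
    by (simp add: singular_values_eq[OF A])
  moreover have "filter (\<lambda>s. s \<noteq> 0) (map (sv A) [0..<?r]) = map (sv A) [0..<?r]"
    by (rule filter_True) (use R(2) in force)
  moreover have "filter (\<lambda>s. s \<noteq> 0) (map (sv A) [?r..<k]) = []"
    by (rule filter_False) (use R(3) in force)
  ultimately show ?thesis by (simp add: nonzero_singular_values_def)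
qed

text \<open>The factor is \<open>Y\<^sup>T * X\<close>: the projection \<open>Y * Y\<^sup>T\<close>
  fixes every column of \<open>X\<close>, as these lie in the common column space.\<close>

lemma orthonormal_basis_mat_change:
  assumes "orthonormal_basis_mat n k S X" "orthonormal_basis_mat n k S Y"
  shows "\<exists>Q. orth_mat k Q \<and> X = Y * Q"
proof -
  have X: "X \<in> carrier_mat n k" "X\<^sup>T * X = 1\<^sub>m k"
    and Y: "Y \<in> carrier_mat n k" "Y\<^sup>T * Y = 1\<^sub>m k"
    and S: "vec_space.col_space n X = vec_space.col_space n Y"
    using assms unfolding orthonormal_basis_mat_def by auto
  define Q where "Q = Y\<^sup>T * X"
  have Q: "Q \<in> carrier_mat k k" using X Y by (simp add: Q_def)
  have YQ: "Y * Q = X"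
  proof (rule mat_col_eqI)
    fix i assume "i < dim_col X"
    then have i: "i < k" using X by simp
    have "X *\<^sub>v unit_vec k i = col X i" by (rule eq_vecI) (use X i in auto)
    moreover have "X *\<^sub>v unit_vec k i \<in> vec_space.col_space n X" unfolding col_space_iff[OF X(1)] by auto
    ultimately have "col X i \<in> {Y *\<^sub>v x | x. x \<in> carrier_vec k}"
      unfolding S col_space_iff[OF Y(1)] by simp
    then obtain x where x: "x \<in> carrier_vec k" "col X i = Y *\<^sub>v x" by blast
    have "col (Y * Q) i = Y *\<^sub>v (Y\<^sup>T *\<^sub>v col X i)"
      using X Y i col_mult2[of Y n k "Y\<^sup>T * X" k i] col_mult2[of "Y\<^sup>T" k n X k i]
      by (simp add: Q_def del: col_mult col_mult2)
    also have "\<dots> = Y *\<^sub>v ((Y\<^sup>T * Y) *\<^sub>v x)"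
      unfolding x(2) using Y(1) x(1) by (simp add: assoc_mult_mat_vec[of _ k n _ k])
    finally show "col (Y * Q) i = col X i" using x Y(2) by simp
  qed (use X Y Q in auto)
  have "Q\<^sup>T * Q = X\<^sup>T * (Y * Q)"
    using X Y Q by (simp add: Q_def transpose_mult[of _ k n _ k] assoc_mult_mat[of _ k n _ k _ k])
  then have "orth_mat k Q" using Q X(2) YQ by (simp add: orth_mat_def)
  then show ?thesis using YQ by blast
qed

text \<open>The reversal matches the decreasing order of the cosines with the decreasing order of the
  sines.\<close>

lemma sin_Theta_gram:
  assumes X: "orthonormal_basis_mat n k S X" and Y: "orthonormal_basis_mat n k T Y"
  shows "\<exists>W. orth_mat k W \<and> (\<forall>v\<in>carrier_vec k.
    nsq ((sin_Theta n k S T * W) *\<^sub>v v) = nsq v - nsq ((X\<^sup>T * Y) *\<^sub>v v))"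
proof -
  \<comment> \<open>The bases hidden in \<open>canonical_angle\<close> differ from \<open>X\<close>
    and \<open>Y\<close> by orthogonal factors \<open>Q1\<close> and \<open>Q2\<close>; the first
    does not affect lengths, the second is absorbed into \<open>W\<close>.\<close>
  define X0 where "X0 = (SOME X. orthonormal_basis_mat n k S X)"
  define Y0 where "Y0 = (SOME Y. orthonormal_basis_mat n k T Y)"
  have X0: "orthonormal_basis_mat n k S X0" unfolding X0_def using X by (rule someI)
  have Y0: "orthonormal_basis_mat n k T Y0" unfolding Y0_def using Y by (rule someI)
  have c: "X0 \<in> carrier_mat n k" "Y0 \<in> carrier_mat n k" "X0\<^sup>T * X0 = 1\<^sub>m k" "Y0\<^sup>T * Y0 = 1\<^sub>m k"
    using X0 Y0 unfolding orthonormal_basis_mat_def by auto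
  obtain Q1 where Q1: "orth_mat k Q1" "X = X0 * Q1" using orthonormal_basis_mat_change[OF X X0] by blast
  obtain Q2 where Q2: "orth_mat k Q2" "Y = Y0 * Q2" using orthonormal_basis_mat_change[OF Y Y0] by blast
  note Q1c = orth_matD[OF Q1(1)] and Q2c = orth_matD[OF Q2(1)]
  define M where "M = X0\<^sup>T * Y0"
  have M: "M \<in> carrier_mat k k" using c by (simp add: M_def)
  obtain V where V: "orth_mat k V"
    and d: "(M * V)\<^sup>T * (M * V) = mat_diag k (\<lambda>i. (sv M i)\<^sup>2)"
    using exists_sv_basis[OF M] by blast
  note Vc = orth_matD[OF V]
  have sv1: "sv M i \<le> 1" if "i < k" for i
  proof -
    have "sv M i \<le> sv (1\<^sub>m k) i"
    proof (rule sv_mono[OF M one_carrier_mat])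
      fix v :: "real vec" assume v: "v \<in> carrier_vec k"
      have "nsq (M *\<^sub>v v) \<le> nsq (Y0 *\<^sub>v v)"
        using nsq_transpose_isometry_le[OF c(1,3), of "Y0 *\<^sub>v v"] c v
        by (simp add: M_def assoc_mult_mat_vec[of _ k n _ k])
      then show "nsq (M *\<^sub>v v) \<le> nsq (1\<^sub>m k *\<^sub>v v)" using nsq_isometry[OF c(2,4) v] v by simp
    qed
    then show ?thesis using sv_one[OF that] by simp
  qed
  define R where "R = mat k k (\<lambda>(i,j). if k - 1 - i = j then 1 else 0 :: real)"
  have R: "R \<in> carrier_mat k k" by (simp add: R_def)
  have Rv: "(R *\<^sub>v v) $ i = v $ (k - 1 - i)" if "v \<in> carrier_vec k" "i < k" for v i
    using that by (simp add: R_def scalar_prod_def sum_if_mult)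
  have rev: "(\<Sum>i<k. f (k - 1 - i)) = (\<Sum>i<k. f i)" for f :: "nat \<Rightarrow> real"
    using sum.nat_diff_reindex[of f k] by simp
  have "R\<^sup>T * R = 1\<^sub>m k"
  proof (rule eq_matI)
    fix i j assume "i < dim_row (1\<^sub>m k :: real mat)" "j < dim_col (1\<^sub>m k :: real mat)"
    then have ij: "i < k" "j < k" by auto
    have "(R\<^sup>T * R) $$ (i,j) = (\<Sum>l<k. (if k - 1 - l = i then 1 else 0) * (if k - 1 - l = j then 1 else 0))"
      using ij by (simp add: R_def scalar_prod_def lessThan_atLeast0)
    also have "\<dots> = (\<Sum>l<k. (if l = i then 1 else 0) * (if l = j then 1 else 0))"
      by (rule rev[of "\<lambda>l. (if l = i then 1 else 0) * (if l = j then 1 else 0)"])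
    also have "\<dots> = (\<Sum>l<k. (if i = l then 1 else 0) * (if l = j then 1 else 0))"
      by (rule sum.cong) auto
    also have "\<dots> = 1\<^sub>m k $$ (i,j)" using ij by (simp only: sum_if_mult finite_lessThan) simp
    finally show "(R\<^sup>T * R) $$ (i,j) = 1\<^sub>m k $$ (i,j)" .
  qed (use R in auto)
  then have Ro: "orth_mat k R" using R by (simp add: orth_mat_def)
  define W where "W = R * (V\<^sup>T * Q2)"
  have W: "orth_mat k W" unfolding W_def by (intro orth_mat_mult Ro orth_mat_transpose V Q2(1))
  have st: "sin_Theta n k S T = mat_diag k (\<lambda>i. sqrt (1 - (sv M (k - 1 - i))\<^sup>2))"
  proof -
    have "sin (canonical_angle n k S T i) = sqrt (1 - (sv M (k - 1 - i))\<^sup>2)" if "i < k" for i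
    proof -
      have "canonical_angle n k S T i = arccos (sv M (k - 1 - i))"
        using that M by (simp add: canonical_angle_def Let_def X0_def[symmetric] Y0_def[symmetric]
            M_def[symmetric] singular_values_eq[OF M])
      moreover have "-1 \<le> sv M (k - 1 - i)" using sv_nonneg[OF M, of "k - 1 - i"] by linarith
      ultimately show ?thesis using sin_arccos[of "sv M (k - 1 - i)"] sv1[of "k - 1 - i"] that by simp
    qed
    then show ?thesis by (auto simp: sin_Theta_def mat_diag_def)
  qed
  have "nsq ((sin_Theta n k S T * W) *\<^sub>v v) = nsq v - nsq ((X\<^sup>T * Y) *\<^sub>v v)"
    if v: "v \<in> carrier_vec k" for v
  proof -
    define u where "u = Q2 *\<^sub>v v"
    define w where "w = V\<^sup>T *\<^sub>v u"
    have u: "u \<in> carrier_vec k" using Q2c v by (simp add: u_def)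
    have w: "w \<in> carrier_vec k" using Vc u by (simp add: w_def)
    have Rw: "R *\<^sub>v w \<in> carrier_vec k" using R w by simp
    have nw: "nsq w = nsq v"
      using nsq_orth[OF orth_mat_transpose[OF V] u] nsq_orth[OF Q2(1) v] by (simp add: w_def u_def)
    have Vw: "V *\<^sub>v w = u"
    proof -
      have "V *\<^sub>v w = (V * V\<^sup>T) *\<^sub>v u"
        using Vc(1) u by (simp add: w_def assoc_mult_mat_vec[of _ k k _ k])
      then show ?thesis using Vc u by simp
    qed
    have "X\<^sup>T * Y = Q1\<^sup>T * (M * Q2)"
      unfolding Q1(2) Q2(2) M_def using c Q1c(1) Q2c(1)
      by (simp add: transpose_mult[of _ n k _ k] assoc_mult_mat[of _ k k _ n _ k] assoc_mult_mat[of _ k n _ k _ k]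
          assoc_mult_mat[of _ k k _ k _ k])
    then have "nsq ((X\<^sup>T * Y) *\<^sub>v v) = nsq (Q1\<^sup>T *\<^sub>v (M *\<^sub>v u))"
      using Q1c(1) Q2c(1) M v by (simp add: u_def assoc_mult_mat_vec[of _ k k _ k] mult_carrier_mat[of _ k k _ k])
    also have "\<dots> = nsq (M *\<^sub>v u)" by (rule nsq_orth[OF orth_mat_transpose[OF Q1(1)]]) (use M u in simp)
    also have "\<dots> = (\<Sum>i<k. (sv M i)\<^sup>2 * (w $ i)\<^sup>2)" using nsq_sv_basis[OF M V d w] Vw by simp
    finally have xy: "nsq ((X\<^sup>T * Y) *\<^sub>v v) = (\<Sum>i<k. (sv M i)\<^sup>2 * (w $ i)\<^sup>2)" .
    have "W *\<^sub>v v = R *\<^sub>v w"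
      using R Vc(1) Q2c(1) v by (simp add: W_def w_def u_def assoc_mult_mat_vec[of _ k k _ k] mult_carrier_mat[of _ k k _ k])
    then have "nsq ((sin_Theta n k S T * W) *\<^sub>v v) = nsq (sin_Theta n k S T *\<^sub>v (R *\<^sub>v w))"
      using orth_matD(1)[OF W] v by (simp add: sin_Theta_def assoc_mult_mat_vec[of _ k k _ k])
    also have "\<dots> = (\<Sum>i<k. (1 - (sv M (k - 1 - i))\<^sup>2) * (w $ (k - 1 - i))\<^sup>2)"
      unfolding st nsq_mat_diag[OF Rw]
    proof (rule sum.cong)
      fix i assume "i \<in> {..<k}"
      then have i: "i < k" "k - 1 - i < k" by auto
      have "(sv M (k - 1 - i))\<^sup>2 \<le> 1"
        using sv1[OF i(2)] sv_nonneg[OF M] by (simp add: power_le_one)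
      then show "(sqrt (1 - (sv M (k - 1 - i))\<^sup>2))\<^sup>2 * ((R *\<^sub>v w) $ i)\<^sup>2 = (1 - (sv M (k - 1 - i))\<^sup>2) * (w $ (k - 1 - i))\<^sup>2"
        using Rv[OF w i(1)] by simp
    qed simp
    also have "\<dots> = (\<Sum>i<k. (1 - (sv M i)\<^sup>2) * (w $ i)\<^sup>2)"
      by (rule rev[of "\<lambda>i. (1 - (sv M i)\<^sup>2) * (w $ i)\<^sup>2"])
    also have "\<dots> = nsq v - nsq ((X\<^sup>T * Y) *\<^sub>v v)"
      unfolding xy nw[symmetric] nsq_sum[OF w] sum_subtractf[symmetric]
      by (rule sum.cong) (auto simp: algebra_simps)
    finally show ?thesis .
  qed
  then show ?thesis using W by blast
qed

section \<open>Assembly of the bound\<close>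

text \<open>\<open>X * Q\<close> with \<open>Q = U\<^sup>T\<close> is inserted between
  \<open>X'\<close> and the member of the family. The remaining factor splits along
  \<open>P'\<close> and \<open>Pc'\<close> because \<open>Q * U\<close> is the identity;
  \<open>X\<close> and \<open>Q\<close> then drop out as isometries, and the alignment of the
  kernels supplies \<open>W\<close>.\<close>

lemma (in aligned_psd_pair_norm) basis_family_decomposition:
  assumes X: "X \<in> carrier_mat n k" "X\<^sup>T * X = 1\<^sub>m k" and X': "X' \<in> carrier_mat n k" and n: "n \<le> N"
    and V1: "V1 \<in> carrier_mat k r" "V1 * V1\<^sup>T = P"
    and V2: "V2 \<in> carrier_mat k (k - r)" "V2\<^sup>T * V2 = 1\<^sub>m (k - r)" "V2 * V2\<^sup>T = Pc"
  shows "\<exists>W. orth_mat (k - r) W \<and> nrm (X' - (X * V1 * V1\<^sup>T + X * V2 * W * V2\<^sup>T))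
    \<le> nrm (X' - X * U\<^sup>T) + nrm (U * P - P') + sqrt 2 * (nrm (Pc' * (U * P)) + nrm (P' * Pc))"
proof -
  define Q where "Q = U\<^sup>T"
  have Q: "orth_mat k Q" unfolding Q_def by (rule orth_mat_transpose[OF U])
  note Qc = orth_matD[OF Q]
  have QU: "Q * U = 1\<^sub>m k" unfolding Q_def by (rule orth_matD(2)[OF U])
  have QT: "Q\<^sup>T = U" by (simp add: Q_def)
  define m where "m = k - r"
  have mN: "m \<le> N" using kN by (simp add: m_def)
  define H where "H = mat k m (\<lambda>(i,j). V' $$ (i, r + j))"
  have H: "H \<in> carrier_mat k m" by (simp add: H_def)
  have H1: "H\<^sup>T * H = 1\<^sub>m m"
    by (rule column_block(1)[OF V', of r m H]) (use r in \<open>auto simp: H_def m_def\<close>)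
  have "H * H\<^sup>T = fc k V' (\<lambda>i. if r \<le> i \<and> i < r + m then 1 else 0)"
    by (rule column_block(2)[OF V', of r m H]) (use r in \<open>auto simp: H_def m_def\<close>)
  also have "\<dots> = Pc'" unfolding Pc'_def by (rule fc_cong[OF V']) (auto simp: m_def)
  finally have HP: "H * H\<^sup>T = Pc'" .
  note V2 = V2[folded m_def]
  have PV2: "1\<^sub>m k - V2 * V2\<^sup>T = P"
    unfolding V2(3) complement by (rule eq_matI) (use carriers in auto)
  obtain W where W: "orth_mat m W" and rot: "nrm (Q * (H * H\<^sup>T) - V2 * W * V2\<^sup>T)
     \<le> sqrt 2 * nrm ((1\<^sub>m k - V2 * V2\<^sup>T) * (Q * H))
       + sqrt 2 * nrm ((1\<^sub>m k - V2 * V2\<^sup>T) * H)"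
    using complement_rotation[OF V2(1,2) H H1 Q kN mN] by blast
  note Wc = orth_matD(1)[OF W]
  \<comment> \<open>Multiplying by \<open>H\<^sup>T\<close> and transposing turns the sines of a
    kernel basis into an off-diagonal block; the same is done for \<open>n2\<close>.\<close>
  have n1: "nrm (P * (Q * H)) = nrm (Pc' * (U * P))"
  proof -
    have "nrm (P * (Q * H)) = nrm ((P * (Q * H)) * H\<^sup>T)"
      by (rule nrm_isometry_right[OF H H1, symmetric]) (use Qc(1) H carriers kN mN in auto)
    also have "(P * (Q * H)) * H\<^sup>T = P * (Q * Pc')"
      unfolding HP[symmetric] using Qc(1) H carriers
      by (simp add: assoc_mult_mat[of _ k k _ m _ k] assoc_mult_mat[of _ k k _ k _ k] mult_carrier_mat[of _ k k _ m])
    also have "nrm \<dots> = nrm ((P * (Q * Pc'))\<^sup>T)"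
      by (rule nrm_transpose[symmetric, OF _ kN kN]) (use Qc(1) in \<open>simp add: square_simps\<close>)
    also have "(P * (Q * Pc'))\<^sup>T = Pc' * (U * P)"
      using Qc(1) by (simp add: square_simps transpose_mult[of _ k k _ k] transposes QT)
    finally show ?thesis .
  qed
  have n2: "nrm (P * H) = nrm (P' * Pc)"
  proof -
    have "nrm (P * H) = nrm ((P * H) * H\<^sup>T)"
      by (rule nrm_isometry_right[OF H H1, symmetric]) (use H carriers kN mN in auto)
    also have "(P * H) * H\<^sup>T = P * Pc'"
      unfolding HP[symmetric] using H carriers by (simp add: assoc_mult_mat[of _ k k _ m _ k])
    also have "nrm \<dots> = nrm ((P * Pc')\<^sup>T)"
      by (rule nrm_transpose[symmetric, OF _ kN kN]) (simp add: square_simps)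
    also have "(P * Pc')\<^sup>T = Pc' * P" by (simp add: square_simps transpose_mult[of _ k k _ k] transposes)
    finally show ?thesis by (simp only: nrm_Pc'_P)
  qed
  define Z where "Z = V2 * W * V2\<^sup>T"
  have Z: "Z \<in> carrier_mat k k" using V2 Wc by (auto simp: Z_def)
  have QZ: "Q * Pc' - Z \<in> carrier_mat k k" "Q * (P' - U * P) \<in> carrier_mat k k"
    using Qc(1) Z by (simp_all add: square_simps)
  have rot': "nrm (Q * Pc' - Z) \<le> sqrt 2 * (nrm (Pc' * (U * P)) + nrm (P' * Pc))"
    using rot unfolding HP PV2 n1 n2 Z_def[symmetric] by (simp add: algebra_simps)
  have YZ: "X * V1 * V1\<^sup>T + X * V2 * W * V2\<^sup>T = X * P + X * Z"
    unfolding V1(2)[symmetric] Z_def using X V1(1) V2(1) Wc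
    by (simp add: assoc_mult_mat[of _ n k _ r _ k] assoc_mult_mat[of _ n k _ m _ m] assoc_mult_mat[of _ n m _ m _ k]
        assoc_mult_mat[of _ k m _ m _ k] assoc_mult_mat[of _ n k _ m _ k] mult_carrier_mat[of _ k m _ m] mult_carrier_mat[of _ m m _ k])
  have QP: "Q * (P' - U * P) + (Q * Pc' - Z) = Q - P - Z"
  proof -
    have "Q * (P' - U * P) = Q * P' - (Q * U) * P" using Qc(1) by (simp add: square_simps)
    then have "Q * (P' - U * P) = Q * P' - P" using QU carriers by simp
    moreover have "Q * Pc' = Q - Q * P'"
      unfolding complement using Qc(1) by (simp add: square_simps right_mult_one_mat[of _ k k])
    moreover have "(y - p) + ((q - y) - z) = q - p - z"
      if "y \<in> carrier_mat k k" "p \<in> carrier_mat k k" "q \<in> carrier_mat k k" "z \<in> carrier_mat k k" for y p q z :: "real mat"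
      by (rule eq_matI) (use that in auto)
    ultimately show ?thesis using Qc(1) Z carriers by simp
  qed
  have alg: "a - (p + z) = (a - q) + (q - p - z)"
    if "a \<in> carrier_mat n k" "p \<in> carrier_mat n k" "q \<in> carrier_mat n k" "z \<in> carrier_mat n k" for a p q z :: "real mat"
    by (rule eq_matI) (use that in auto)
  have XX: "X * (Q * (P' - U * P) + (Q * Pc' - Z)) = X * Q - X * P - X * Z"
    unfolding QP using X Qc(1) Z carriers
    by (simp add: mult_minus_distrib_mat[of _ n k _ k] minus_carrier_mat[of _ k k])
  have "X' - (X * V1 * V1\<^sup>T + X * V2 * W * V2\<^sup>T)
      = (X' - X * Q) + X * (Q * (P' - U * P) + (Q * Pc' - Z))"
    unfolding YZ XX by (rule alg) (use X X' Qc(1) Z carriers in auto)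
  also have "nrm \<dots> \<le> nrm (X' - X * Q) + nrm (X * (Q * (P' - U * P) + (Q * Pc' - Z)))"
    by (rule nrm_add[of _ n k]) (use X X' Qc(1) QZ n kN in \<open>auto intro!: minus_carrier_mat mult_carrier_mat[of _ n k _ k] add_carrier_mat\<close>)
  also have "nrm (X * (Q * (P' - U * P) + (Q * Pc' - Z))) = nrm (Q * (P' - U * P) + (Q * Pc' - Z))"
    by (rule nrm_isometry_left[OF X _ n kN kN]) (use QZ in simp)
  also have "\<dots> \<le> nrm (Q * (P' - U * P)) + nrm (Q * Pc' - Z)"
    by (rule nrm_add[OF QZ(2,1) kN kN])
  also have "nrm (Q * (P' - U * P)) = nrm (P' - U * P)"
    by (rule nrm_orth_left[OF Q _ kN kN]) (simp add: square_simps)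
  also have "\<dots> = nrm (- (P' - U * P))"
    by (rule nrm_uminus[symmetric, OF _ kN kN]) (simp add: square_simps)
  also have "- (P' - U * P) = U * P - P'"
  proof -
    have "- (y - z) = z - y" if "y \<in> carrier_mat k k" "z \<in> carrier_mat k k" for y z :: "real mat"
      by (rule eq_matI) (use that in auto)
    then show ?thesis by (simp add: square_simps)
  qed
  finally show ?thesis using rot' W unfolding m_def[symmetric] Q_def[symmetric]
    by (intro exI[of _ W]) auto
qed

text \<open>By Pythagoras the part of \<open>Y *\<^sub>v v\<close> orthogonal to the columns of
  \<open>X\<close> is exactly as long as the image of \<open>v\<close> under
  \<open>sin_Theta\<close> times an orthogonal matrix.\<close>

lemma (in monotone_matrix_norm) nrm_alignment_le_sin_Theta:
  assumes X: "orthonormal_basis_mat n k S X" and Y: "orthonormal_basis_mat n k T Y" and N: "n \<le> N" "k \<le> N"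
    and Q: "Q \<in> carrier_mat k k"
    and le: "\<And>v. v \<in> carrier_vec k \<Longrightarrow>
      nsq ((Y - X * Q) *\<^sub>v v) \<le> 2 * nsq ((1\<^sub>m n - X * X\<^sup>T) *\<^sub>v (Y *\<^sub>v v))"
  shows "nrm (Y - X * Q) \<le> sqrt 2 * nrm (sin_Theta n k S T)"
proof -
  have Xc: "X \<in> carrier_mat n k" "X\<^sup>T * X = 1\<^sub>m k"
    and Yc: "Y \<in> carrier_mat n k" "Y\<^sup>T * Y = 1\<^sub>m k"
    using X Y unfolding orthonormal_basis_mat_def by auto
  obtain W where W: "orth_mat k W" and gram: "\<And>v. v \<in> carrier_vec k \<Longrightarrow>
      nsq ((sin_Theta n k S T * W) *\<^sub>v v) = nsq v - nsq ((X\<^sup>T * Y) *\<^sub>v v)"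
    using sin_Theta_gram[OF X Y] by blast
  have st: "sin_Theta n k S T \<in> carrier_mat k k" by (simp add: sin_Theta_def)
  have "nrm (Y - X * Q) \<le> sqrt 2 * nrm (sin_Theta n k S T * W)"
  proof (rule nrm_sqrt2_le[of _ n k _ k])
    fix v :: "real vec" assume v: "v \<in> carrier_vec k"
    have Yv: "Y *\<^sub>v v \<in> carrier_vec n" using Yc v by simp
    have "nsq ((1\<^sub>m n - X * X\<^sup>T) *\<^sub>v (Y *\<^sub>v v)) = nsq ((sin_Theta n k S T * W) *\<^sub>v v)"
      using nsq_projection_complement[OF Xc Yv] nsq_isometry[OF Yc v] gram[OF v] Xc Yc v
      by (simp add: assoc_mult_mat_vec[of _ k n _ k])
    then show "nsq ((Y - X * Q) *\<^sub>v v) \<le> 2 * nsq ((sin_Theta n k S T * W) *\<^sub>v v)" using le[OF v] by simp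
  qed (use Xc Yc Q st orth_matD(1)[OF W] N in \<open>auto intro!: minus_carrier_mat mult_carrier_mat[of _ n k _ k]\<close>)
  also have "nrm (sin_Theta n k S T * W) = nrm (sin_Theta n k S T)"
    by (rule nrm_orth_right[OF W st N(2,2)])
  finally show ?thesis .
qed

lemma append_cols_index:
  assumes "V1 \<in> carrier_mat k r" "V2 \<in> carrier_mat k m" "i < k" "j < r + m"
  shows "append_cols V1 V2 $$ (i,j) = (if j < r then V1 $$ (i,j) else V2 $$ (i, j - r))"
  using assms by (simp add: append_cols_def)

lemma append_cols_carrier:
  "V1 \<in> carrier_mat k r \<Longrightarrow> V2 \<in> carrier_mat k m \<Longrightarrow> append_cols V1 V2 \<in> carrier_mat k (r + m)"
  unfolding append_cols_def using four_block_carrier_mat[of V1 k r "0\<^sub>m 0 (dim_col V2)" 0 m] by simp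

theorem theorem3p1:
  fixes n k r :: nat
    and D X X' V1 V2 :: "real mat"
    and \<X> \<X>' :: "real vec set"
    and \<sigma> \<sigma>' :: "real list"
  assumes "1 \<le> k" and "k \<le> n"
    and "D \<in> carrier_mat n k"
    and "subspace_of_dim n k \<X>" and "subspace_of_dim n k \<X>'"
    and "orthonormal_basis_mat n k \<X> X" and "orthonormal_basis_mat n k \<X>' X'"
    and "psd (transpose_mat X * D)" and "psd (transpose_mat X' * D)"
    and "vec_space.rank k (transpose_mat X * D) = r"
    and "vec_space.rank k (transpose_mat X' * D) = r"
    and "1 \<le> r"
    and "\<sigma> = nonzero_singular_values (transpose_mat X * D)"
    and "\<sigma>' = nonzero_singular_values (transpose_mat X' * D)"
    and "V1 \<in> carrier_mat k r" and "V2 \<in> carrier_mat k (k - r)"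
    and "transpose_mat (append_cols V1 V2) * append_cols V1 V2 = 1\<^sub>m k"
    and "transpose_mat X * D =
           append_cols V1 V2
           * four_block_mat (mat_diag r (\<lambda>i. \<sigma> ! i)) (0\<^sub>m r (k - r))
                            (0\<^sub>m (k - r) r)           (0\<^sub>m (k - r) (k - r))
           * transpose_mat (append_cols V1 V2)"
  shows "(\<forall>N \<Phi>. n \<le> N \<and> symmetric_gauge N \<Phi> \<longrightarrow>
            minimum_le (\<lambda>Y. ui_norm N \<Phi> (X' - Y)) (basis_family (k - r) X V1 V2)
              ((if r = k
                then sqrt 2 * (1 + 2 * spectral_norm D / (\<sigma> ! (k - 1) + \<sigma>' ! (k - 1)))
                else sqrt 2 * (1 + 2 * spectral_norm D / (\<sigma> ! (r - 1) + \<sigma>' ! (r - 1)))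
                     + (2 * sqrt 2 + 4) * spectral_norm D / max (\<sigma> ! (r - 1)) (\<sigma>' ! (r - 1)))
               * ui_norm N \<Phi> (sin_Theta n k \<X> \<X>')))
       \<and> (r < k \<longrightarrow>
            minimum_le (\<lambda>Y. frobenius_norm (X' - Y)) (basis_family (k - r) X V1 V2)
              ((sqrt 2 * (1 + 2 * spectral_norm D / (\<sigma> ! (r - 1) + \<sigma>' ! (r - 1)))
                + 4 * spectral_norm D / max (\<sigma> ! (r - 1)) (\<sigma>' ! (r - 1)))
               * frobenius_norm (sin_Theta n k \<X> \<X>')))
       \<and> (r < k \<longrightarrow>
            minimum_le (\<lambda>Y. spectral_norm (X' - Y)) (basis_family (k - r) X V1 V2)
              ((sqrt 2
                + sqrt (8 * (spectral_norm D)\<^sup>2 / (\<sigma> ! (r - 1) + \<sigma>' ! (r - 1))\<^sup>2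
                        + 4 * (spectral_norm D)\<^sup>2 / (max (\<sigma> ! (r - 1)) (\<sigma>' ! (r - 1)))\<^sup>2)
                + 4 * spectral_norm D / max (\<sigma> ! (r - 1)) (\<sigma>' ! (r - 1)))
               * spectral_norm (sin_Theta n k \<X> \<X>')))"
  proof -
  note k = assms(1,2) and D = assms(3) and bX = assms(6) and bX' = assms(7) and r1 = assms(12)
    and V1 = assms(15) and V2 = assms(16)
  have X: "X \<in> carrier_mat n k" "X\<^sup>T * X = 1\<^sub>m k"
    and X': "X' \<in> carrier_mat n k" "X'\<^sup>T * X' = 1\<^sub>m k"
    using bX bX' unfolding orthonormal_basis_mat_def by auto
  define B where "B = X\<^sup>T * D"
  define B' where "B' = X'\<^sup>T * D"
  have B: "B \<in> carrier_mat k k" "psd B" and B': "B' \<in> carrier_mat k k" "psd B'"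
    using X X' D assms(8,9) by (auto simp: B_def B'_def)
  have rk: "vec_space.rank k B = r" "vec_space.rank k B' = r" using assms(10,11) by (simp_all add: B_def B'_def)
  note R = psd_rank[OF B, unfolded rk] and R' = psd_rank[OF B', unfolded rk]
  have \<sigma>: "\<sigma> = map (sv B) [0..<r]" and \<sigma>': "\<sigma>' = map (sv B') [0..<r]"
    using assms(13,14) nonzero_singular_values_psd[OF B] nonzero_singular_values_psd[OF B'] rk
    by (simp_all add: B_def B'_def)
  have rk': "r \<le> k" by (rule R(1))
  define V where "V = append_cols V1 V2"
  have V: "orth_mat k V"
    using append_cols_carrier[OF V1 V2] rk' assms(17) by (simp add: orth_mat_def V_def)
  \<comment> \<open>Any eigenbasis of \<open>B'\<close> will do, whereas that of \<open>B\<close> is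
    the given \<open>[V1, V2]\<close>, on which the family depends.\<close>
  obtain V' where V': "orth_mat k V'" and B'_eq: "B' = fc k V' (sv B')"
    using psd_eq_fc_sv[OF B'] by blast
  define a where "a i = (if i < r then \<sigma> ! i else 0)" for i
  define s where "s = \<sigma> ! (r - 1)"
  define s' where "s' = \<sigma>' ! (r - 1)"
  have s: "s = sv B (r - 1)" "s' = sv B' (r - 1)" using r1 by (simp_all add: s_def s'_def \<sigma> \<sigma>')
  have spos: "0 < s" "0 < s'" using R(2) R'(2) r1 by (simp_all add: s)
  have B_eq: "B = fc k V a"
  proof -
    have "four_block_mat (mat_diag r (\<lambda>i. \<sigma> ! i)) (0\<^sub>m r (k - r)) (0\<^sub>m (k - r) r) (0\<^sub>m (k - r) (k - r))
        = mat_diag k a"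
      using rk' by (intro eq_matI) (auto simp: mat_diag_def a_def)
    then show ?thesis using assms(18) by (simp add: B_def V_def fc_def)
  qed
  obtain Q where Q: "orth_mat k Q" and polar: "\<And>v. v \<in> carrier_vec k \<Longrightarrow>
      nsq ((X' - X * Q) *\<^sub>v v) \<le> 2 * nsq ((1\<^sub>m n - X * X\<^sup>T) *\<^sub>v (X' *\<^sub>v v))"
    using polar_alignment[OF X X'] by blast
  note Qc = orth_matD[OF Q]
  define U where "U = Q\<^sup>T"
  have U: "orth_mat k U" and UT: "U\<^sup>T = Q" using orth_mat_transpose[OF Q] by (simp_all add: U_def)
  interpret aligned_psd_pair k r V V' U a "sv B'" s s'
  proof
    show "orth_mat k U" by (rule U)
    show "s \<le> a i" if "i < r" for i
      using that sv_antimono[OF B(1), of i "r - 1"] by (simp add: a_def \<sigma> s)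
    show "s' \<le> sv B' i" if "i < r" for i
      using that sv_antimono[OF B'(1), of i "r - 1"] by (simp add: s)
  qed (use V V' rk' R'(3) spos in \<open>auto simp: a_def\<close>)
  have E: "E = (X * Q - X')\<^sup>T * D"
  proof -
    have "(X * Q - X')\<^sup>T * D = U * (X\<^sup>T * D) - X'\<^sup>T * D"
      using X(1) X'(1) D Qc(1)
      by (simp add: U_def transpose_minus[of _ n k] transpose_mult[of _ n k _ k] minus_mult_distrib_mat[of _ k n _ _ k]
          assoc_mult_mat[of _ k k _ n _ k] mult_carrier_mat[of _ k k _ n])
    then show ?thesis
      unfolding E_def A_def A'_def B_eq[symmetric] B'_eq[symmetric] unfolding B_def B'_def by simp
  qed
  have V1V: "V1 $$ (i,j) = V $$ (i, 0 + j)" if "i < k" "j < r" for i j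
    using append_cols_index[OF V1 V2, of i j] that rk' by (simp add: V_def)
  have V2V: "V2 $$ (i,j) = V $$ (i, r + j)" if "i < k" "j < k - r" for i j
    using append_cols_index[OF V1 V2, of i "r + j"] that rk' by (simp add: V_def)
  have V1P: "V1 * V1\<^sup>T = P"
    using column_block(2)[OF V _ V1 V1V] rk' by (simp add: P_def)
  have V2_1: "V2\<^sup>T * V2 = 1\<^sub>m (k - r)"
    by (rule column_block(1)[OF V _ V2 V2V]) (use rk' in auto)
  have V2P: "V2 * V2\<^sup>T = Pc"
  proof -
    have "V2 * V2\<^sup>T = fc k V (\<lambda>i. if r \<le> i \<and> i < r + (k - r) then 1 else 0)"
      by (rule column_block(2)[OF V _ V2 V2V]) (use rk' in auto)
    also have "\<dots> = Pc" unfolding Pc_def by (rule fc_cong[OF V]) (use rk' in auto)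
    finally show ?thesis .
  qed
  define d where "d = spectral_norm D"
  have d0: "0 \<le> d" unfolding d_def by (rule spectral_norm_nonneg)
  define S where "S = sin_Theta n k \<X> \<X>'"
  have Sc: "S \<in> carrier_mat k k" by (simp add: S_def sin_Theta_def)
  define M where "M = max s s'"
  have M: "0 < M" using spos by (simp add: M_def)
  \<comment> \<open>The threshold \<open>c\<close> stays free, so that each of the three norms has
    only to estimate \<open>U * P - P'\<close>.\<close>
  have common: "aligned_psd_pair_norm k r V V' U a (sv B') s s' nrm N \<and>
      nrm E \<le> sqrt 2 * d * nrm S \<and> nrm T \<le> 2 * sqrt 2 * d * nrm S / (s + s') \<and>
      nrm (P' * Pc) \<le> sqrt 2 * d * nrm S / M \<and> nrm (Pc' * (U * P)) \<le> sqrt 2 * d * nrm S / M \<and>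
      sqrt 2 * (nrm (Pc' * (U * P)) + nrm (P' * Pc)) \<le> 4 * d * nrm S / M \<and>
      (\<forall>c. sqrt 2 * nrm S + nrm (U * P - P')
            + sqrt 2 * (nrm (Pc' * (U * P)) + nrm (P' * Pc)) \<le> c \<longrightarrow>
         minimum_le (\<lambda>Y. nrm (X' - Y)) (basis_family (k - r) X V1 V2) c)"
    if "monotone_matrix_norm nrm N" "n \<le> N" for nrm N
  proof -
    interpret monotone_matrix_norm nrm N by (rule that(1))
    have N: "n \<le> N" "k \<le> N" "k - r \<le> N" using that(2) k by auto
    interpret aligned_psd_pair_norm k r V V' U a "sv B'" s s' nrm N
      by unfold_locales (rule N(2))
    have align: "nrm (X' - X * Q) \<le> sqrt 2 * nrm S"
      unfolding S_def by (rule nrm_alignment_le_sin_Theta[OF bX bX' N(1,2) Qc(1) polar])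
    have XQ: "X * Q - X' \<in> carrier_mat n k" using X'(1) by (rule minus_carrier_mat)
    have "nrm E \<le> d * nrm (X * Q - X')"
      unfolding E d_def by (rule nrm_mult_spectral_norm[OF XQ D N(1,2,2)])
    also have "nrm (X * Q - X') = nrm (- (X * Q - X'))" by (rule nrm_uminus[symmetric, OF XQ N(1,2)])
    also have "- (X * Q - X') = X' - X * Q"
      by (rule eq_matI) (use X(1) X'(1) Qc(1) in auto)
    also have "d * nrm (X' - X * Q) \<le> d * (sqrt 2 * nrm S)" by (rule mult_left_mono[OF align d0])
    finally have e: "nrm E \<le> sqrt 2 * d * nrm S" by (simp add: mult_ac)
    obtain W where W: "orth_mat (k - r) W" and le: "nrm (X' - (X * V1 * V1\<^sup>T + X * V2 * W * V2\<^sup>T))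
        \<le> nrm (X' - X * Q) + nrm (U * P - P')
          + sqrt 2 * (nrm (Pc' * (U * P)) + nrm (P' * Pc))"
      using basis_family_decomposition[OF X X'(1) N(1) V1 V1P V2 V2_1 V2P] unfolding UT by auto
    have "minimum_le (\<lambda>Y. nrm (X' - Y)) (basis_family (k - r) X V1 V2) c"
      if "sqrt 2 * nrm S + nrm (U * P - P')
            + sqrt 2 * (nrm (Pc' * (U * P)) + nrm (P' * Pc)) \<le> c" for c
      by (rule attains_min_on_basis_family[OF X X'(1) V1 V2 V2_1 N W]) (use le align that in linarith)
    moreover have "nrm T \<le> 2 * sqrt 2 * d * nrm S / (s + s')"
    proof -
      have "nrm T \<le> 2 * nrm E / (s + s')" by (rule T_bound_E)
      also have "\<dots> \<le> 2 * (sqrt 2 * d * nrm S) / (s + s')"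
        using e spos by (intro divide_right_mono mult_left_mono) auto
      finally show ?thesis by simp
    qed
    moreover have xy: "nrm (P' * Pc) \<le> sqrt 2 * d * nrm S / M" "nrm (Pc' * (U * P)) \<le> sqrt 2 * d * nrm S / M"
      using offdiagonal_bounds_max divide_right_mono[OF e, of M] M unfolding M_def by auto
    moreover have "sqrt 2 * (nrm (Pc' * (U * P)) + nrm (P' * Pc)) \<le> 4 * d * nrm S / M"
    proof -
      \<comment> \<open>The 4 is sqrt 2 from the kernel alignment, times sqrt 2 from the error
        bound, times two blocks.\<close>
      have "sqrt 2 * (nrm (Pc' * (U * P)) + nrm (P' * Pc)) \<le> sqrt 2 * (2 * (sqrt 2 * d * nrm S / M))"
        unfolding mult_2 by (intro mult_left_mono add_mono xy) simp
      also have "\<dots> = 4 * d * nrm S / M" by simp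
      finally show ?thesis .
    qed
    ultimately show ?thesis using e aligned_psd_pair_norm_axioms by blast
  qed
  have ui: "minimum_le (\<lambda>Y. ui_norm N \<Phi> (X' - Y)) (basis_family (k - r) X V1 V2)
      ((if r = k then sqrt 2 * (1 + 2 * d / (s + s'))
        else sqrt 2 * (1 + 2 * d / (s + s')) + (2 * sqrt 2 + 4) * d / M) * ui_norm N \<Phi> S)"
    if N: "n \<le> N" and G: "symmetric_gauge N \<Phi>" for N \<Phi>
  proof -
    note C = common[OF ui_norm_monotone_matrix_norm[OF G] N]
    interpret aligned_psd_pair_norm k r V V' U a "sv B'" s s' "ui_norm N \<Phi>" N
      using C by blast
    define \<nu> where "\<nu> = ui_norm N \<Phi>"
    have t: "\<nu> T \<le> 2 * sqrt 2 * d * \<nu> S / (s + s')"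
      and xy: "\<nu> (P' * Pc) \<le> sqrt 2 * d * \<nu> S / M" "\<nu> (Pc' * (U * P)) \<le> sqrt 2 * d * \<nu> S / M"
      and sum: "sqrt 2 * (\<nu> (Pc' * (U * P)) + \<nu> (P' * Pc)) \<le> 4 * d * \<nu> S / M"
      using C unfolding \<nu>_def by blast+
    have UP: "\<nu> (U * P - P') \<le> \<nu> T + \<nu> (P' * Pc) + \<nu> (Pc' * (U * P))"
      unfolding \<nu>_def by (rule UP_minus_P'_bound)
    show ?thesis
    proof (cases "r = k")
      case True
      \<comment> \<open>For \<open>r = k\<close> both kernels are trivial, so only \<open>T\<close>
        contributes.\<close>
      have "Pc = 0\<^sub>m k k" unfolding Pc_def by (rule fc_zero[OF V]) (use True in simp)
      moreover have "Pc' = 0\<^sub>m k k" unfolding Pc'_def by (rule fc_zero[OF V']) (use True in simp)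
      ultimately have "P' * Pc = 0\<^sub>m k k" "Pc' * (U * P) = 0\<^sub>m k k"
        using carriers by (simp_all add: mult_carrier_mat[of _ k k _ k])
      then have z: "\<nu> (P' * Pc) = 0" "\<nu> (Pc' * (U * P)) = 0"
        using nrm_zero[OF kN kN] by (simp_all add: \<nu>_def)
      have "sqrt 2 * \<nu> S + \<nu> (U * P - P')
            + sqrt 2 * (\<nu> (Pc' * (U * P)) + \<nu> (P' * Pc))
          \<le> sqrt 2 * (1 + 2 * d / (s + s')) * \<nu> S"
        using UP t unfolding z by (simp add: algebra_simps)
      then show ?thesis using C True by (simp add: \<nu>_def)
    next
      case False
      have "sqrt 2 * \<nu> S + \<nu> (U * P - P')
            + sqrt 2 * (\<nu> (Pc' * (U * P)) + \<nu> (P' * Pc))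
          \<le> sqrt 2 * \<nu> S + 2 * sqrt 2 * d * \<nu> S / (s + s') + 2 * (sqrt 2 * d * \<nu> S / M) + 4 * d * \<nu> S / M"
        using UP t xy sum unfolding mult_2[of "sqrt 2 * d * \<nu> S / M"] by linarith
      also have "\<dots> = (sqrt 2 * (1 + 2 * d / (s + s')) + (2 * sqrt 2 + 4) * d / M) * \<nu> S"
        by (simp add: algebra_simps add_divide_distrib)
      finally show ?thesis using C False by (simp add: \<nu>_def)
    qed
  qed
  have fro: "minimum_le (\<lambda>Y. frobenius_norm (X' - Y)) (basis_family (k - r) X V1 V2)
      ((sqrt 2 * (1 + 2 * d / (s + s')) + 4 * d / M) * frobenius_norm S)"
  proof -
    note C = common[OF frobenius_norm_monotone_matrix_norm order_refl]
    define \<nu> where "\<nu> = frobenius_norm"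
    have e: "\<nu> E \<le> sqrt 2 * d * \<nu> S" using C by (simp add: \<nu>_def)
    have sum: "sqrt 2 * (\<nu> (Pc' * (U * P)) + \<nu> (P' * Pc)) \<le> 4 * d * \<nu> S / M"
      using C unfolding \<nu>_def by blast
    have UP: "\<nu> (U * P - P') \<le> 2 * sqrt 2 * d * \<nu> S / (s + s')"
    proof -
      have "\<nu> (U * P - P') \<le> 2 * \<nu> E / (s + s')" unfolding \<nu>_def by (rule frobenius_bound)
      also have "\<dots> \<le> 2 * (sqrt 2 * d * \<nu> S) / (s + s')"
        using e spos by (intro divide_right_mono mult_left_mono) auto
      finally show ?thesis by simp
    qed
    have "sqrt 2 * \<nu> S + \<nu> (U * P - P')
          + sqrt 2 * (\<nu> (Pc' * (U * P)) + \<nu> (P' * Pc))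
        \<le> sqrt 2 * \<nu> S + 2 * sqrt 2 * d * \<nu> S / (s + s') + 4 * d * \<nu> S / M"
      using UP sum by linarith
    also have "\<dots> = (sqrt 2 * (1 + 2 * d / (s + s')) + 4 * d / M) * \<nu> S"
      by (simp add: algebra_simps)
    finally show ?thesis using C by (simp add: \<nu>_def)
  qed
  have spe: "minimum_le (\<lambda>Y. spectral_norm (X' - Y)) (basis_family (k - r) X V1 V2)
      ((sqrt 2 + sqrt (8 * d\<^sup>2 / (s + s')\<^sup>2 + 4 * d\<^sup>2 / M\<^sup>2) + 4 * d / M) * spectral_norm S)"
  proof -
    note C = common[OF spectral_norm_monotone_matrix_norm order_refl]
    define \<nu> where "\<nu> = spectral_norm"
    have nn: "0 \<le> \<nu> Z" for Z unfolding \<nu>_def by (rule spectral_norm_nonneg)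
    have t: "\<nu> T \<le> 2 * sqrt 2 * d * \<nu> S / (s + s')"
      and xy: "\<nu> (P' * Pc) \<le> sqrt 2 * d * \<nu> S / M" "\<nu> (Pc' * (U * P)) \<le> sqrt 2 * d * \<nu> S / M"
      and sum: "sqrt 2 * (\<nu> (Pc' * (U * P)) + \<nu> (P' * Pc)) \<le> 4 * d * \<nu> S / M"
      using C unfolding \<nu>_def by blast+
    have "(\<nu> (U * P - P'))\<^sup>2 \<le> (\<nu> T)\<^sup>2 + (\<nu> (P' * Pc))\<^sup>2 + (\<nu> (Pc' * (U * P)))\<^sup>2"
      unfolding \<nu>_def by (rule spectral_bound)
    \<comment> \<open>The 8 is the square of 2 sqrt 2 from \<open>T\<close>; the 4 is 2 + 2 from the
      two off-diagonal blocks.\<close>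
    also have "\<dots> \<le> (2 * sqrt 2 * d * \<nu> S / (s + s'))\<^sup>2 + (sqrt 2 * d * \<nu> S / M)\<^sup>2 + (sqrt 2 * d * \<nu> S / M)\<^sup>2"
      by (intro add_mono power_mono t xy nn)
    also have "\<dots> = (8 * d\<^sup>2 / (s + s')\<^sup>2 + 4 * d\<^sup>2 / M\<^sup>2) * (\<nu> S)\<^sup>2"
      by (simp add: power_divide power_mult_distrib algebra_simps)
    finally have "\<nu> (U * P - P') \<le> sqrt ((8 * d\<^sup>2 / (s + s')\<^sup>2 + 4 * d\<^sup>2 / M\<^sup>2) * (\<nu> S)\<^sup>2)"
      by (rule real_le_rsqrt)
    also have "\<dots> = sqrt (8 * d\<^sup>2 / (s + s')\<^sup>2 + 4 * d\<^sup>2 / M\<^sup>2) * \<nu> S"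
      using nn[of S] by (simp add: real_sqrt_mult)
    finally have UP: "\<nu> (U * P - P') \<le> sqrt (8 * d\<^sup>2 / (s + s')\<^sup>2 + 4 * d\<^sup>2 / M\<^sup>2) * \<nu> S" .
    have "sqrt 2 * \<nu> S + \<nu> (U * P - P')
          + sqrt 2 * (\<nu> (Pc' * (U * P)) + \<nu> (P' * Pc))
        \<le> sqrt 2 * \<nu> S + sqrt (8 * d\<^sup>2 / (s + s')\<^sup>2 + 4 * d\<^sup>2 / M\<^sup>2) * \<nu> S + 4 * d * \<nu> S / M"
      using UP sum by linarith
    also have "\<dots> = (sqrt 2 + sqrt (8 * d\<^sup>2 / (s + s')\<^sup>2 + 4 * d\<^sup>2 / M\<^sup>2) + 4 * d / M) * \<nu> S"
      by (simp add: algebra_simps)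
    finally show ?thesis using C by (simp add: \<nu>_def)
  qed
  \<comment> \<open>For \<open>r = k\<close> the index \<open>k - 1\<close> is the index
    \<open>r - 1\<close> at which \<open>s\<close> and \<open>s'\<close> were taken.\<close>
  have "minimum_le (\<lambda>Y. ui_norm N \<Phi> (X' - Y)) (basis_family (k - r) X V1 V2)
      ((if r = k then sqrt 2 * (1 + 2 * d / (\<sigma> ! (k - 1) + \<sigma>' ! (k - 1)))
        else sqrt 2 * (1 + 2 * d / (s + s')) + (2 * sqrt 2 + 4) * d / M) * ui_norm N \<Phi> S)"
    if "n \<le> N" "symmetric_gauge N \<Phi>" for N \<Phi>
    using ui[OF that] by (auto simp: s_def s'_def)
  then show ?thesis
    using fro spe unfolding d_def S_def M_def s_def s'_def by blast
qed

end
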